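(* Let $\Bbbk$ be a field. (1) Let $R$ be a cyclotomic standard graded $\Bbbk$-algebra with $h$-polynomial $h_R(t)$. If $h_R(1)\in\{1,4,6\}$ or $h_R(1)$ is a prime number, then $h_R(t)$ is of type CI. (2) Let $n\ge 8$ be an integer that is not prime. Then there exists a cyclotomic standard graded $\Bbbk$-algebra $R$ such that $h_R(1)=n$ and $h_R(t)$ is not of type CI.
   Context: A standard graded $\Bbbk$-algebra is a commutative graded $\Bbbk$-algebra $R=\bigoplus_{n\ge 0}R_n$ with $R_0=\Bbbk$ that is generated as a $\Bbbk$-algebra by finitely many elements of degree one. Its Hilbert series $\sum_{n\ge0}(\dim_{\Bbbk}R_n)t^n$ can be written uniquely as $h_R(t)/(1-t)^d$, where $d$ is the Krull dimension of $R$ and $h_R(t)\in\mathbb{Z}[t]$ satisfies $h_R(1)>0$; the polynomial $h_R(t)$ is called the $h$-polynomial of $R$. The algebra $R$ is called cyclotomic if all complex roots of $h_R(t)$ lie on the unit circle. For a positive integer $m$, put $\Psi_m(t)=1+t+\cdots+t^{m-1}$. A polynomial is of type CI if it can be written as a finite product $\prod_{i=1}^r\Psi_{m_i}(t)$ with $r\ge0$ and positive integers $m_1,\dots,m_r$ (the empty product being $1$). *)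

theory Defs
  imports
    "HOL-Algebra.Generated_Rings"
    "HOL-Library.Multiset"
    "HOL-Library.Extended_Nat"
    "HOL-Computational_Algebra.Computational_Algebra"
    "Jordan_Normal_Form.Missing_VectorSpace"
begin

text \<open>
  A graded algebra is a pair of an algebra \<open>R\<close> over \<open>K\<close> (HOL-Algebra's locale \<^locale>\<open>algebra\<close>,
  which includes commutativity) and a function \<open>A\<close> giving its homogeneous components.
  The \<open>\<exists>!\<close> condition says that \<open>R\<close> is the direct sum of the \<open>A n\<close>. The qualified name
  \<open>Module.submodule\<close> is HOL-Algebra's locale; the unqualified one is that of AFP VectorSpace.

  Where existence of a graded \<open>K\<close>-algebra is asserted, the carrier type has to be named;
  \<open>nat multiset \<Rightarrow> 'k\<close> (functions from monomials in variables \<open>x\<^sub>0, x\<^sub>1, \<dots>\<close> to the type of \<open>K\<close>)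
  suffices for every finitely generated \<open>K\<close>-algebra up to isomorphism, because residue classes
  of monomials contain a \<open>K\<close>-basis.
\<close>

definition graded_algebra ::
    "('k, 'm) ring_scheme \<Rightarrow> ('k, 'a) module \<Rightarrow> (nat \<Rightarrow> 'a set) \<Rightarrow> bool" where
  "graded_algebra K R A \<longleftrightarrow>
     algebra K R \<and>
     (\<forall>n. Module.submodule (A n) K R) \<and>
     (\<forall>i j. \<forall>x \<in> A i. \<forall>y \<in> A j. x \<otimes>\<^bsub>R\<^esub> y \<in> A (i + j)) \<and>
     (\<forall>x \<in> carrier R. \<exists>!f. (\<forall>n. f n \<in> A n) \<and> finite {n. f n \<noteq> \<zero>\<^bsub>R\<^esub>} \<and>
        x = finsum R f {n. f n \<noteq> \<zero>\<^bsub>R\<^esub>})"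

text \<open>
  The condition on \<open>A 0\<close> says that the structure map of the algebra is a bijection from \<open>K\<close>
  onto \<open>A 0\<close>; in particular \<open>R\<close> is not the zero ring. The subalgebra generated by a set \<open>S\<close> is
  the subring generated by \<open>S\<close> together with the scalars.
\<close>

definition standard_graded_algebra ::
    "('k, 'm) ring_scheme \<Rightarrow> ('k, 'a) module \<Rightarrow> (nat \<Rightarrow> 'a set) \<Rightarrow> bool" where
  "standard_graded_algebra K R A \<longleftrightarrow>
     graded_algebra K R A \<and>
     bij_betw (\<lambda>c. c \<odot>\<^bsub>R\<^esub> \<one>\<^bsub>R\<^esub>) (carrier K) (A 0) \<and>
     (\<exists>S. finite S \<and> S \<subseteq> A 1 \<and>
        generate_ring R ((\<lambda>c. c \<odot>\<^bsub>R\<^esub> \<one>\<^bsub>R\<^esub>) ` carrier K \<union> S) = carrier R)"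

definition hilbert_series ::
    "('k, 'm) ring_scheme \<Rightarrow> ('k, 'a) module \<Rightarrow> (nat \<Rightarrow> 'a set) \<Rightarrow> int fps" where
  "hilbert_series K R A = Abs_fps (\<lambda>n. int (vectorspace.dim K (R\<lparr>carrier := A n\<rparr>)))"

definition krull_dim :: "('a, 'm) ring_scheme \<Rightarrow> enat" where
  "krull_dim R = Sup {enat n | n. \<exists>P :: nat \<Rightarrow> 'a set.
     (\<forall>i \<le> n. primeideal (P i) R) \<and> (\<forall>i < n. P i \<subset> P (Suc i))}"

text \<open>
  \<open>h\<close> is the \<open>h\<close>-polynomial of \<open>R\<close>: the Hilbert series equals \<open>h / (1 - t)^d\<close> with \<open>d\<close> the Krull
  dimension. Since \<open>1 - t\<close> is invertible as a power series, this is stated without division.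
  There is at most one such \<open>h\<close>; that there is one for every standard graded algebra is the
  Hilbert--Serre theorem.
\<close>

definition is_h_polynomial ::
    "('k, 'm) ring_scheme \<Rightarrow> ('k, 'a) module \<Rightarrow> (nat \<Rightarrow> 'a set) \<Rightarrow> int poly \<Rightarrow> bool" where
  "is_h_polynomial K R A h \<longleftrightarrow>
     (\<exists>d :: nat. krull_dim R = enat d \<and>
        hilbert_series K R A * (1 - fps_X) ^ d = fps_of_poly h) \<and>
     poly h 1 > 0"

lemma is_h_polynomial_unique:
  assumes "is_h_polynomial K R A h" and "is_h_polynomial K R A h'"
  shows "h = h'"
  using assms unfolding is_h_polynomial_def by (metis enat.inject fps_of_poly_eq_iff)

definition cyclotomic_algebra ::
    "('k, 'm) ring_scheme \<Rightarrow> ('k, 'a) module \<Rightarrow> (nat \<Rightarrow> 'a set) \<Rightarrow> bool" where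
  "cyclotomic_algebra K R A \<longleftrightarrow>
     (\<exists>h. is_h_polynomial K R A h \<and>
        (\<forall>z :: complex. poly (map_poly of_int h) z = 0 \<longrightarrow> norm z = 1))"

definition Psi :: "nat \<Rightarrow> int poly" where
  "Psi m = (\<Sum>i<m. Polynomial.monom 1 i)"

definition type_CI :: "int poly \<Rightarrow> bool" where
  "type_CI p \<longleftrightarrow> (\<exists>ms :: nat list. (\<forall>m \<in> set ms. m > 0) \<and> p = (\<Prod>m\<leftarrow>ms. Psi m))"

end

theory Submission
  imports Defs "HOL-Library.Multiset_Order"
begin

text \<open>Part 1: standard monomials replace \<open>R\<close> by a monomial order ideal with the same Hilbert
  series, and the Hilbert coefficients of an order ideal satisfy $2 e_1 \le e_0 (e_0 - 1)$. As \<open>h\<close> is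
  palindromic, $e_1 = h'(1) = h(1) \deg h / 2$, so $\deg h < h(1)$. By Kronecker the roots of \<open>h\<close> are
  roots of unity. If $h(1) = p$ is prime, an irreducible factor \<open>f\<close> with $p \mid f(1)$ has a root of
  order $p^{s+1}$, and Eisenstein's argument gives $f = \Psi_p(t^{p^s})$ up to sign; hence
  $s = 0$ and $h = \Psi_p$. The values 1, 4, 6 leave finitely many candidates.

  Part 2: piling finite regions with the Hilbert functions of boxes onto a plane of multiplicity \<open>n\<close>
  produces monomial algebras with $h = \Psi_n + (1 - t)^2 q$, where $q \ne 0$ has nonnegative
  coefficients, and $\deg h = n - 1$. A type CI polynomial with $\deg h = h(1) - 1$ equals $\Psi_n$, so
  it remains to find such \<open>h\<close> that are cyclotomic; they have the form $\Psi_a \Psi_b g$ with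
  $g = 1 + t^k$ or $g = 1 - t^j + t^{2j}$.\<close>

section \<open>Monomial order ideals and their Hilbert series\<close>

text \<open>Both parts turn on the inequality 2 e_1 <= e_0 (e_0 - 1). The examples of part 2 are
  equality cases: adding (1 - t)^2 q to Psi_n changes neither h(1) nor h'(1), so e_1 stays n (n - 1)
  / 2, and for a palindromic h this says exactly that deg h = n - 1. Conversely, a palindromic h
  with h(1) = n and degree n - 1 differs from Psi_n by a multiple of (1 - t)^2. This is why the
  added regions are finite and sit on a plane: they have dimension two less. The obstacle is that q
  must come from an order ideal, so each candidate h has to be expanded into products Psi_u Psi_v
  that belong to nested regions. For n = 4 and n = 6 the same expansions give q = 0. Part 1 needs no
  dimension theory: from the h-polynomial it takes only that h is the Hilbert series times some
  power of 1 - t and that h(1) > 0. Part 2 does need the Krull dimension. The upper bound 2 comes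
  from quadratic growth of the number of monomials, the lower bound from a chain of three
  primes.\<close>

definition downset :: "nat multiset set \<Rightarrow> bool" where
  "downset M \<longleftrightarrow> (\<forall>u\<in>M. \<forall>v. v \<subseteq># u \<longrightarrow> v \<in> M)"

text \<open>A monomial is encoded as the multiset of its variable indices: sum is the product,
  submultiset is divisibility, \<open>size\<close> is the degree and \<open>count\<close> the
  exponent. The linear order on multisets later serves as monomial order.\<close>

definition monomials :: "nat \<Rightarrow> nat multiset set" where
  "monomials s = {u. set_mset u \<subseteq> {..<s}}"

definition counting_series :: "nat multiset set \<Rightarrow> int fps" where
  "counting_series M = Abs_fps (\<lambda>n. int (card {u \<in> M. size u = n}))"

text \<open>Cutting \<open>M\<close> by the exponent of the last variable is the vehicle for every
  induction on the number of variables: the slices of an order ideal form a decreasing chain of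
  order ideals in one variable fewer.\<close>

definition slice :: "nat \<Rightarrow> nat multiset set \<Rightarrow> nat \<Rightarrow> nat multiset set" where
  "slice s M k = {u \<in> monomials s. u + replicate_mset k s \<in> M}"

lemma finite_monomials_size: "finite {u \<in> monomials s. size u = n}"
proof (rule finite_subset)
  show "{u \<in> monomials s. size u = n} \<subseteq> mset ` {xs. set xs \<subseteq> {..<s} \<and> length xs = n}"
  proof
    fix u assume u: "u \<in> {u \<in> monomials s. size u = n}"
    obtain xs where "mset xs = u" using ex_mset by blast
    then show "u \<in> mset ` {xs. set xs \<subseteq> {..<s} \<and> length xs = n}"
      using u by (auto simp: monomials_def intro!: image_eqI[of _ _ xs])
  qed
  show "finite (mset ` {xs. set xs \<subseteq> {..<s} \<and> length xs = n})"
    by (intro finite_imageI finite_lists_length_eq) auto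
qed

lemma finite_level: "M \<subseteq> monomials s \<Longrightarrow> finite {u \<in> M. size u = n}"
  by (rule finite_subset[OF _ finite_monomials_size[of s n]]) auto

lemma downset_slice: "downset M \<Longrightarrow> downset (slice s M k)"
  unfolding downset_def slice_def monomials_def
  by (smt (verit) mem_Collect_eq set_mset_mono subset_mset.add_right_mono subset_trans)

lemma slice_subset: "slice s M k \<subseteq> monomials s"
  by (auto simp: slice_def)

lemma slice_mono: "M \<subseteq> N \<Longrightarrow> slice s M k \<subseteq> slice s N k"
  by (auto simp: slice_def)

lemma slice_antimono:
  assumes "downset M" "k \<le> l"
  shows "slice s M l \<subseteq> slice s M k"
proof
  fix u assume "u \<in> slice s M l"
  moreover have "u + replicate_mset k s \<subseteq># u + replicate_mset l s"
    using assms(2) by (simp add: subseteq_mset_def)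
  ultimately show "u \<in> slice s M k"
    using assms(1) unfolding slice_def downset_def by blast
qed

section \<open>Stabilization of slices\<close>

lemma monomial_split:
  assumes "u \<in> monomials (Suc s)"
  shows "filter_mset (\<lambda>x. x \<noteq> s) u \<in> monomials s"
    and "u = filter_mset (\<lambda>x. x \<noteq> s) u + replicate_mset (count u s) s"
proof -
  show "filter_mset (\<lambda>x. x \<noteq> s) u \<in> monomials s"
    using assms unfolding monomials_def by (auto simp: less_Suc_eq)
  show "u = filter_mset (\<lambda>x. x \<noteq> s) u + replicate_mset (count u s) s"
    by (rule multiset_eqI) (auto simp: count_eq_zero_iff)
qed

lemma in_iff_slice:
  assumes "M \<subseteq> monomials (Suc s)" "u \<in> monomials (Suc s)"
  shows "u \<in> M \<longleftrightarrow> filter_mset (\<lambda>x. x \<noteq> s) u \<in> slice s M (count u s)"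
  using monomial_split[OF assms(2)] by (auto simp: slice_def)

lemma eq_if_slices_eq:
  assumes "M \<subseteq> monomials (Suc s)" "N \<subseteq> monomials (Suc s)" "\<And>k. slice s M k = slice s N k"
  shows "M = N"
  using in_iff_slice[OF assms(1)] in_iff_slice[OF assms(2)] assms by blast

text \<open>The Noetherian property of monomial ideals, stated for their complements. Infinitely
  many slices have to be controlled at once; the diagonal chain \<open>slice s (M i) i\<close>
  handles all but finitely many of them.\<close>

lemma downset_chain_stabilizes:
  fixes M :: "nat \<Rightarrow> nat multiset set"
  assumes "\<And>i. downset (M i)" "\<And>i. M i \<subseteq> monomials s" "\<And>i j. i \<le> j \<Longrightarrow> M j \<subseteq> M i"
  shows "\<exists>I. \<forall>i\<ge>I. M i = M I"
  using assms
proof (induction s arbitrary: M)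
  case 0
  have sub: "M i \<subseteq> {{#}}" for i using 0(2)[of i] by (auto simp: monomials_def)
  show ?case
  proof (cases "\<exists>I. M I = {}")
    case True
    then show ?thesis using 0(3) by blast
  next
    case False
    then have "M i = {{#}}" for i using sub[of i] by (meson subset_singletonD)
    then show ?thesis by auto
  qed
next
  case (Suc s)
  \<comment> \<open>The diagonal decreases because both the ideal index and the exponent grow, so
    the induction hypothesis applies to it.\<close>
  have "\<exists>I. \<forall>i\<ge>I. slice s (M i) i = slice s (M I) I"
  proof (rule Suc.IH)
    show "slice s (M j) j \<subseteq> slice s (M i) i" if "i \<le> j" for i j
      using slice_mono[OF Suc(4)[OF that]] slice_antimono[OF Suc(2) that] by blast
  qed (intro downset_slice slice_subset Suc)+
  then obtain I where I: "\<And>i. i \<ge> I \<Longrightarrow> slice s (M i) i = slice s (M I) I" by blast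
  have "\<forall>k. \<exists>J. \<forall>i\<ge>J. slice s (M i) k = slice s (M J) k"
  proof
    fix k
    show "\<exists>J. \<forall>i\<ge>J. slice s (M i) k = slice s (M J) k"
      by (rule Suc.IH) (intro downset_slice slice_subset slice_mono Suc; assumption)+
  qed
  then obtain J where J: "\<And>k i. i \<ge> J k \<Longrightarrow> slice s (M i) k = slice s (M (J k)) k" by metis
  define L where "L = Max (insert I (J ` {..<I}))"
  have L: "L \<ge> I" "\<And>k. k < I \<Longrightarrow> L \<ge> J k" unfolding L_def by auto
  have "M i = M L" if "i \<ge> L" for i
  proof (rule eq_if_slices_eq)
    fix k
    show "slice s (M i) k = slice s (M L) k"
    proof (cases "k < I")
      case True
      then show ?thesis using J[of k] L(2)[of k] that by (metis order_trans)
    next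
      case False
      \<comment> \<open>For \<open>k\<close> at least \<open>I\<close> the slice is squeezed: it
        lies inside the stable diagonal value and contains a later diagonal slice, which equals that
        value.\<close>
      have "slice s (M i) k = slice s (M I) I" if "i \<ge> I" for i
      proof
        have "slice s (M i) k \<subseteq> slice s (M i) I"
          using False by (intro slice_antimono Suc) auto
        also have "\<dots> \<subseteq> slice s (M I) I" by (intro slice_mono Suc that)
        finally show "slice s (M i) k \<subseteq> slice s (M I) I" .
        have "slice s (M I) I = slice s (M (max i k)) (max i k)"
          using I[of "max i k"] that by simp
        also have "\<dots> \<subseteq> slice s (M i) (max i k)" by (intro slice_mono Suc) auto
        also have "\<dots> \<subseteq> slice s (M i) k" by (intro slice_antimono Suc) auto
        finally show "slice s (M I) I \<subseteq> slice s (M i) k" .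
      qed
      then show ?thesis using that L(1) by simp
    qed
  qed (use Suc in auto)
  then show ?case by blast
qed

lemma slices_stabilize:
  assumes "downset M"
  shows "\<exists>K. \<forall>k\<ge>K. slice s M k = slice s M K"
  using downset_chain_stabilizes[of "slice s M" s] downset_slice[OF assms] slice_subset
    slice_antimono[OF assms] by blast

lemma card_level_slices:
  assumes "M \<subseteq> monomials (Suc s)"
  shows "card {u \<in> M. size u = n} = (\<Sum>k\<le>n. card {u \<in> slice s M k. size u = n - k})"
proof -
  have "(\<Sum>k\<le>n. card {u \<in> slice s M k. size u = n - k})
      = card (SIGMA k:{..n}. {u \<in> slice s M k. size u = n - k})"
    by (rule card_SigmaI[symmetric]) (auto intro: finite_level[OF slice_subset])
  also have "\<dots> = card {u \<in> M. size u = n}"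
  proof (rule bij_betw_same_card[of "\<lambda>(k, u). u + replicate_mset k s"], rule bij_betwI')
    fix x y
    assume "x \<in> (SIGMA k:{..n}. {u \<in> slice s M k. size u = n - k})"
       and "y \<in> (SIGMA k:{..n}. {u \<in> slice s M k. size u = n - k})"
    then obtain k u l v where [simp]: "x = (k, u)" "y = (l, v)" and
      *: "u \<in> monomials s" "v \<in> monomials s" by (auto simp: slice_def)
    have c: "count u s = 0" "count v s = 0" using * by (auto simp: monomials_def count_eq_zero_iff)
    show "((case x of (k, u) \<Rightarrow> u + replicate_mset k s) = (case y of (k, u) \<Rightarrow> u + replicate_mset k s)) = (x = y)"
    proof
      assume "(case x of (k, u) \<Rightarrow> u + replicate_mset k s) = (case y of (k, u) \<Rightarrow> u + replicate_mset k s)"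
      then have eq: "u + replicate_mset k s = v + replicate_mset l s" by simp
      from arg_cong[OF eq, of "\<lambda>m. count m s"] c have "k = l" by simp
      with eq show "x = y" by simp
    qed auto
  next
    fix x assume "x \<in> (SIGMA k:{..n}. {u \<in> slice s M k. size u = n - k})"
    then show "(case x of (k, u) \<Rightarrow> u + replicate_mset k s) \<in> {u \<in> M. size u = n}"
      by (auto simp: slice_def)
  next
    fix y assume y: "y \<in> {u \<in> M. size u = n}"
    let ?u = "filter_mset (\<lambda>x. x \<noteq> s) y"
    have "y \<in> monomials (Suc s)" using y assms by auto
    note sp = monomial_split[OF this] and iff = in_iff_slice[OF assms this]
    have "size y = size ?u + count y s" using arg_cong[OF sp(2), of size] by simp
    then have "(count y s, ?u) \<in> (SIGMA k:{..n}. {u \<in> slice s M k. size u = n - k})"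
      using y iff by auto
    then show "\<exists>x\<in>SIGMA k:{..n}. {u \<in> slice s M k. size u = n - k}.
        y = (case x of (k, u) \<Rightarrow> u + replicate_mset k s)"
      using sp(2) by (intro bexI[of _ "(count y s, ?u)"]) auto
  qed
  finally show ?thesis ..
qed

text \<open>From exponent \<open>K\<close> on all slices agree, so they contribute a geometric
  series times the stable slice. \<open>G\<close> is that quotient by 1 - X, described by a product
  because the coefficients are integers.\<close>

lemma counting_series_slices:
  assumes "M \<subseteq> monomials (Suc s)" and K: "\<And>k. k \<ge> K \<Longrightarrow> slice s M k = slice s M K"
  shows "\<exists>G. G * (1 - fps_X) = counting_series (slice s M K) \<and> (\<forall>n. fps_nth G n \<ge> 0) \<and>
     counting_series M = (\<Sum>k<K. fps_X ^ k * counting_series (slice s M k)) + fps_X ^ K * G"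
proof (intro exI conjI)
  define c where "c k n = int (card {u \<in> slice s M k. size u = n})" for k n
  define G where "G = Abs_fps (\<lambda>n. \<Sum>i\<le>n. c K i)"
  show "G * (1 - fps_X) = counting_series (slice s M K)"
  proof (rule fps_ext)
    fix n
    show "fps_nth (G * (1 - fps_X)) n = fps_nth (counting_series (slice s M K)) n"
      by (cases n) (auto simp: G_def algebra_simps counting_series_def c_def)
  qed
  show "\<forall>n. fps_nth G n \<ge> 0" by (auto simp: G_def c_def intro: sum_nonneg)
  show "counting_series M = (\<Sum>k<K. fps_X ^ k * counting_series (slice s M k)) + fps_X ^ K * G"
  proof (rule fps_ext)
    fix n
    have "fps_nth (counting_series M) n = (\<Sum>k\<le>n. c k (n - k))"
      using card_level_slices[OF assms(1), of n] by (simp add: counting_series_def c_def)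
    also have "\<dots> = (\<Sum>k<K. if n < k then 0 else c k (n - k)) + (if n < K then 0 else \<Sum>i\<le>n-K. c K i)"
    proof (cases "n < K")
      case True
      have "(\<Sum>k<K. if n < k then 0 else c k (n - k)) = (\<Sum>k\<le>n. c k (n - k))"
        using True by (intro sum.mono_neutral_cong_right) auto
      then show ?thesis using True by simp
    next
      case False
      have "(\<Sum>k\<le>n. c k (n - k)) = (\<Sum>k<K. c k (n - k)) + (\<Sum>k=K..n. c k (n - k))"
      proof -
        have "{..n} = {..<K} \<union> {K..n}" using False by auto
        then show ?thesis by (simp only: sum.union_disjoint finite_lessThan finite_atLeastAtMost) (rule sum.union_disjoint, auto)
      qed
      also have "(\<Sum>k=K..n. c k (n - k)) = (\<Sum>k=K..n. c K (n - k))"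
        by (rule sum.cong) (auto simp: c_def dest: K)
      also have "\<dots> = (\<Sum>i\<le>n-K. c K i)"
        by (rule sum.reindex_bij_witness[of _ "\<lambda>i. n - i" "\<lambda>k. n - k"]) (use False in auto)
      also have "(\<Sum>k<K. c k (n - k)) = (\<Sum>k<K. if n < k then 0 else c k (n - k))"
        using False by (intro sum.cong) auto
      finally show ?thesis using False by simp
    qed
    finally show "fps_nth (counting_series M) n =
        fps_nth ((\<Sum>k<K. fps_X ^ k * counting_series (slice s M k)) + fps_X ^ K * G) n"
      by (simp add: fps_sum_nth fps_X_power_mult_nth counting_series_def c_def G_def cong: if_cong)
  qed
qed

text \<open>F = p / (1 - X)^D, where p(1) = 0 is allowed. Thus series with poles of different orders
  can share a denominator, and p(1) is the multiplicity in dimension \<open>D\<close>, zero when the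
  actual dimension is smaller.\<close>

definition pole_form :: "nat \<Rightarrow> int fps \<Rightarrow> int poly \<Rightarrow> bool" where
  "pole_form D F p \<longleftrightarrow> F * (1 - fps_X) ^ D = fps_of_poly p"

lemma fps_of_poly_one_minus_X: "fps_of_poly [:1, -1:] = (1 - fps_X :: int fps)"
  by (simp add: fps_of_poly_pCons fps_const_neg)

lemma one_minus_X_nonzero: "(1 - fps_X :: int fps) \<noteq> 0"
  by (simp flip: fps_of_poly_one_minus_X)

lemma pole_form_add_exponent:
  "pole_form D F p \<Longrightarrow> pole_form (D + k) F (p * [:1, -1:] ^ k)"
  by (simp add: pole_form_def power_add fps_of_poly_mult fps_of_poly_power
      fps_of_poly_one_minus_X flip: mult.assoc)

lemma pole_form_diff: "pole_form D F p \<Longrightarrow> pole_form D G q \<Longrightarrow> pole_form D (F - G) (p - q)"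
  by (simp add: pole_form_def fps_of_poly_diff left_diff_distrib)

lemma pole_form_add: "pole_form D F p \<Longrightarrow> pole_form D G q \<Longrightarrow> pole_form D (F + G) (p + q)"
  by (simp add: pole_form_def fps_of_poly_add distrib_right)

lemma pole_form_unique: "pole_form D F p \<Longrightarrow> pole_form D F q \<Longrightarrow> p = q"
  by (simp add: pole_form_def fps_of_poly_eq_iff)

lemma pole_form_sum:
  "(\<And>i. i \<in> A \<Longrightarrow> pole_form D (F i) (p i)) \<Longrightarrow> pole_form D (\<Sum>i\<in>A. F i) (\<Sum>i\<in>A. p i)"
  by (simp add: pole_form_def fps_of_poly_sum sum_distrib_right)

lemma pole_form_shift:
  "pole_form D F p \<Longrightarrow> pole_form D (fps_X ^ k * F) (monom 1 k * p)"
  by (simp add: pole_form_def fps_of_poly_mult fps_of_poly_monom mult.assoc)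

lemma pole_form_Suc_iff: "pole_form (Suc D) F p \<longleftrightarrow> pole_form D (F * (1 - fps_X)) p"
  by (simp add: pole_form_def mult.assoc)

lemma pole_form_reduce:
  assumes "pole_form (Suc D) F p" "poly p 1 = 0"
  obtains q where "p = [:1, -1:] * q" "pole_form D F q"
proof -
  have "[:- 1, 1:] dvd p" using assms(2) poly_eq_0_iff_dvd by blast
  then obtain q where "p = [:- 1, 1:] * q" by (elim dvdE)
  then have q: "p = [:1, -1:] * (- q)" by simp
  have "F * (1 - fps_X) ^ D * (1 - fps_X) = fps_of_poly (- q) * (1 - fps_X)"
    using assms(1) by (simp only: pole_form_def q fps_of_poly_mult fps_of_poly_one_minus_X power_Suc) (simp add: ac_simps)
  then have "pole_form D F (- q)"
    using one_minus_X_nonzero by (simp add: pole_form_def)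
  with q that show ?thesis by blast
qed

lemma nth_eq_sum_nth_one_minus_X:
  "fps_nth F n = (\<Sum>i\<le>n. fps_nth (F * (1 - fps_X)) i)" for F :: "int fps"
  by (induction n) (simp_all add: algebra_simps)

lemma poly_1_eq_sum_coeff: "poly p 1 = (\<Sum>i\<le>n. coeff p i)" if "degree p \<le> n" for p :: "int poly"
proof -
  have "poly p 1 = (\<Sum>i\<le>degree p. coeff p i)" by (simp add: poly_altdef)
  also have "\<dots> = (\<Sum>i\<le>n. coeff p i)"
    using that by (intro sum.mono_neutral_left) (auto simp: coeff_eq_0)
  finally show ?thesis .
qed

text \<open>Multiplication by 1 - X takes differences. Each induction step therefore says that the
  differences are eventually at most -1, which drives the coefficients below zero.\<close>

lemma eventually_negative:
  assumes "pole_form (Suc D) F p" "poly p 1 < 0"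
  shows "\<exists>N. \<forall>n\<ge>N. fps_nth F n < 0"
  using assms
proof (induction D arbitrary: F)
  case 0
  then have "F * (1 - fps_X) = fps_of_poly p" by (simp add: pole_form_def)
  then have "fps_nth F n = poly p 1" if "n \<ge> degree p" for n
    using nth_eq_sum_nth_one_minus_X[of F n] poly_1_eq_sum_coeff[OF that] by simp
  with 0(2) have "\<forall>n\<ge>degree p. fps_nth F n < 0" by simp
  then show ?case by blast
next
  case (Suc D)
  then obtain N where N: "\<And>n. n \<ge> N \<Longrightarrow> fps_nth (F * (1 - fps_X)) n < 0"
    using pole_form_Suc_iff by blast
  have "fps_nth F (N + k) \<le> fps_nth F N - int k" for k
  proof (induction k)
    case (Suc k)
    then show ?case using N[of "N + Suc k"] by (simp add: algebra_simps)
  qed simp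
  \<comment> \<open>The coefficients fall by at least one per step after \<open>N\<close>, so
    \<open>nat (fps_nth F N) + 1\<close> steps are enough.\<close>
  from this[of "n - N" for n] have "fps_nth F n < 0" if "n \<ge> N + nat (fps_nth F N) + 1" for n
    using that by (smt (verit) le_add_diff_inverse add_leD1 nat_le_iff of_nat_add of_nat_le_iff of_nat_1 int_nat_eq)
  then show ?case by blast
qed

text \<open>Applied to differences of series, this turns termwise inequalities into inequalities
  between multiplicities.\<close>

lemma poly_1_nonneg:
  assumes "pole_form D F p" "\<And>n. fps_nth F n \<ge> 0"
  shows "poly p 1 \<ge> 0"
proof (cases D)
  case 0
  then have "coeff p i \<ge> 0" for i using assms by (simp add: pole_form_def)
  then show ?thesis using poly_1_eq_sum_coeff[of p "degree p"] by (simp add: sum_nonneg)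
next
  case (Suc d)
  then show ?thesis using eventually_negative assms
    by (metis linorder_not_less order_refl)
qed

text \<open>A smaller nonnegative series cannot have a larger pole. If the exponent of
  \<open>A\<close> exceeds \<open>D\<close>, the padded numerator of \<open>B\<close> vanishes at 1,
  so nonnegativity of \<open>B - A\<close> and of \<open>A\<close> forces a(1) = 0, and a factor 1 -
  t cancels.\<close>

lemma pole_form_mono:
  assumes "pole_form m A a" "pole_form D B b"
    and A: "\<And>n. 0 \<le> fps_nth A n" and AB: "\<And>n. fps_nth A n \<le> fps_nth B n"
  obtains a' where "pole_form D A a'" "poly a' 1 \<le> poly b 1"
proof -
  have "\<exists>a'. pole_form D A a'"
    using assms(1)
  proof (induction m arbitrary: a)
    case 0
    then show ?case using pole_form_add_exponent[of 0] by fastforce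
  next
    case (Suc m)
    show ?case
    proof (cases "Suc m \<le> D")
      case True
      then show ?thesis using pole_form_add_exponent[OF Suc.prems, of "D - Suc m"] by auto
    next
      case False
      then obtain k where k: "Suc m = D + Suc k" by (metis less_imp_Suc_add linorder_not_le add_Suc_right)
      have "pole_form (Suc m) (B - A) (b * [:1, -1:] ^ Suc k - a)"
        using pole_form_diff[OF _ Suc.prems] pole_form_add_exponent[OF assms(2), of "Suc k"] k by metis
      from poly_1_nonneg[OF this] AB have "poly a 1 \<le> 0" by simp
      moreover have "poly a 1 \<ge> 0" by (rule poly_1_nonneg[OF Suc.prems A])
      ultimately obtain q where "pole_form m A q" using pole_form_reduce[OF Suc.prems] by force
      then show ?thesis by (rule Suc.IH)
    qed
  qed
  then obtain a' where a': "pole_form D A a'" by blast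
  from poly_1_nonneg[OF pole_form_diff[OF assms(2) a']] AB have "poly a' 1 \<le> poly b 1" by simp
  with a' that show ?thesis by blast
qed

lemma counting_series_monomials_0:
  assumes "M \<subseteq> monomials 0"
  shows "pole_form 0 (counting_series M) (if {#} \<in> M then 1 else 0)"
proof -
  have "fps_nth (counting_series M) n = coeff (if {#} \<in> M then 1 else 0) n" for n
  proof -
    have "{u \<in> M. size u = n} = (if n = 0 \<and> {#} \<in> M then {{#}} else {})"
      using assms by (auto simp: monomials_def)
    then show ?thesis by (auto simp: counting_series_def)
  qed
  then show ?thesis unfolding pole_form_def by (intro fps_ext) simp
qed

text \<open>Hilbert's theorem with the number of variables as a crude exponent: the tail of equal
  slices costs one factor 1 - X more than a slice, which is what the new variable provides.\<close>

lemma counting_series_pole_form: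
  assumes "downset M" "M \<subseteq> monomials s"
  shows "\<exists>p. pole_form s (counting_series M) p"
  using assms
proof (induction s arbitrary: M)
  case 0
  have "pole_form 0 (counting_series M) (if {#} \<in> M then 1 else 0)"
    using 0(2) by (rule counting_series_monomials_0)
  then show ?case by blast
next
  case (Suc s)
  obtain K where K: "\<And>k. k \<ge> K \<Longrightarrow> slice s M k = slice s M K"
    using slices_stabilize[OF Suc.prems(1)] by blast
  obtain G where G: "G * (1 - fps_X) = counting_series (slice s M K)" and
    eq: "counting_series M = (\<Sum>k<K. fps_X ^ k * counting_series (slice s M k)) + fps_X ^ K * G"
    using counting_series_slices[OF Suc.prems(2) K] by blast
  have IH: "\<exists>p. pole_form s (counting_series (slice s M k)) p" for k
    by (intro Suc.IH downset_slice slice_subset Suc.prems)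
  obtain p where p: "\<And>k. pole_form s (counting_series (slice s M k)) (p k)" using IH by metis
  have "pole_form (Suc s) G (p K)" using p G by (simp add: pole_form_Suc_iff)
  moreover have "pole_form (Suc s) (counting_series (slice s M k)) (p k * [:1, -1:])" for k
    using pole_form_add_exponent[OF p, of 1] by simp
  ultimately show ?case unfolding eq
    using pole_form_add[OF pole_form_sum pole_form_shift,
        of "{..<K}" "Suc s" "\<lambda>k. fps_X ^ k * counting_series (slice s M k)"
           "\<lambda>k. monom 1 k * (p k * [:1, -1:])"] pole_form_shift by blast
qed

lemma counting_series_nonneg: "fps_nth (counting_series M) n \<ge> 0"
  by (simp add: counting_series_def)

lemma counting_series_mono:
  "M \<subseteq> N \<Longrightarrow> N \<subseteq> monomials s \<Longrightarrow> fps_nth (counting_series M) n \<le> fps_nth (counting_series N) n"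
  by (auto simp: counting_series_def intro!: card_mono finite_level)

section \<open>The bound on the Hilbert coefficient e_1\<close>

lemma poly_pderiv_monom_mult_1:
  "poly (pderiv (monom 1 k * p)) 1 = int k * poly p 1 + poly (pderiv p) 1" for p :: "int poly"
  by (simp add: pderiv_mult pderiv_monom poly_monom)

lemma pderiv_sum: "pderiv (sum f A) = (\<Sum>x\<in>A. pderiv (f x))"
  by (induction A rule: infinite_finite_induct) (simp_all add: pderiv_add)

text \<open>The coefficients of \<open>g\<close> are partial sums of nonnegative numbers, hence
  nonnegative and nondecreasing, but they end in zeros.\<close>

lemma fps_zero_if_partial_sums_poly:
  assumes "fps_of_poly g * (1 - fps_X) = F" "\<And>n. fps_nth F n \<ge> 0"
  shows "g = (0 :: int poly)"
proof -
  have mono: "coeff g m \<le> coeff g n" if "m \<le> n" for m n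
  proof -
    have "coeff g k = (\<Sum>i\<le>k. fps_nth F i)" for k
      using nth_eq_sum_nth_one_minus_X[of "fps_of_poly g" k] assms(1) by simp
    then show ?thesis using that assms(2) by (auto intro!: sum_mono2)
  qed
  have "coeff g n \<le> 0" for n using mono[of n "max n (Suc (degree g))"] by (simp add: coeff_eq_0)
  moreover have "coeff g n \<ge> 0" for n
    using nth_eq_sum_nth_one_minus_X[of "fps_of_poly g" n] assms by (simp add: sum_nonneg)
  ultimately show ?thesis by (intro poly_eqI) (simp add: antisym)
qed

text \<open>Write p = sum of t^k h_k + t^K g along the slices. Then e_1 is the sum of the e_1 of the
  pieces plus the sum of k e_0(h_k), with K e_0(g) for the tail. Multiplicities of slices decrease,
  so as long as they are nonzero each is at least 1, and the index k is at most the sum of the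
  earlier ones; this bounds the extra terms by mixed products of multiplicities. The exponent
  \<open>D\<close> is arbitrary because slices of smaller dimension have to be put over the common
  denominator.\<close>

lemma hilbert_coefficient_bound:
  assumes "downset M" "M \<subseteq> monomials s" "pole_form D (counting_series M) p"
  shows "2 * poly (pderiv p) 1 \<le> poly p 1 * (poly p 1 - 1)"
  using assms
proof (induction s arbitrary: M D p)
  case 0
  have "pole_form 0 (counting_series M) (if {#} \<in> M then 1 else 0)"
    using 0(2) by (rule counting_series_monomials_0)
  from pole_form_add_exponent[OF this, of D]
  have p: "p = (if {#} \<in> M then 1 else 0) * [:1, -1:] ^ D"
    using 0(3) pole_form_unique by simp
  show ?case
  proof (cases D)
    case (Suc d)
    then show ?thesis by (cases d) (simp_all add: p pderiv_power_Suc pderiv_pCons pderiv_add pderiv_minus pderiv_mult del: mult_pCons_left mult_pCons_right power_Suc)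
  qed (simp add: p)
next
  case (Suc s)
  let ?F = "\<lambda>k. counting_series (slice s M k)"
  obtain K where K: "\<And>k. k \<ge> K \<Longrightarrow> slice s M k = slice s M K"
    using slices_stabilize[OF Suc.prems(1)] by blast
  obtain G where G: "G * (1 - fps_X) = ?F K" and G_nonneg: "\<And>n. fps_nth G n \<ge> 0" and
    eq: "counting_series M = (\<Sum>k<K. fps_X ^ k * ?F k) + fps_X ^ K * G"
    using counting_series_slices[OF Suc.prems(2) K] by blast
  have ds: "downset (slice s M k)" "slice s M k \<subseteq> monomials s" for k
    using downset_slice[OF Suc.prems(1)] slice_subset by auto
  have term_nonneg: "fps_nth (fps_X ^ k * ?F k) n \<ge> 0" for k n
    by (simp add: fps_X_power_mult_nth counting_series_nonneg)
  \<comment> \<open>The shifted slice is termwise below the whole series, so its pole order is at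
    most \<open>D\<close>.\<close>
  have "\<exists>h. pole_form D (fps_X ^ k * ?F k) h" if "k < K" for k
  proof -
    obtain a where "pole_form s (?F k) a" using counting_series_pole_form ds by blast
    then have "pole_form s (fps_X ^ k * ?F k) (monom 1 k * a)" by (rule pole_form_shift)
    then show ?thesis
    proof (rule pole_form_mono[OF _ Suc.prems(3) term_nonneg])
      fix n
      have "fps_nth (fps_X ^ k * ?F k) n \<le> (\<Sum>k<K. fps_nth (fps_X ^ k * ?F k) n)"
        using that term_nonneg by (intro member_le_sum) auto
      then show "fps_nth (fps_X ^ k * ?F k) n \<le> fps_nth (counting_series M) n"
        using G_nonneg[of "n - K"]
        by (simp add: eq fps_sum_nth fps_X_power_mult_nth[of K] add_increasing2)
    qed blast
  qed
  \<comment> \<open>The numerator of X^k F is divisible by X^k, so its coefficients can be moved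
    down by \<open>k\<close>.\<close>
  moreover have unshift: "\<exists>h. pole_form D F h" if "pole_form D (fps_X ^ k * F) a" for F k a
  proof -
    have "fps_X ^ k * (F * (1 - fps_X) ^ D) = fps_of_poly a"
      using that by (simp add: pole_form_def mult.assoc)
    then have "fps_nth (F * (1 - fps_X) ^ D) n = coeff (poly_shift k a) n" for n
      by (metis add.commute add_diff_cancel_left' coeff_poly_shift fps_X_power_mult_nth fps_of_poly_nth not_add_less2)
    then have "pole_form D F (poly_shift k a)"
      unfolding pole_form_def by (intro fps_ext) (simp only: fps_of_poly_nth)
    then show ?thesis by blast
  qed
  ultimately have "\<forall>k\<in>{..<K}. \<exists>h. pole_form D (?F k) h" by blast
  then obtain h where h: "\<And>k. k < K \<Longrightarrow> pole_form D (?F k) (h k)" by (metis lessThan_iff)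
  have "pole_form D (fps_X ^ K * G) (p - (\<Sum>k<K. monom 1 k * h k))"
    using pole_form_diff[OF Suc.prems(3)] pole_form_sum[of "{..<K}" D "\<lambda>k. fps_X ^ k * ?F k"]
      pole_form_shift[OF h] eq by (metis (no_types, lifting) add_diff_cancel_left' lessThan_iff)
  then obtain g where g: "pole_form D G g" using unshift by blast
  have p: "p = (\<Sum>k<K. monom 1 k * h k) + monom 1 K * g"
  proof (rule pole_form_unique[OF Suc.prems(3)])
    show "pole_form D (counting_series M) ((\<Sum>k<K. monom 1 k * h k) + monom 1 K * g)"
      unfolding eq by (intro pole_form_add pole_form_sum pole_form_shift g h) auto
  qed
  define e c e' c' where "e k = poly (h k) 1" and "c k = poly (pderiv (h k)) 1"
    and "e' = poly g 1" and "c' = poly (pderiv g) 1" for k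
  have e_nonneg: "e k \<ge> 0" if "k < K" for k
    unfolding e_def using poly_1_nonneg[OF h[OF that]] counting_series_nonneg by blast
  have e'_nonneg: "e' \<ge> 0" unfolding e'_def using poly_1_nonneg[OF g G_nonneg] .
  have mono: "fps_nth (?F l) n \<le> fps_nth (?F k) n" if "k \<le> l" for k l n
    by (rule counting_series_mono[OF slice_antimono[OF Suc.prems(1) that] slice_subset])
  have e_antimono: "e l \<le> e k" if "k \<le> l" "l < K" for k l
    using poly_1_nonneg[OF pole_form_diff[OF h h], of k l] that mono[OF that(1)] by (simp add: e_def)
  have c: "2 * c k \<le> e k * (e k - 1)" if "k < K" for k
    unfolding c_def e_def using Suc.IH[OF ds h[OF that]] .
  \<comment> \<open>The tail is the stable slice divided by 1 - X, so \<open>g\<close> is also the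
    numerator of that slice for exponent \<open>D - 1\<close>, and the induction hypothesis applies.
    For \<open>D = 0\<close> the tail would be a polynomial, which forces
    \<open>g = 0\<close>.\<close>
  have c': "2 * c' \<le> e' * (e' - 1)"
  proof (cases D)
    case 0
    then have "G = fps_of_poly g" using g by (simp add: pole_form_def)
    then have "g = 0" using fps_zero_if_partial_sums_poly G counting_series_nonneg by blast
    then show ?thesis by (simp add: c'_def e'_def)
  next
    case (Suc d)
    then have "pole_form d (?F K) g" using g G by (simp add: pole_form_Suc_iff)
    then show ?thesis unfolding c'_def e'_def using Suc.IH ds by blast
  qed
  \<comment> \<open>If slice \<open>k\<close> has multiplicity 0 in dimension \<open>D\<close>, its
    numerator is (1 - t) f and \<open>c k\<close> is -f(1). Since the slice contains the stable one,
    f(1) is at least \<open>e'\<close>. This deficit pays for the extra \<open>e'\<close> that index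
    \<open>k\<close> adds to the term K e'.\<close>
  have c_zero: "c k + e' \<le> 0" if k: "k < K" "e k = 0" for k
  proof (cases D)
    case 0
    then have "G = fps_of_poly g" using g by (simp add: pole_form_def)
    then have "g = 0" using fps_zero_if_partial_sums_poly G counting_series_nonneg by blast
    then show ?thesis using c[OF k(1)] k by (simp add: e'_def)
  next
    case (Suc d)
    then obtain f where f: "h k = [:1, -1:] * f" "pole_form d (?F k) f"
      using pole_form_reduce[of d] h[OF k(1)] k(2) unfolding e_def by blast
    have "pole_form d (?F K) g" using Suc g G by (simp add: pole_form_Suc_iff)
    from poly_1_nonneg[OF pole_form_diff[OF f(2) this]] mono[of k K] k
    have "e' \<le> poly f 1" by (simp add: e'_def)
    moreover have "c k = - poly f 1" by (simp add: c_def f(1) pderiv_mult pderiv_pCons del: mult_pCons_left)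
    ultimately show ?thesis by simp
  qed
  \<comment> \<open>The mixed term with \<open>e'\<close> on the right is chosen so that adding 2 c'
    <= e' (e' - 1) at L = K produces (A + e') (A + e' - 1), where A is the sum of the
    \<open>e k\<close>.\<close>
  have "2 * ((\<Sum>k<L. int k * e k + c k) + int L * e') \<le> (\<Sum>k<L. e k) * ((\<Sum>k<L. e k) - 1) + 2 * (\<Sum>k<L. e k) * e'"
    if "L \<le> K" for L
    using that
  proof (induction L)
    case (Suc L)
    define A where "A = (\<Sum>k<L. e k)"
    have IH: "2 * ((\<Sum>k<L. int k * e k + c k) + int L * e') \<le> A * (A - 1) + 2 * A * e'"
      using Suc A_def by simp
    show ?case
    proof (cases "e L = 0")
      case True
      then show ?thesis using IH c_zero[of L] Suc.prems by (simp add: A_def algebra_simps)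
    next
      case False
      then have L: "e L \<ge> 1" using e_nonneg[of L] Suc.prems by simp
      \<comment> \<open>All earlier multiplicities are at least \<open>e L\<close>, hence at least
        1, so their number is at most their sum.\<close>
      have "int L = (\<Sum>k<L. 1)" by simp
      also have "\<dots> \<le> A" unfolding A_def
        using order_trans[OF L e_antimono] Suc.prems by (intro sum_mono) simp
      finally have "int L * e L \<le> A * e L" using L by (intro mult_right_mono) auto
      moreover have "e' \<le> e L * e'" using L e'_nonneg mult_right_mono[of 1 "e L" e'] by simp
      moreover have "2 * c L \<le> e L * (e L - 1)" using c Suc.prems by simp
      ultimately have "2 * (int L * e L + c L + e') \<le> 2 * (A * e L) + e L * (e L - 1) + 2 * (e L * e')"
        by (simp add: algebra_simps)
      with IH show ?thesis by (simp add: A_def algebra_simps)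
    qed
  qed simp
  from this[of K] c'
  have "2 * ((\<Sum>k<K. int k * e k + c k) + int K * e' + c')
      \<le> ((\<Sum>k<K. e k) + e') * ((\<Sum>k<K. e k) + e' - 1)"
    by (simp add: algebra_simps)
  moreover have "poly p 1 = (\<Sum>k<K. e k) + e'"
    by (simp add: p poly_sum poly_monom e_def e'_def)
  moreover have "poly (pderiv p) 1 = (\<Sum>k<K. int k * e k + c k) + (int K * e' + c')"
    by (simp add: p pderiv_add pderiv_sum poly_sum poly_pderiv_monom_mult_1 e_def e'_def c_def c'_def)
  ultimately show ?case by (simp add: add.assoc)
qed

section \<open>Palindromic polynomials and roots of unity\<close>

abbreviation cpoly :: "int poly \<Rightarrow> complex poly" where
  "cpoly \<equiv> map_poly of_int"

definition unit_roots :: "int poly \<Rightarrow> bool" where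
  "unit_roots h \<longleftrightarrow> (\<forall>z :: complex. poly (cpoly h) z = 0 \<longrightarrow> norm z = 1)"

section \<open>Integer polynomials over the complex numbers\<close>

lemma map_poly_hom_mult:
  fixes f :: "'b::comm_semiring_0 \<Rightarrow> 'c::comm_semiring_0"
  assumes "f 0 = 0" "\<And>x y. f (x + y) = f x + f y" "\<And>x y. f (x * y) = f x * f y"
  shows "map_poly f (p * q) = map_poly f p * map_poly f q"
proof (rule poly_eqI)
  fix n
  have "f (sum g A) = (\<Sum>x\<in>A. f (g x))" for g :: "nat \<Rightarrow> 'b" and A
    by (induction A rule: infinite_finite_induct) (simp_all add: assms)
  then show "coeff (map_poly f (p * q)) n = coeff (map_poly f p * map_poly f q) n"
    by (simp add: coeff_map_poly assms coeff_mult)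
qed

lemma cpoly_mult: "cpoly (p * q) = cpoly p * cpoly q"
  by (rule map_poly_hom_mult) auto

lemma cpoly_add: "cpoly (p + q) = cpoly p + cpoly q"
  by (rule poly_eqI) (simp add: coeff_map_poly)

lemma cpoly_pderiv: "cpoly (pderiv p) = pderiv (cpoly p)"
  by (rule poly_eqI) (simp add: coeff_map_poly coeff_pderiv)

lemma cpoly_smult: "cpoly (smult c p) = smult (of_int c) (cpoly p)"
  by (rule poly_eqI) (simp add: coeff_map_poly)

lemma degree_cpoly [simp]: "degree (cpoly p) = degree p"
  by (cases "p = 0") (simp_all add: map_poly_degree_eq)

lemma coeff_cpoly [simp]: "coeff (cpoly p) n = of_int (coeff p n)"
  by (simp add: coeff_map_poly)

lemma cpoly_eq_iff [simp]: "cpoly p = cpoly q \<longleftrightarrow> p = q"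
  by (auto simp: poly_eq_iff)

lemma cpoly_eq_0_iff [simp]: "cpoly p = 0 \<longleftrightarrow> p = 0"
  by (auto simp: poly_eq_iff)

lemma poly_cpoly_of_int: "poly (cpoly p) (of_int x) = of_int (poly p x)"
  by (induction p) (simp_all add: map_poly_pCons)

lemma unit_roots_dvd:
  assumes "unit_roots h" "f dvd h"
  shows "unit_roots f"
  using assms by (auto simp: unit_roots_def cpoly_mult)

lemma mult_cnj_unit: "norm z = 1 \<Longrightarrow> z * cnj z = 1"
  by (simp add: complex_norm_square[symmetric])

text \<open>Reversing a polynomial inverts its roots, and on the unit circle inversion is
  conjugation.\<close>

lemma reflect_prod_unit_roots:
  assumes "\<forall>z\<in>#Z. norm z = 1"
  shows "reflect_poly (\<Prod>z\<in>#Z. [:- z, 1:])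
       = smult (\<Prod>z\<in>#Z. - z) (map_poly cnj (\<Prod>z\<in>#Z. [:- z, 1:]))"
  using assms
proof (induction Z)
  case (add z Z)
  have z: "norm z = 1" using add.prems by simp
  then have "z \<noteq> 0" by auto
  have m: "map_poly cnj ([:- z, 1:] * p) = [:- cnj z, 1:] * map_poly cnj p" for p
    by (simp only: map_poly_hom_mult[of cnj] complex_cnj_zero complex_cnj_add complex_cnj_mult)
       (simp add: map_poly_pCons)
  have r: "reflect_poly [:- z, 1:] = smult (- z) [:- cnj z, 1:]"
    using mult_cnj_unit[OF z] \<open>z \<noteq> 0\<close> by (simp add: reflect_poly_def)
  show ?case
  proof -
    have "reflect_poly (\<Prod>z\<in>#Z. [:- z, 1:])
        = smult (\<Prod>z\<in>#Z. - z) (map_poly cnj (\<Prod>z\<in>#Z. [:- z, 1:]))"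
      using add by simp
    then show ?thesis
      by (simp only: image_mset_add_mset prod_mset.add_mset reflect_poly_mult m r
          mult_smult_left mult_smult_right smult_smult mult.commute)
  qed
qed simp

lemma unit_roots_factorization:
  assumes "unit_roots h" "coeff h 0 = 1"
  obtains Z where "cpoly h = smult (of_int (lead_coeff h)) (\<Prod>z\<in>#Z. [:- z, 1:])"
    "\<forall>z\<in>#Z. norm z = 1" "size Z = degree h" "set_mset Z = {z. poly (cpoly h) z = 0}"
proof (rule that[of "proots (cpoly h)"])
  have "h \<noteq> 0" using assms(2) by auto
  show "cpoly h = smult (of_int (lead_coeff h)) (\<Prod>z\<in>#proots (cpoly h). [:- z, 1:])"
    using complex_poly_decompose_multiset[of "cpoly h"] by simp
  show set: "set_mset (proots (cpoly h)) = {z. poly (cpoly h) z = 0}"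
    using \<open>h \<noteq> 0\<close> by simp
  show "\<forall>z\<in>#proots (cpoly h). norm z = 1"
    unfolding set using assms(1) by (auto simp: unit_roots_def)
qed (simp add: size_proots_complex)

text \<open>Reversal acts on the roots as conjugation, which fixes an integer polynomial, so the
  reversal is proportional to \<open>h\<close>. Reversal also keeps the value at 1, which is
  nonzero, so the factor is 1.\<close>

lemma unit_roots_palindromic:
  assumes "unit_roots h" "coeff h 0 = 1" "poly h 1 > 0"
  shows "reflect_poly h = h" and "lead_coeff h = 1"
proof -
  obtain Z where Z: "cpoly h = smult (of_int (lead_coeff h)) (\<Prod>z\<in>#Z. [:- z, 1:])"
    "\<forall>z\<in>#Z. norm z = 1"
    using unit_roots_factorization[OF assms(1,2)] .
  define c q where "c = complex_of_int (lead_coeff h)" and "q = (\<Prod>z\<in>#Z. [:- z, 1:])"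
  have h: "cpoly h = smult c q" using Z(1) by (simp add: c_def q_def)
  have "poly (cpoly h) 0 = 1" using assms(2) by (simp add: poly_0_coeff_0)
  then have c: "c * (\<Prod>z\<in>#Z. - z) = 1" by (simp add: h q_def poly_prod_mset)
  have "map_poly cnj (cpoly h) = cpoly h" by (rule poly_eqI) (simp add: coeff_map_poly)
  then have conj: "smult c (map_poly cnj q) = cpoly h"
    unfolding h by (simp add: map_poly_smult c_def)
  have "cpoly (reflect_poly h) = reflect_poly (cpoly h)"
    by (rule poly_eqI) (simp add: coeff_reflect_poly)
  also have "\<dots> = map_poly cnj q"
    unfolding h reflect_poly_smult q_def reflect_prod_unit_roots[OF Z(2)]
    using c by simp
  finally have "cpoly (smult (lead_coeff h) (reflect_poly h)) = cpoly h"
    using conj by (simp add: cpoly_smult c_def)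
  then have eq: "smult (lead_coeff h) (reflect_poly h) = h" by (simp only: cpoly_eq_iff)
  have "poly (reflect_poly h) 1 = poly h 1"
  proof -
    have "degree (reflect_poly h) = degree h" using assms(2) by simp
    then show ?thesis unfolding poly_altdef
      by (auto intro!: sum.reindex_bij_witness[of _ "\<lambda>i. degree h - i" "\<lambda>i. degree h - i"]
          simp: coeff_reflect_poly)
  qed
  then have "lead_coeff h * poly h 1 = poly h 1" using arg_cong[OF eq, of "\<lambda>p. poly p 1"] by simp
  then show "lead_coeff h = 1" using assms(3) by simp
  with eq show "reflect_poly h = h" by simp
qed

lemma palindromic_coeff:
  assumes "reflect_poly h = h" "i \<le> degree h"
  shows "coeff h (degree h - i) = coeff h i"
  using coeff_reflect_poly[of h i] assms by simp

text \<open>By symmetry the mean exponent is half the degree; this is what converts a bound on h'(1)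
  into one on the degree.\<close>

lemma palindromic_pderiv_1:
  assumes "reflect_poly h = (h :: int poly)"
  shows "2 * poly (pderiv h) 1 = int (degree h) * poly h 1"
proof -
  let ?d = "degree h"
  have deriv: "poly (pderiv h) 1 = (\<Sum>i\<le>?d. int i * coeff h i)"
  proof -
    have "poly (pderiv h) 1 = (\<Sum>i\<le>?d. coeff (pderiv h) i)"
      unfolding poly_altdef power_one mult_1_right
      by (rule sum.mono_neutral_left) (auto simp: degree_pderiv coeff_eq_0)
    also have "\<dots> = (\<Sum>i\<le>?d. int (Suc i) * coeff h (Suc i))" by (simp add: coeff_pderiv)
    also have "\<dots> = (\<Sum>i\<le>Suc ?d. int i * coeff h i)"
      by (subst sum.atMost_Suc_shift) simp
    finally show ?thesis by (simp add: coeff_eq_0)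
  qed
  have "(\<Sum>i\<le>?d. int i * coeff h i) = (\<Sum>i\<le>?d. int (?d - i) * coeff h (?d - i))"
    by (rule sum.reindex_bij_witness[of _ "\<lambda>i. ?d - i" "\<lambda>i. ?d - i"]) auto
  also have "\<dots> = (\<Sum>i\<le>?d. (int ?d - int i) * coeff h i)"
    by (rule sum.cong) (auto simp: palindromic_coeff[OF assms] of_nat_diff)
  finally have "poly (pderiv h) 1 = (\<Sum>i\<le>?d. (int ?d - int i) * coeff h i)" using deriv by simp
  also have "\<dots> = (\<Sum>i\<le>?d. int ?d * coeff h i) - poly (pderiv h) 1"
    unfolding deriv by (simp add: left_diff_distrib sum_subtractf)
  finally have "2 * poly (pderiv h) 1 = (\<Sum>i\<le>?d. int ?d * coeff h i)" by simp
  then show ?thesis by (simp add: poly_altdef sum_distrib_left)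
qed

lemma degree_less_value:
  assumes "reflect_poly h = (h :: int poly)" "poly h 1 > 0"
    and "2 * poly (pderiv h) 1 \<le> poly h 1 * (poly h 1 - 1)"
  shows "int (degree h) < poly h 1"
proof -
  have "poly h 1 * int (degree h) \<le> poly h 1 * (poly h 1 - 1)"
    using palindromic_pderiv_1[OF assms(1)] assms(3) by (simp add: mult.commute)
  then show ?thesis using assms(2) by simp
qed

text \<open>A negative value at -1 and h(0) = 1 would give a real root strictly between -1 and
  0.\<close>

lemma poly_minus_1_nonneg:
  assumes "unit_roots h" "coeff h 0 = 1"
  shows "poly h (-1) \<ge> 0"
proof (rule ccontr)
  assume "\<not> poly h (-1) \<ge> 0"
  define r where "r = map_poly real_of_int h"
  have r_int: "poly r (of_int x) = of_int (poly h x)" for x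
    unfolding r_def by (induction h) (simp_all add: map_poly_pCons)
  have "poly r (-1) < 0" using r_int[of "-1"] \<open>\<not> poly h (-1) \<ge> 0\<close> by simp
  moreover have "poly r 0 > 0" using r_int[of 0] assms(2) by (simp add: poly_0_coeff_0)
  ultimately obtain x where x: "-1 < x" "x < 0" "poly r x = 0"
    using poly_IVT_pos[of "-1" 0 r] by auto
  have "poly (cpoly h) (of_real x) = of_real (poly r x)"
    unfolding r_def by (induction h) (simp_all add: map_poly_pCons)
  then have "norm (complex_of_real x) = 1" using x(3) assms(1) by (metis of_real_0 unit_roots_def)
  then show False using x by simp
qed

text \<open>Newton's identities in generating form: the logarithmic derivative of a product of
  factors 1 - w t is the sum of -w / (1 - w t), whose coefficients are the negated power
  sums.\<close>

lemma logarithmic_derivative_prod: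
  "fps_of_poly (\<Prod>w\<in>#W. [:1, - w:]) * Abs_fps (\<lambda>k. - (\<Sum>w\<in>#W. w ^ Suc k))
   = fps_of_poly (pderiv (\<Prod>w\<in>#W. [:1, - w:]))" for W :: "complex multiset"
proof (induction W)
  case empty
  have "Abs_fps (\<lambda>k. 0 :: complex) = 0" by (rule fps_ext) simp
  then show ?case by simp
next
  case (add w W)
  define p where "p = (\<Prod>w\<in>#W. [:1, - w:])"
  define A B where "A = Abs_fps (\<lambda>k. - (\<Sum>w\<in>#W. w ^ Suc k))" and "B = Abs_fps (\<lambda>k. - (w ^ Suc k))"
  have AB: "Abs_fps (\<lambda>k. - (\<Sum>w\<in>#add_mset w W. w ^ Suc k)) = A + B"
    by (rule fps_ext) (simp add: A_def B_def)
  have q: "fps_of_poly [:1, - w:] = 1 - fps_const w * fps_X"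
    by (simp add: fps_of_poly_pCons mult.commute flip: fps_const_neg)
  have "(1 - fps_const w * fps_X) * B = fps_const (- w)"
  proof (rule fps_ext)
    fix n show "fps_nth ((1 - fps_const w * fps_X) * B) n = fps_nth (fps_const (- w)) n"
      by (cases n) (simp_all add: B_def left_diff_distrib mult.assoc)
  qed
  then have B: "fps_of_poly [:1, - w:] * B = fps_of_poly [:- w:]"
    by (simp only: q fps_of_poly_const)
  have "fps_of_poly ([:1, - w:] * p) * (A + B)
      = fps_of_poly [:1, - w:] * (fps_of_poly p * A) + (fps_of_poly [:1, - w:] * B) * fps_of_poly p"
    by (simp only: fps_of_poly_mult) (simp only: ring_distribs ac_simps)
  also have "\<dots> = fps_of_poly ([:1, - w:] * pderiv p + [:- w:] * p)"
    unfolding B using add.IH by (simp only: p_def A_def fps_of_poly_mult fps_of_poly_add)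
  also have "[:1, - w:] * pderiv p + [:- w:] * p = pderiv ([:1, - w:] * p)"
    by (simp only: pderiv_mult) (simp add: pderiv_pCons)
  finally show ?case unfolding AB by (simp only: image_mset_add_mset prod_mset.add_mset p_def)
qed

text \<open>Comparing coefficients in the logarithmic derivative gives a recursion for the power
  sums; constant coefficient 1 means that no division occurs.\<close>

lemma power_sums_integral:
  assumes "cpoly h = (\<Prod>w\<in>#W. [:1, - w:])" "coeff h 0 = 1"
  shows "(\<Sum>w\<in>#W. w ^ Suc k) \<in> \<int>"
proof (induction k rule: less_induct)
  case (less k)
  define A where "A = Abs_fps (\<lambda>k. - (\<Sum>w\<in>#W. w ^ Suc k))"
  have "fps_of_poly (cpoly h) * A = fps_of_poly (cpoly (pderiv h))"
    using logarithmic_derivative_prod[of W] by (simp add: assms(1) cpoly_pderiv A_def)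
  from arg_cong[OF this, of "\<lambda>F. fps_nth F k"]
  have "(\<Sum>i=0..k. of_int (coeff h i) * fps_nth A (k - i)) = of_int (coeff (pderiv h) k)"
    by (simp add: fps_mult_nth)
  then have "fps_nth A k = of_int (coeff (pderiv h) k)
      - (\<Sum>i\<in>{0..k}-{0}. of_int (coeff h i) * fps_nth A (k - i))"
    by (subst (asm) sum.remove[of _ 0]) (auto simp: assms(2) algebra_simps)
  also have "\<dots> \<in> \<int>"
    using less by (intro Ints_diff Ints_sum Ints_mult) (auto simp: A_def)
  finally show ?case by (simp add: A_def)
qed

text \<open>Factors 1 - w t fit expansions at 0. Each \<open>w\<close> is the inverse of a root,
  which on the unit circle is its conjugate.\<close>

lemma reciprocal_factorization:
  assumes "unit_roots h" "coeff h 0 = 1"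
  obtains W where "cpoly h = (\<Prod>w\<in>#W. [:1, - w:])" "\<forall>w\<in>#W. norm w = 1" "size W = degree h"
    "\<And>z. poly (cpoly h) z = 0 \<Longrightarrow> cnj z \<in># W"
proof -
  obtain Z where Z: "cpoly h = smult (of_int (lead_coeff h)) (\<Prod>z\<in>#Z. [:- z, 1:])"
    "\<forall>z\<in>#Z. norm z = 1" "size Z = degree h" "set_mset Z = {z. poly (cpoly h) z = 0}"
    using unit_roots_factorization[OF assms] .
  have "poly (cpoly h) 0 = 1" using assms(2) by (simp add: poly_0_coeff_0)
  then have c: "of_int (lead_coeff h) * (\<Prod>z\<in>#Z. - z) = 1"
    by (subst (asm) Z(1)) (simp add: poly_prod_mset)
  have "(\<Prod>z\<in>#Z. [:- z, 1:]) = smult (\<Prod>z\<in>#Z. - z) (\<Prod>w\<in>#image_mset cnj Z. [:1, - w:])"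
    using Z(2)
  proof (induction Z)
    case (add z Z)
    have "z * cnj z = 1" using mult_cnj_unit add.prems by auto
    then have "[:- z, 1:] = smult (- z) [:1, - cnj z:]" by simp
    moreover have "(\<Prod>z\<in>#Z. [:- z, 1:]) = smult (\<Prod>z\<in>#Z. - z) (\<Prod>w\<in>#image_mset cnj Z. [:1, - w:])"
      using add by simp
    ultimately show ?case
      by (simp only: image_mset_add_mset prod_mset.add_mset
          mult_smult_left mult_smult_right smult_smult mult.commute)
  qed simp
  then have "cpoly h = (\<Prod>w\<in>#image_mset cnj Z. [:1, - w:])"
    using c by (subst Z(1)) simp
  then show ?thesis using Z by (intro that[of "image_mset cnj Z"]) auto
qed

lemma norm_sum_mset_unit_le:
  "\<forall>w\<in>#W. norm w = 1 \<Longrightarrow> norm (\<Sum>w\<in>#W. w ^ k :: complex) \<le> size W"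
proof (induction W)
  case (add w W)
  then have "norm (w ^ k) = 1" by (simp add: norm_power)
  with add norm_triangle_ineq[of "w ^ k" "\<Sum>w\<in>#W. w ^ k"] show ?case by simp
qed simp

text \<open>This coefficient is minus the sum of \<open>degree h\<close> numbers of norm 1.\<close>

lemma abs_coeff_1_le:
  assumes "unit_roots h" "coeff h 0 = 1"
  shows "\<bar>coeff h 1\<bar> \<le> int (degree h)"
proof -
  obtain W where W: "cpoly h = (\<Prod>w\<in>#W. [:1, - w:])" "\<forall>w\<in>#W. norm w = 1" "size W = degree h"
    using reciprocal_factorization[OF assms] by blast
  from arg_cong[OF logarithmic_derivative_prod[of W], of "\<lambda>F. fps_nth F 0"]
  have "of_int (coeff h 1) = - (\<Sum>w\<in>#W. w ^ 1)"
    using assms(2) by (simp add: W(1)[symmetric] fps_mult_nth cpoly_pderiv[symmetric] coeff_pderiv)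
  then have "norm (of_int (coeff h 1) :: complex) \<le> size W"
    using norm_sum_mset_unit_le[OF W(2), of 1] by (simp only: norm_minus_cancel)
  then show ?thesis using W(3) by simp
qed

text \<open>The Vandermonde argument in linear form: weights orthogonal to the first
  \<open>n\<close> powers are orthogonal to every polynomial of degree below \<open>n\<close>, so
  one may test against a polynomial that isolates a single root.\<close>

lemma sum_mset_weighted_poly:
  assumes "\<And>i. i < n \<Longrightarrow> (\<Sum>w\<in>#W. g w * w ^ i) = 0" "degree Q < n"
  shows "(\<Sum>w\<in>#W. g w * poly Q w) = (0 :: complex)"
proof -
  have "(\<Sum>w\<in>#W. g w * poly Q w) = (\<Sum>w\<in>#W. \<Sum>i\<le>degree Q. coeff Q i * (g w * w ^ i))"
    by (simp add: poly_altdef sum_distrib_left ac_simps)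
  also have "\<dots> = (\<Sum>i\<le>degree Q. \<Sum>w\<in>#W. coeff Q i * (g w * w ^ i))"
    by (induction W) (simp_all add: sum.distrib)
  also have "\<dots> = (\<Sum>i\<le>degree Q. coeff Q i * (\<Sum>w\<in>#W. g w * w ^ i))"
    by (simp add: sum_mset_distrib_left)
  also have "\<dots> = 0" using assms by simp
  finally show ?thesis .
qed

text \<open>Kronecker: the integers $\sum_w w^{k+1}$ are bounded, so two windows of length \<open>degree h\<close>
  of this sequence agree, and a Vandermonde argument separates the roots.\<close>

lemma roots_of_unity:
  assumes "unit_roots h" "coeff h 0 = 1"
  shows "\<exists>T>0. \<forall>z. poly (cpoly h) z = 0 \<longrightarrow> z ^ T = 1"
proof -
  obtain W where W: "cpoly h = (\<Prod>w\<in>#W. [:1, - w:])" "\<forall>w\<in>#W. norm w = 1" "size W = degree h"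
    "\<And>z. poly (cpoly h) z = 0 \<Longrightarrow> cnj z \<in># W"
    using reciprocal_factorization[OF assms] by blast
  define n where "n = size W"
  define a where "a k = (\<Sum>w\<in>#W. w ^ Suc k)" for k
  define V where "V = complex_of_int ` {- int n..int n}"
  have "a k \<in> V" for k
  proof -
    obtain m where m: "a k = of_int m"
      using power_sums_integral[OF W(1) assms(2)] unfolding a_def Ints_def by blast
    have "norm (a k) \<le> n" unfolding a_def n_def by (rule norm_sum_mset_unit_le[OF W(2)])
    then have "\<bar>m\<bar> \<le> int n" by (simp add: m)
    then show ?thesis unfolding V_def m by (intro imageI) auto
  qed
  then have "range (\<lambda>k. map (\<lambda>i. a (k + i)) [0..<n]) \<subseteq> {xs. set xs \<subseteq> V \<and> length xs = n}" by auto
  moreover have "finite {xs. set xs \<subseteq> V \<and> length xs = n}"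
    by (rule finite_lists_length_eq) (simp add: V_def)
  ultimately have "\<not> inj (\<lambda>k. map (\<lambda>i. a (k + i)) [0..<n])"
    using finite_subset range_inj_infinite by blast
  then obtain k l where kl: "k < l" and eq: "map (\<lambda>i. a (k + i)) [0..<n] = map (\<lambda>i. a (l + i)) [0..<n]"
    unfolding inj_def by (metis linorder_neqE_nat)
  define T where "T = l - k"
  have "a (k + i) = a (l + i)" if "i < n" for i
    using arg_cong[OF eq, of "\<lambda>xs. xs ! i"] that by simp
  \<comment> \<open>Subtracting the two equal windows makes w^T - 1, times a power of
    \<open>w\<close>, the weight in \<open>sum_mset_weighted_poly\<close>.\<close>
  have vanish: "(\<Sum>w\<in>#W. (w ^ T - 1) * w ^ Suc k * w ^ i) = 0" if "i < n" for i
  proof -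
    have "l = k + T" using kl by (simp add: T_def)
    then have "(\<Sum>w\<in>#W. (w ^ T - 1) * w ^ Suc k * w ^ i) = a (l + i) - a (k + i)"
      unfolding a_def by (induction W) (simp_all add: algebra_simps power_add)
    then show ?thesis using \<open>\<And>i. i < n \<Longrightarrow> a (k + i) = a (l + i)\<close>[OF that] by simp
  qed
  have "w ^ T = 1" if w: "w \<in># W" for w
  proof -
    \<comment> \<open>\<open>Q\<close> vanishes at every element of \<open>W\<close> other than
      \<open>w\<close>, so only the copies of \<open>w\<close> survive in the sum.\<close>
    define Q where "Q = (\<Prod>v\<in>set_mset W - {w}. [:- v, 1:])"
    have "degree Q \<le> card (set_mset W - {w})"
      unfolding Q_def using degree_prod_sum_le[of "set_mset W - {w}" "\<lambda>v. [:- v, 1:]"] by simp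
    also have "\<dots> < card (set_mset W)" using w by (intro psubset_card_mono) auto
    also have "\<dots> \<le> n" unfolding n_def by (metis size_mset_set size_mset_mono mset_set_set_mset_msubset)
    finally have "degree Q < n" .
    from sum_mset_weighted_poly[of n "\<lambda>w. (w ^ T - 1) * w ^ Suc k" W, OF vanish this]
    have "0 = (\<Sum>v\<in>#W. (v ^ T - 1) * v ^ Suc k * poly Q v)" by simp
    also have "\<dots> = (\<Sum>v\<in>#W. if v = w then (w ^ T - 1) * w ^ Suc k * poly Q w else 0)"
      by (rule arg_cong[of _ _ sum_mset], rule image_mset_cong) (auto simp: Q_def poly_prod)
    also have "\<dots> = of_nat (count W w) * ((w ^ T - 1) * w ^ Suc k * poly Q w)"
      by (simp add: sum_mset_delta)
    finally have "(w ^ T - 1) * w ^ Suc k * poly Q w = 0" using w by (auto simp: count_eq_zero_iff)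
    moreover have "w \<noteq> 0" using W(2) w by auto
    moreover have "poly Q w \<noteq> 0" by (auto simp: Q_def poly_prod)
    ultimately show ?thesis by simp
  qed
  then have "z ^ T = 1" if "poly (cpoly h) z = 0" for z
    using W(4)[OF that] by (metis complex_cnj_cnj complex_cnj_one complex_cnj_power)
  then show ?thesis using kl unfolding T_def by (intro exI[of _ "l - k"]) auto
qed

section \<open>Products of the polynomials Psi\<close>

lemma poly_Psi: "poly (Psi m) x = (\<Sum>i<m. x ^ i)"
  by (simp add: Psi_def poly_sum poly_monom)

lemma poly_Psi_1 [simp]: "poly (Psi m) 1 = int m"
  by (simp add: poly_Psi)

lemma coeff_Psi: "coeff (Psi m) i = (if i < m then 1 else 0)"
  by (simp add: Psi_def coeff_sum)

lemma Psi_0 [simp]: "Psi 0 = 0" and Psi_1 [simp]: "Psi (Suc 0) = 1"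
  by (simp_all add: Psi_def)

lemma Psi_Suc: "Psi (Suc m) = pCons 1 (Psi m)"
  by (rule poly_eqI) (simp add: coeff_Psi coeff_pCons split: nat.splits)

lemma degree_Psi: "degree (Psi m) = m - 1"
proof (cases m)
  case (Suc n)
  then show ?thesis by (intro antisym degree_le le_degree) (auto simp: coeff_Psi)
qed simp

lemma Psi_eq_0_iff [simp]: "Psi m = 0 \<longleftrightarrow> m = 0"
  by (metis Psi_0 coeff_0 coeff_Psi gr0I zero_neq_one)

lemma lead_coeff_Psi: "m > 0 \<Longrightarrow> lead_coeff (Psi m) = 1"
  by (simp add: degree_Psi coeff_Psi)

lemma one_minus_times_Psi: "(1 - monom 1 1) * Psi m = 1 - monom 1 m"
proof (induction m)
  case (Suc m)
  have "Psi (Suc m) = Psi m + monom 1 m" by (simp add: Psi_def)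
  then show ?case using Suc
    by (simp add: distrib_left left_diff_distrib mult_monom)
qed (simp add: monom_0 one_pCons)

lemma type_CI_prod: "\<forall>m\<in>set ms. m > 0 \<Longrightarrow> type_CI (\<Prod>m\<leftarrow>ms. Psi m)"
  by (auto simp: type_CI_def)

section \<open>The values 1, 4 and 6 of h(1)\<close>

lemma eq_pCons_coeffs: "degree h \<le> n \<Longrightarrow> h = Poly (map (coeff h) [0..<Suc n])" for h :: "int poly"
  by (rule poly_eqI) (auto simp: coeff_Poly_eq nth_default_def coeff_eq_0 simp del: upt_Suc)

lemma unit_roots_monic:
  assumes "unit_roots h" "coeff h 0 = 1" "poly h 1 > 0"
  shows "coeff h (degree h) = 1" "i \<le> degree h \<Longrightarrow> coeff h (degree h - i) = coeff h i"
  using unit_roots_palindromic[OF assms] palindromic_coeff by auto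

lemma type_CI_value_1:
  assumes "coeff h 0 = 1" "int (degree h) < poly h 1" "poly h 1 = 1"
  shows "type_CI h"
proof -
  have "degree h = 0" using assms by simp
  then have "h = 1" using assms(1) by (auto elim!: degree_eq_zeroE simp: one_pCons)
  then show ?thesis using type_CI_prod[of "[]"] by simp
qed

text \<open>In each degree up to 3 palindromy leaves at most one free coefficient, and the value 4
  fixes it.\<close>

lemma type_CI_value_4:
  assumes h: "unit_roots h" "coeff h 0 = 1" and "int (degree h) < poly h 1" "poly h 1 = 4"
  shows "type_CI h"
proof -
  note pal = unit_roots_monic[OF h] assms(4)
  have "degree h \<le> 3" using assms by simp
  then consider "degree h = 0" | "degree h = 1" | "degree h = 2" | "degree h = 3" by linarith
  then show ?thesis
  proof cases
    case 1
    then have "h = [:1:]" using eq_pCons_coeffs[of h 0] h by simp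
    then show ?thesis using assms(4) by (metis poly_const_conv numeral_eq_one_iff semiring_norm(85))
  next
    case 2
    then have "h = [:1, 1:]" using eq_pCons_coeffs[of h 1] pal h by simp
    then have "poly h 1 = 2" by simp
    then show ?thesis using assms(4) by simp
  next
    case 3
    then have eq: "h = [:1, coeff h 1, 1:]"
      using eq_pCons_coeffs[of h 2] pal h by (simp add: upt_rec numeral_eq_Suc)
    have "coeff h 1 = 2" using assms(4) by (subst (asm) eq) simp
    with eq have "h = (\<Prod>m\<leftarrow>[2, 2]. Psi m)" by (simp add: numeral_eq_Suc Psi_Suc)
    then show ?thesis using type_CI_prod[of "[2, 2]"] by auto
  next
    case 4
    then have eq: "h = [:1, coeff h 1, coeff h 1, 1:]"
      using eq_pCons_coeffs[of h 3] pal(2)[of 1] pal h by (simp add: upt_rec numeral_eq_Suc)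
    have "coeff h 1 = 1" using assms(4) by (subst (asm) eq) simp
    with eq have "h = (\<Prod>m\<leftarrow>[4]. Psi m)" by (simp add: numeral_eq_Suc Psi_Suc)
    then show ?thesis using type_CI_prod[of "[4]"] by simp
  qed
qed

text \<open>Up to degree 3, palindromy and the value leave one candidate per degree, and 1 + 4 t +
  t^2 fails \<open>abs_coeff_1_le\<close>. Degrees 4 and 5 leave an integer parameter, confined to a
  short range by the constraints on roots; \<open>h2\<close> decides within that range. It is
  essential: (1 + t^2) (1 + t + t^2) satisfies every other premise.\<close>

lemma type_CI_value_6:
  assumes h: "unit_roots h" "coeff h 0 = 1" and "int (degree h) < poly h 1" "poly h 1 = 6"
    and h2: "2 * coeff h 2 \<le> coeff h 1 * (coeff h 1 + 1)"
  shows "type_CI h"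
proof -
  note pal = unit_roots_monic[OF h] assms(4)
  have bound: "\<bar>coeff h 1\<bar> \<le> int (degree h)" by (rule abs_coeff_1_le[OF h])
  have "degree h \<le> 5" using assms by simp
  then consider "degree h = 0" | "degree h = 1" | "degree h = 2" | "degree h = 3"
    | "degree h = 4" | "degree h = 5" by linarith
  then show ?thesis
  proof cases
    case 1
    then have "h = [:1:]" using eq_pCons_coeffs[of h 0] h by simp
    then have "poly h 1 = 1" by simp
    then show ?thesis using assms(4) by simp
  next
    case 2
    then have "h = [:1, 1:]" using eq_pCons_coeffs[of h 1] pal h by simp
    then have "poly h 1 = 2" by simp
    then show ?thesis using assms(4) by simp
  next
    case 3
    then have eq: "h = [:1, coeff h 1, 1:]"
      using eq_pCons_coeffs[of h 2] pal h by (simp add: upt_rec numeral_eq_Suc)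
    have "coeff h 1 = 4" using assms(4) by (subst (asm) eq) simp
    with bound 3 show ?thesis by simp
  next
    case 4
    then have eq: "h = [:1, coeff h 1, coeff h 1, 1:]"
      using eq_pCons_coeffs[of h 3] pal(2)[of 1] pal h by (simp add: upt_rec numeral_eq_Suc)
    have "coeff h 1 = 2" using assms(4) by (subst (asm) eq) simp
    with eq have "h = (\<Prod>m\<leftarrow>[2, 3]. Psi m)" by (simp add: numeral_eq_Suc Psi_Suc)
    then show ?thesis using type_CI_prod[of "[2, 3]"] by auto
  next
    case 5
    define a b where "a = coeff h 1" and "b = coeff h 2"
    have eq: "h = [:1, a, b, a, 1:]"
      using eq_pCons_coeffs[of h 4] pal(2)[of 1] pal h 5 unfolding a_def b_def
      by (simp add: upt_rec numeral_eq_Suc)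
    have b: "b = 4 - 2 * a" using assms(4) unfolding eq by simp
    have "a \<le> 1" using poly_minus_1_nonneg[OF h] b unfolding eq by simp
    moreover have "a \<ge> -4" using bound 5 unfolding a_def by simp
    moreover have "2 * b \<le> a * (a + 1)" using h2 unfolding a_def b_def .
    ultimately have "a \<in> {-4, -3, -2, -1, 0, 1}" "2 * (4 - 2 * a) \<le> a * (a + 1)"
      unfolding b by auto
    then show ?thesis by auto
  next
    case 6
    define c e where "c = coeff h 1" and "e = coeff h 2"
    have eq: "h = [:1, c, e, e, c, 1:]"
      using eq_pCons_coeffs[of h 5] pal(2)[of 1] pal(2)[of 2] pal h 6 unfolding c_def e_def
      by (simp add: upt_rec numeral_eq_Suc)
    have e: "e = 2 - c" using assms(4) unfolding eq by simp
    \<comment> \<open>A palindromic polynomial of odd degree vanishes at -1, so its sign there says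
      nothing. The factor 1 + t is split off and the tests are applied to the quotient.\<close>
    define k where "k = [:1, c - 1, 3 - 2 * c, c - 1, 1:]"
    have "h = [:1, 1:] * k" unfolding eq e k_def by simp
    then have "k dvd h" by (metis dvd_triv_right)
    then have k: "unit_roots k" "coeff k 0 = 1"
      using unit_roots_dvd[OF h(1)] by (blast, simp add: k_def)
    have "c \<le> 1" using poly_minus_1_nonneg[OF k] by (simp add: k_def)
    moreover have "c \<ge> -3" using abs_coeff_1_le[OF k] by (simp add: k_def)
    moreover have "2 * e \<le> c * (c + 1)" using h2 unfolding c_def e_def .
    ultimately have "c \<in> {-3, -2, -1, 0, 1}" "2 * (2 - c) \<le> c * (c + 1)" unfolding e by auto
    then have "c = 1" by auto
    with eq e have "h = (\<Prod>m\<leftarrow>[6]. Psi m)" by (simp add: numeral_eq_Suc Psi_Suc)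
    then show ?thesis using type_CI_prod[of "[6]"] by simp
  qed
qed

section \<open>The case where h(1) is prime\<close>

lemma prime_factor_value:
  fixes h :: "int poly"
  assumes "h \<noteq> 0" "prime p" "p dvd poly h 1"
  obtains f where "prime_elem f" "f dvd h" "p dvd poly f 1"
proof -
  have "h \<noteq> 0 \<longrightarrow> p dvd poly h 1 \<longrightarrow> (\<exists>f. prime_elem f \<and> f dvd h \<and> p dvd poly f 1)"
  proof (induction h rule: prime_divisors_induct)
    case (unit x)
    then obtain y where "1 = x * y" by (elim dvdE)
    then have "1 = poly x 1 * poly y 1" by (metis poly_1 poly_mult)
    then have "p dvd poly x 1 \<Longrightarrow> is_unit p" by (metis dvd_triv_left dvd_trans)
    then show ?case using assms(2) not_prime_unit by blast
  next
    case (factor q x)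
    show ?case
    proof (intro impI)
      assume "q * x \<noteq> 0" "p dvd poly (q * x) 1"
      then consider "p dvd poly q 1" | "x \<noteq> 0" "p dvd poly x 1"
        using assms(2) by (auto simp: prime_dvd_mult_iff)
      then show "\<exists>f. prime_elem f \<and> f dvd q * x \<and> p dvd poly f 1"
      proof cases
        case 1
        then show ?thesis using factor by (intro exI[of _ q]) (auto dest: prime_imp_prime_elem)
      next
        case 2
        then show ?thesis using factor by auto
      qed
    qed
  qed simp
  then show ?thesis using assms that by blast
qed

text \<open>Divisibility is wanted over the integers, where leading coefficients cannot be inverted.
  Pseudo-division by a nonzero \<open>m\<close> of least degree vanishing at \<open>z\<close> shows
  that \<open>m\<close> divides a nonzero constant multiple of \<open>f\<close> and of
  \<open>g\<close>. Primality gives that \<open>f\<close> divides \<open>m\<close>: if it divided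
  the cofactor \<open>q\<close> instead, \<open>m\<close> would divide a nonzero constant although
  m(z) = 0.\<close>

lemma prime_elem_dvd_if_common_root:
  fixes f g :: "int poly" and z :: complex
  assumes f: "prime_elem f" "poly (cpoly f) z = 0" and g: "poly (cpoly g) z = 0"
  shows "f dvd g"
proof -
  have not_const: "a \<noteq> 0 \<Longrightarrow> \<not> f dvd [:a:]" for a
  proof
    assume "a \<noteq> 0" "f dvd [:a:]"
    then obtain k where "[:a:] = f * k" by (elim dvdE)
    then have "poly (cpoly [:a:]) z = 0" using f(2) by (simp add: cpoly_mult)
    then show False using \<open>a \<noteq> 0\<close> by (simp add: map_poly_pCons)
  qed
  have "f \<noteq> 0" using f(1) by auto
  define P where "P q \<longleftrightarrow> q \<noteq> 0 \<and> poly (cpoly q) z = 0" for q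
  have "P f" using f \<open>f \<noteq> 0\<close> by (simp add: P_def)
  define m where "m = (ARG_MIN degree q. P q)"
  have m: "m \<noteq> 0" "poly (cpoly m) z = 0" and min: "\<And>q. P q \<Longrightarrow> degree m \<le> degree q"
    using arg_min_natI[of P f degree, OF \<open>P f\<close>] arg_min_nat_le[of P _ degree] unfolding m_def P_def
    by blast+
  have div: "\<exists>a q. a \<noteq> 0 \<and> smult a u = m * q" if u: "poly (cpoly u) z = 0" for u
  proof -
    obtain a q where a: "a \<noteq> 0" "smult a u = m * q + pseudo_mod u m"
      using pseudo_mod(1)[OF m(1)] by blast
    from arg_cong[OF a(2), of "\<lambda>p. poly (cpoly p) z"]
    have "poly (cpoly (pseudo_mod u m)) z = 0"
      using u m(2) by (simp add: cpoly_add cpoly_mult cpoly_smult)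
    then have "pseudo_mod u m = 0"
      using min[of "pseudo_mod u m"] pseudo_mod(2)[OF m(1), of u] unfolding P_def by fastforce
    with a show ?thesis by auto
  qed
  obtain a q where a: "a \<noteq> 0" "smult a f = m * q" using div f(2) by blast
  have "f dvd m * q" using a(2) by (metis dvd_smult dvd_refl)
  moreover have "\<not> f dvd q"
  proof
    assume "f dvd q"
    then obtain r where "q = f * r" by (elim dvdE)
    then have "f * [:a:] = f * (m * r)" using a(2) by (simp add: ac_simps)
    then have "[:a:] = m * r" using \<open>f \<noteq> 0\<close> mult_left_cancel by blast
    then have "poly (cpoly [:a:]) z = 0" using m(2) by (simp add: cpoly_mult)
    then show False using a(1) by (simp add: map_poly_pCons)
  qed
  ultimately have "f dvd m" using f(1) by (simp add: prime_elem_dvd_mult_iff)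
  obtain b r where b: "b \<noteq> 0" "smult b g = m * r" using div g by blast
  have "f dvd [:b:] * g" using \<open>f dvd m\<close> b(2) by simp
  then show ?thesis using f(1) not_const[OF b(1)] by (metis prime_elem_dvd_mult_iff)
qed

text \<open>By absorption i (n choose i) = n (n - 1 choose i - 1). If p did not divide the binomial
  coefficient, n = p^s would divide the smaller number i.\<close>

lemma prime_dvd_prime_power_choose:
  assumes "prime p" "0 < i" "i < p ^ s"
  shows "p dvd (p ^ s choose i)"
proof (rule ccontr)
  assume "\<not> p dvd (p ^ s choose i)"
  then have cop: "coprime (p ^ s) (p ^ s choose i)"
    using assms(1) by (simp add: prime_imp_coprime)
  obtain k where k: "i = Suc k" using assms(2) by (cases i) auto
  have "i * (p ^ s choose i) = p ^ s * (p ^ s - 1 choose k)"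
    unfolding k by (rule binomial_absorption)
  then have "p ^ s dvd i" using cop by (metis coprime_dvd_mult_left_iff dvd_triv_left)
  then show False using assms by (auto dest: dvd_imp_le)
qed

lemma pcompose_monom: "pcompose (monom 1 n) q = q ^ n" for q :: "'a::comm_ring_1 poly"
  by (induction n) (simp_all add: monom_0 monom_Suc pcompose_pCons)

text \<open>Eisenstein's argument after the substitution \<open>t \<mapsto> t + 1\<close>.\<close>

lemma prime_dvd_value_if_dvd_prime_power:
  fixes A B :: "int poly"
  assumes p: "prime p" and AB: "A * B = monom 1 (p ^ s) - 1" and nd: "\<not> int p dvd poly A 1"
  shows "degree A = 0"
proof -
  define n where "n = p ^ s"
  have "n > 0" using p by (simp add: n_def prime_gt_0_nat)
  define A' B' where "A' = pcompose A [:1, 1:]" and "B' = pcompose B [:1, 1:]"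
  have prod: "A' * B' = [:1, 1:] ^ n - 1"
    using arg_cong[OF AB, of "\<lambda>q. pcompose q [:1, 1:]"]
    by (simp add: A'_def B'_def pcompose_mult pcompose_diff pcompose_monom pcompose_1 n_def)
  have coeff_pow: "coeff ([:1, 1:] ^ n) i = int (n choose i)" for i
    using coeff_linear_poly_power[of i n "1::int" 1] degree_linear_power[of "1::int" n]
    by (cases "i \<le> n") (simp_all add: coeff_eq_0)
  have low: "int p dvd coeff (A' * B') i" if "i < n" for i
  proof (cases "i = 0")
    case False
    then show ?thesis unfolding prod using prime_dvd_prime_power_choose[OF p _ that[unfolded n_def]]
      by (simp add: coeff_pow[unfolded n_def] n_def)
  qed (simp add: prod coeff_pow)
  have "A' * B' \<noteq> 0"
  proof -
    have "coeff (A' * B') n = 1" unfolding prod using \<open>n > 0\<close> by (simp add: coeff_pow)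
    then show ?thesis by auto
  qed
  then have nz: "A' \<noteq> 0" "B' \<noteq> 0" by auto
  have "degree ([:1, 1:] ^ n - 1 :: int poly) = n"
    by (intro antisym degree_le le_degree) (use \<open>n > 0\<close> in \<open>auto simp: coeff_pow\<close>)
  then have deg: "degree A' + degree B' = n" using nz prod degree_mult_eq by metis
  have "lead_coeff A' * lead_coeff B' = 1"
    using arg_cong[OF prod, of "\<lambda>q. coeff q n"] \<open>n > 0\<close>
    by (simp add: coeff_mult_degree_sum flip: deg) (simp add: deg coeff_pow)
  then have "\<not> int p dvd lead_coeff B'"
    using p by (metis dvd_mult not_prime_unit prime_nat_int_transfer)
  then have ex: "\<exists>j. \<not> int p dvd coeff B' j" by blast
  \<comment> \<open>Lowest coefficient of \<open>B'\<close> not divisible by \<open>p\<close>. Since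
    \<open>A'\<close> has constant term prime to \<open>p\<close>, coefficient \<open>j\<close> of
    the product is not divisible either, but all coefficients below \<open>n\<close> are. Hence
    \<open>j\<close>, and with it the degree of \<open>B'\<close>, is at least \<open>n\<close>,
    which leaves degree 0 for \<open>A'\<close>.\<close>
  define j where "j = (LEAST j. \<not> int p dvd coeff B' j)"
  have j: "\<not> int p dvd coeff B' j" "\<And>i. i < j \<Longrightarrow> int p dvd coeff B' i"
    using LeastI_ex[OF ex] not_less_Least unfolding j_def by blast+
  have A0: "\<not> int p dvd coeff A' 0"
    using nd by (simp add: A'_def poly_0_coeff_0[symmetric] poly_pcompose)
  have "coeff (A' * B') j = coeff A' 0 * coeff B' j + (\<Sum>i\<in>{..j}-{0}. coeff A' i * coeff B' (j - i))"
    by (simp add: coeff_mult sum.remove[of "{..j}" 0])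
  moreover have "int p dvd (\<Sum>i\<in>{..j}-{0}. coeff A' i * coeff B' (j - i))"
    using j(2) by (intro dvd_sum dvd_mult) auto
  moreover have "\<not> int p dvd coeff A' 0 * coeff B' j"
    using A0 j(1) p by (simp add: prime_dvd_mult_iff)
  ultimately have "\<not> int p dvd coeff (A' * B') j" by (simp add: dvd_add_left_iff)
  then have "n \<le> j" using low not_le by blast
  moreover have "j \<le> degree B'" using j(1) by (metis coeff_eq_0 dvd_0_right not_le)
  ultimately have "degree A' = 0" using deg by simp
  then show ?thesis by (simp add: A'_def degree_pcompose)
qed

lemma poly_pcompose_Psi: "(pcompose (Psi m) (monom 1 k)) * (monom 1 k - 1) = monom 1 (m * k) - 1"
proof -
  have "Psi m * (monom 1 1 - 1) = monom 1 m - 1"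
    using one_minus_times_Psi[of m] by (simp add: algebra_simps)
  from arg_cong[OF this, of "\<lambda>q. pcompose q (monom 1 k)"] show ?thesis
    by (simp add: pcompose_mult pcompose_diff pcompose_monom pcompose_1 monom_power mult.commute)
qed

lemma Psi_eq_pcompose: "pcompose (Psi m) (monom 1 (Suc 0)) = Psi m"
  by (simp add: monom_Suc monom_0)

lemma root_pcompose_Psi:
  fixes z :: complex
  assumes "z ^ (m * k) = 1" "z ^ k \<noteq> 1"
  shows "poly (cpoly (pcompose (Psi m) (monom 1 k))) z = 0"
proof -
  have monom: "cpoly (monom 1 j - 1) = monom 1 j - 1" for j
    by (rule poly_eqI) simp
  from arg_cong[OF poly_pcompose_Psi[of m k], of "\<lambda>q. poly (cpoly q) z"]
  have "poly (cpoly (pcompose (Psi m) (monom 1 k))) z * (z ^ k - 1) = z ^ (m * k) - 1"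
    by (simp only: cpoly_mult poly_mult monom poly_diff poly_monom) simp
  then show ?thesis using assms by simp
qed

lemma eq_if_dvd_same_degree:
  fixes f h :: "int poly"
  assumes "f dvd h" "degree h \<le> degree f" "lead_coeff f = lead_coeff h" "f \<noteq> 0"
  shows "f = h"
proof (cases "h = 0")
  case False
  obtain k where k: "h = f * k" using assms(1) by (elim dvdE)
  then have "degree k = 0" using False assms by (auto simp: degree_mult_eq)
  then obtain c where "k = [:c:]" by (elim degree_eq_zeroE)
  then have h: "h = smult c f" using k by simp
  moreover have "c * lead_coeff f = lead_coeff f" using assms(3) unfolding h lead_coeff_smult by (rule sym)
  ultimately show ?thesis using assms(4) by simp
qed (use assms in auto)

lemma type_CI_value_prime:
  assumes h: "unit_roots h" "coeff h 0 = 1" and deg: "int (degree h) < poly h 1"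
    and p: "prime (poly h 1)"
  shows "type_CI h"
proof -
  define p where "p = nat (poly h 1)"
  have h1: "poly h 1 = int p" and "prime p" using p by (auto simp: p_def prime_ge_0_int)
  have "poly h 1 > 0" using p prime_gt_0_int by blast
  note lead = unit_roots_palindromic(2)[OF h this]
  have "h \<noteq> 0" using h(2) by auto
  obtain f where f: "prime_elem f" "f dvd h" "int p dvd poly f 1"
    using prime_factor_value[OF \<open>h \<noteq> 0\<close> p] h1 by auto
  have "f \<noteq> 0" using f(1) by auto
  have "degree f > 0"
  proof (rule ccontr)
    assume "\<not> degree f > 0"
    then obtain a where a: "f = [:a:]" by (auto elim: degree_eq_zeroE)
    then have "a dvd 1" using f(2) lead by (metis const_poly_dvd_iff)
    moreover have "int p dvd a" using f(3) a by simp
    ultimately have "int p dvd 1" using dvd_trans by blast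
    then show False using \<open>prime p\<close> by (simp add: prime_nat_iff)
  qed
  then obtain z where z: "poly (cpoly f) z = 0"
    using fundamental_theorem_of_algebra_alt[of "cpoly f"] by (metis degree_cpoly degree_pCons_0 neq0_conv)
  obtain q where q: "h = f * q" using f(2) by (elim dvdE)
  obtain T where T: "T > 0" "z ^ T = 1"
    using roots_of_unity[OF h] z by (auto simp: q cpoly_mult)
  define N where "N = (LEAST N. N > 0 \<and> z ^ N = 1)"
  have N: "N > 0" "z ^ N = 1" and N_min: "\<And>k. k > 0 \<Longrightarrow> k < N \<Longrightarrow> z ^ k \<noteq> 1"
    using LeastI[of "\<lambda>N. N > 0 \<and> z ^ N = 1" T] T not_less_Least unfolding N_def by blast+
  have "z \<noteq> 1"
  proof
    assume "z = 1"
    then have "poly f 1 = 0" using z poly_cpoly_of_int[of f 1] by simp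
    then show False using h1 \<open>prime p\<close> by (simp add: q)
  qed
  then have "N \<noteq> 1" using N(2) by auto
  \<comment> \<open>\<open>N\<close> is the exact order of \<open>z\<close>, so z^(r k) = 1 while
    z^k is not 1, which makes \<open>z\<close> a root of Psi_r(t^k).\<close>
  have dvd_g: "f dvd pcompose (Psi r) (monom 1 k)" if "N = r * k" "r > 1" for r k
  proof (rule prime_elem_dvd_if_common_root[OF f(1) z root_pcompose_Psi])
    show "z ^ (r * k) = 1" using N(2) that by simp
    have "k > 0" "k < N" using N(1) that by auto
    then show "z ^ k \<noteq> 1" by (rule N_min)
  qed
  have value_g: "poly (pcompose (Psi r) (monom 1 k)) 1 = int r" for r k
    by (simp add: poly_pcompose poly_monom)
  \<comment> \<open>Psi_r(t^k) takes the value r at 1, so f(1) divides r; as \<open>p\<close>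
    divides f(1), it divides the prime \<open>r\<close>. This is what makes the order of
    \<open>z\<close> a power of \<open>p\<close>.\<close>
  have only_p: "r = p" if r: "prime r" "r dvd N" for r
  proof -
    obtain k where "N = r * k" using r(2) by (elim dvdE)
    then have "f dvd pcompose (Psi r) (monom 1 k)" using dvd_g r(1) prime_gt_1_nat by blast
    then have "poly f 1 dvd int r" using value_g by (metis dvdE dvd_triv_left poly_mult)
    then have "int p dvd int r" using f(3) dvd_trans by blast
    then show ?thesis using r(1) \<open>prime p\<close> by (metis int_dvd_int_iff primes_dvd_imp_eq)
  qed
  have "N \<noteq> 0" "\<not> is_unit p" using N(1) \<open>prime p\<close> not_prime_unit by auto
  then obtain m where m: "N = p ^ multiplicity p N * m" "\<not> p dvd m"
    by (rule multiplicity_decompose')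
  have "m = 1"
  proof (rule ccontr)
    assume "m \<noteq> 1"
    then obtain r where r: "prime r" "r dvd m" using prime_factor_nat by blast
    have "m dvd N" using m(1) dvd_triv_right by metis
    then have "r = p" using only_p r dvd_trans by blast
    then show False using m(2) r(2) by simp
  qed
  then have "N = p ^ multiplicity p N" using m(1) by simp
  then obtain s where s: "N = p ^ Suc s" using \<open>N \<noteq> 1\<close> by (cases "multiplicity p N") auto
  define g where "g = pcompose (Psi p) (monom 1 (p ^ s))"
  have "p > 1" using \<open>prime p\<close> prime_gt_1_nat by blast
  then have "f dvd g" unfolding g_def using dvd_g[of p "p ^ s"] s by simp
  then obtain k where k: "g = f * k" by (elim dvdE)
  have "f * (k * (monom 1 (p ^ s) - 1)) = monom 1 (p ^ Suc s) - 1"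
    using poly_pcompose_Psi[of p "p ^ s"] by (simp add: g_def[symmetric] k mult.assoc)
  \<comment> \<open>g(1) = p contains \<open>p\<close> only once and f(1) already uses it up, so the
    Eisenstein argument applies to the cofactor \<open>k\<close>.\<close>
  moreover have "poly f 1 * poly k 1 = int p" using value_g[of p "p ^ s"] by (simp add: g_def[symmetric] k)
  then have "\<not> int p dvd poly k 1"
  proof (intro notI)
    assume "int p dvd poly k 1"
    then have "int p * int p dvd int p"
      using f(3) \<open>poly f 1 * poly k 1 = int p\<close> by (metis mult_dvd_mono)
    then show False using \<open>p > 1\<close> by simp
  qed
  ultimately have "degree k = 0"
    using prime_dvd_value_if_dvd_prime_power[OF \<open>prime p\<close>, of k "f * (monom 1 (p ^ s) - 1)" "Suc s"]
    by (simp add: ac_simps)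
  have "degree g = (p - 1) * p ^ s"
    by (simp add: g_def degree_pcompose degree_Psi degree_monom_eq)
  moreover have "degree f = degree g"
  proof -
    obtain c where c: "k = [:c:]" using \<open>degree k = 0\<close> by (elim degree_eq_zeroE)
    have "c \<noteq> 0" using \<open>poly f 1 * poly k 1 = int p\<close> \<open>p > 1\<close> c by auto
    then show ?thesis by (simp add: k c)
  qed
  moreover have "degree f \<le> degree h" using f(2) \<open>h \<noteq> 0\<close> by (rule dvd_imp_degree_le)
  moreover have "degree h \<le> p - 1" using deg h1 by simp
  ultimately have "(p - 1) * p ^ s \<le> p - 1" by (metis order_trans)
  then have "p ^ s \<le> 1" using \<open>p > 1\<close> by simp
  then have "s = 0" using \<open>p > 1\<close> by (metis less_numeral_extra(3) linorder_not_less one_less_power not_gr0)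
  then have g: "g = Psi p" by (simp add: g_def Psi_eq_pcompose)
  have "g dvd h"
  proof -
    obtain c where c: "k = [:c:]" using \<open>degree k = 0\<close> by (elim degree_eq_zeroE)
    have "c * lead_coeff f = 1"
      using lead_coeff_Psi[of p] \<open>p > 1\<close> k by (simp only: g c lead_coeff_mult) (simp add: mult.commute)
    then have "c dvd 1" by (metis dvd_triv_left)
    then have "is_unit k" unfolding c by (simp add: is_unit_const_poly_iff)
    then show ?thesis using k f(2) by (simp add: mult_unit_dvd_iff)
  qed
  moreover have "degree h \<le> degree g" using \<open>degree h \<le> p - 1\<close> by (simp add: g degree_Psi)
  ultimately have "g = h"
    using lead lead_coeff_Psi[of p] \<open>p > 1\<close> by (intro eq_if_dvd_same_degree) (auto simp: g)
  then show ?thesis using type_CI_prod[of "[p]"] \<open>p > 1\<close> by (simp add: g)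
qed

section \<open>Standard monomials of a standard graded algebra\<close>

text \<open>Joins spans and dimensions of vector spaces with the multiplication of an algebra over
  the same \<open>K\<close> and \<open>R\<close>.\<close>

locale field_algebra = vectorspace K R + Alg: algebra K R for K and R (structure)
begin

lemma span_induct:
  assumes "T \<subseteq> carrier R" "x \<in> span T"
    and "\<And>t. t \<in> T \<Longrightarrow> P t" "P \<zero>"
    and "\<And>x y. x \<in> carrier R \<Longrightarrow> y \<in> carrier R \<Longrightarrow> P x \<Longrightarrow> P y \<Longrightarrow> P (x \<oplus> y)"
    and "\<And>c x. c \<in> carrier K \<Longrightarrow> x \<in> carrier R \<Longrightarrow> P x \<Longrightarrow> P (c \<odot> x)"
  shows "P x"
proof -
  have "submodule K {x \<in> carrier R. P x} R"
    using assms by (auto simp: submodule_def is_module intro: module_axioms)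
  moreover have "T \<subseteq> {x \<in> carrier R. P x}" using assms by auto
  ultimately show ?thesis using span_is_subset[of T "{x \<in> carrier R. P x}"] assms(2) by auto
qed

lemma span_add_closed: "T \<subseteq> carrier R \<Longrightarrow> x \<in> span T \<Longrightarrow> y \<in> span T \<Longrightarrow> x \<oplus> y \<in> span T"
  using span_is_submodule[of T] by (auto simp: submodule_def)

lemma span_smult_closed: "T \<subseteq> carrier R \<Longrightarrow> c \<in> carrier K \<Longrightarrow> x \<in> span T \<Longrightarrow> c \<odot> x \<in> span T"
  using span_is_submodule[of T] by (auto simp: submodule_def)

lemma smult_mult_right:
  "c \<in> carrier K \<Longrightarrow> x \<in> carrier R \<Longrightarrow> y \<in> carrier R \<Longrightarrow> x \<otimes> (c \<odot> y) = c \<odot> (x \<otimes> y)"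
  by (metis Alg.m_comm Alg.smult_assoc2 smult_closed)

lemma span_mult_closed:
  assumes T: "T \<subseteq> carrier R" and mult: "\<And>s t. s \<in> T \<Longrightarrow> t \<in> T \<Longrightarrow> s \<otimes> t \<in> T"
    and x: "x \<in> span T" and y: "y \<in> span T"
  shows "x \<otimes> y \<in> span T"
proof -
  have c: "z \<in> carrier R" if "z \<in> span T" for z using span_is_subset2[OF T] that by auto
  have sub: "T \<subseteq> span T" by (rule in_own_span[OF T])
  have "\<zero> \<in> span T" by (rule span_zero)
  have 1: "x \<otimes> t \<in> span T" if t: "t \<in> T" for t
  proof -
    have tc: "t \<in> carrier R" using t T by auto
    have ts: "s \<otimes> t \<in> span T" if "s \<in> T" for s using mult[OF that t] sub by auto
    show ?thesis
      by (rule span_induct[OF T x]) (simp_all add: ts tc \<open>\<zero> \<in> span T\<close> Alg.l_distr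
          Alg.smult_assoc2 span_add_closed[OF T] span_smult_closed[OF T])
  qed
  show ?thesis
    by (rule span_induct[OF T y]) (simp_all add: 1 c[OF x] \<open>\<zero> \<in> span T\<close> Alg.r_distr
        smult_mult_right span_add_closed[OF T] span_smult_closed[OF T])
qed

lemma dim_subspace_eq_card:
  assumes "submodule K N R" "B \<subseteq> N" "finite B" "lin_indpt B" "N \<subseteq> span B"
  shows "vectorspace.dim K (R\<lparr>carrier := N\<rparr>) = card B"
proof -
  have "subspace K N R" using assms(1) by (simp add: subspace_def vectorspace_axioms)
  then interpret N: vectorspace K "R\<lparr>carrier := N\<rparr>" by (rule subspace_is_vs)
  have "N.basis B"
    unfolding N.basis_def
    using assms span_li_not_depend[OF assms(2,1)] span_is_subset[OF assms(2,1)] by auto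
  then show ?thesis using N.dim_basis assms(3) by blast
qed

definition monom_val :: "nat \<Rightarrow> (nat \<Rightarrow> 'c) \<Rightarrow> nat multiset \<Rightarrow> 'c" where
  "monom_val s x u = (\<Otimes>i\<in>{..<s}. x i [^] count u i)"

context
  fixes s :: nat and x :: "nat \<Rightarrow> 'c"
  assumes x: "\<And>i. i < s \<Longrightarrow> x i \<in> carrier R"
begin

lemma monom_val_closed [simp]: "monom_val s x u \<in> carrier R"
  unfolding monom_val_def using x by (intro Alg.finprod_closed) auto

lemma monom_val_add: "monom_val s x (u + v) = monom_val s x u \<otimes> monom_val s x v"
proof -
  have "monom_val s x (u + v) = (\<Otimes>i\<in>{..<s}. x i [^] count u i \<otimes> x i [^] count v i)"
    unfolding monom_val_def using x by (intro Alg.finprod_cong') (auto simp: Alg.nat_pow_mult)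
  also have "\<dots> = monom_val s x u \<otimes> monom_val s x v"
    unfolding monom_val_def using x by (intro Alg.finprod_multf) auto
  finally show ?thesis .
qed

lemma monom_val_empty: "monom_val s x {#} = \<one>"
  by (simp add: monom_val_def)

lemma monom_val_single: "i < s \<Longrightarrow> monom_val s x {#i#} = x i"
proof -
  assume i: "i < s"
  have "monom_val s x {#i#} = (\<Otimes>j\<in>{..<s}. if i = j then x j else \<one>)"
    unfolding monom_val_def using x by (intro Alg.finprod_cong') auto
  also have "\<dots> = x i" using i x by (intro Alg.finprod_singleton) auto
  finally show ?thesis .
qed

end

end

text \<open>A standard graded algebra with a chosen enumeration x 0, ..., x (s - 1) of its
  generators. Evaluating monomials at \<open>x\<close> replaces a presentation as a quotient of a
  polynomial ring.\<close>

locale standard_graded = field_algebra K R for K and R :: "('a, 'c) module" (structure) +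
  fixes A :: "nat \<Rightarrow> 'c set" and s :: nat and x :: "nat \<Rightarrow> 'c"
  assumes A_submodule: "\<And>n. submodule K (A n) R"
    and A_mult: "\<And>i j a b. a \<in> A i \<Longrightarrow> b \<in> A j \<Longrightarrow> a \<otimes> b \<in> A (i + j)"
    and decomposition: "\<And>a. a \<in> carrier R \<Longrightarrow> \<exists>!f. (\<forall>n. f n \<in> A n) \<and> finite {n. f n \<noteq> \<zero>} \<and>
        a = finsum R f {n. f n \<noteq> \<zero>}"
    and one_A: "\<one> \<in> A 0"
    and x_A: "\<And>i. i < s \<Longrightarrow> x i \<in> A 1"
    and generated: "generate_ring R ((\<lambda>c. c \<odot> \<one>) ` carrier K \<union> x ` {..<s}) = carrier R"
begin

lemma A_subset: "A n \<subseteq> carrier R"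
  using A_submodule by (auto simp: submodule_def)

lemma x_carrier: "i < s \<Longrightarrow> x i \<in> carrier R"
  using x_A A_subset by blast

abbreviation mon :: "nat multiset \<Rightarrow> 'c" where "mon \<equiv> monom_val s x"

lemma mon_carrier: "mon u \<in> carrier R"
  using x_carrier by simp

lemma mon_add: "mon (u + v) = mon u \<otimes> mon v"
  by (rule monom_val_add) (rule x_carrier)

lemma mon_empty: "mon {#} = \<one>"
  by (rule monom_val_empty) (rule x_carrier)

lemma mon_single: "i < s \<Longrightarrow> mon {#i#} = x i"
  by (rule monom_val_single) (rule x_carrier)

lemma mon_A: "u \<in> monomials s \<Longrightarrow> mon u \<in> A (size u)"
proof (induction u)
  case empty
  then show ?case using one_A by (simp add: mon_empty)
next
  case (add i u)
  then have i: "i < s" and "u \<in> monomials s" by (auto simp: monomials_def)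
  have "mon (add_mset i u) = x i \<otimes> mon u"
    using mon_add[of "{#i#}" u] mon_single[OF i] by simp
  then show ?case using A_mult[OF x_A[OF i] add.IH] \<open>u \<in> monomials s\<close> by simp
qed

lemma monomials_add: "u \<in> monomials s \<Longrightarrow> v \<in> monomials s \<Longrightarrow> u + v \<in> monomials s"
  by (simp add: monomials_def)

lemma span_mons: "span (mon ` monomials s) = carrier R"
proof
  have T: "mon ` monomials s \<subseteq> carrier R" using mon_carrier by auto
  show "span (mon ` monomials s) \<subseteq> carrier R" by (rule span_is_subset2[OF T])
  have one: "\<one> \<in> span (mon ` monomials s)"
  proof -
    have "mon {#} \<in> mon ` monomials s" by (rule imageI) (simp add: monomials_def)
    then show ?thesis using in_own_span[OF T] unfolding mon_empty by blast
  qed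
  have gens: "h \<in> span (mon ` monomials s)"
    if "h \<in> (\<lambda>c. c \<odot> \<one>) ` carrier K \<union> x ` {..<s}" for h
    using that
  proof
    assume "h \<in> (\<lambda>c. c \<odot> \<one>) ` carrier K"
    then show ?thesis using span_smult_closed[OF T _ one] by auto
  next
    assume "h \<in> x ` {..<s}"
    then obtain i where i: "i < s" "h = x i" by auto
    then have "h = mon {#i#}" by (simp add: mon_single)
    then have "h \<in> mon ` monomials s" using i(1) by (auto simp: monomials_def)
    then show ?thesis using in_own_span[OF T] by blast
  qed
  have "h \<in> span (mon ` monomials s)"
    if "h \<in> generate_ring R ((\<lambda>c. c \<odot> \<one>) ` carrier K \<union> x ` {..<s})" for h
    using that
  proof induction
    case one
    then show ?case by (rule \<open>\<one> \<in> _\<close>)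
  next
    case (incl h)
    then show ?case by (rule gens)
  next
    case (a_inv h)
    then show ?case using span_neg[OF T] by (simp add: a_inv_def)
  next
    case (eng_add h1 h2)
    then show ?case by (intro span_add_closed[OF T])
  next
    case (eng_mult h1 h2)
    show ?case
    proof (rule span_mult_closed[OF T])
      fix a b assume "a \<in> mon ` monomials s" "b \<in> mon ` monomials s"
      then show "a \<otimes> b \<in> mon ` monomials s"
        using monomials_add by (auto simp flip: mon_add)
    qed (use eng_mult in auto)
  qed
  then show "carrier R \<subseteq> span (mon ` monomials s)" using generated by blast
qed

definition graded_parts :: "'c \<Rightarrow> (nat \<Rightarrow> 'c) \<Rightarrow> bool" where
  "graded_parts a f \<longleftrightarrow> (\<forall>n. f n \<in> A n) \<and> finite {n. f n \<noteq> \<zero>} \<and> a = finsum R f {n. f n \<noteq> \<zero>}"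

lemma graded_parts_unique: "a \<in> carrier R \<Longrightarrow> graded_parts a f \<Longrightarrow> graded_parts a g \<Longrightarrow> f = g"
  using decomposition unfolding graded_parts_def by blast

lemma zero_A: "\<zero> \<in> A n"
  using A_submodule by (auto simp: submodule_def)

lemma graded_partsI:
  assumes "\<And>n. f n \<in> A n" "finite T" "\<And>n. n \<notin> T \<Longrightarrow> f n = \<zero>" "a = finsum R f T"
  shows "graded_parts a f"
proof -
  have sub: "{n. f n \<noteq> \<zero>} \<subseteq> T" using assms(3) by blast
  have "finsum R f T = finsum R f {n. f n \<noteq> \<zero>}"
    using assms A_subset sub by (intro M.add.finprod_mono_neutral_cong_right) auto
  then show ?thesis using assms finite_subset[OF sub] by (auto simp: graded_parts_def)
qed

lemma graded_parts_sum_superset: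
  assumes "graded_parts a f" "finite T" "{n. f n \<noteq> \<zero>} \<subseteq> T"
  shows "a = finsum R f T"
proof -
  have "finsum R f T = finsum R f {n. f n \<noteq> \<zero>}"
    using assms A_subset by (intro M.add.finprod_mono_neutral_cong_right) (auto simp: graded_parts_def)
  then show ?thesis using assms(1) by (simp add: graded_parts_def)
qed

lemma graded_parts_homogeneous: "a \<in> A n \<Longrightarrow> graded_parts a (\<lambda>k. if k = n then a else \<zero>)"
proof (rule graded_partsI[of _ "{n}"])
  assume a: "a \<in> A n"
  then have "a \<in> carrier R" using A_subset by blast
  then show "a = finsum R (\<lambda>k. if k = n then a else \<zero>) {n}"
    by simp
qed (auto simp: zero_A)

abbreviation level_mons :: "nat \<Rightarrow> 'c set" where
  "level_mons n \<equiv> mon ` {u \<in> monomials s. size u = n}"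

lemma level_mons_A: "level_mons n \<subseteq> A n"
  using mon_A by auto

lemma level_mons_carrier: "level_mons n \<subseteq> carrier R"
  using mon_carrier by auto

text \<open>Monomials span everything, so each element has a decomposition whose parts lie in the
  spans of the monomials of each degree. For a homogeneous element, uniqueness of the decomposition
  identifies it with its own part.\<close>

lemma span_level_mons: "span (level_mons n) = A n"
proof
  show "span (level_mons n) \<subseteq> A n"
    by (rule span_is_subset[OF level_mons_A A_submodule])
  have "\<exists>f. graded_parts a f \<and> (\<forall>n. f n \<in> span (level_mons n))" if "a \<in> carrier R" for a
  proof (rule span_induct[of "mon ` monomials s"])
    show "a \<in> span (mon ` monomials s)" using that span_mons by simp
  next
    fix t assume "t \<in> mon ` monomials s"
    then obtain u where u: "u \<in> monomials s" "t = mon u" by auto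
    have "graded_parts t (\<lambda>k. if k = size u then t else \<zero>)"
      using mon_A[OF u(1)] u(2) by (intro graded_parts_homogeneous) simp
    moreover have "t \<in> span (level_mons (size u))"
      using in_own_span[OF level_mons_carrier] u by blast
    ultimately show "\<exists>f. graded_parts t f \<and> (\<forall>n. f n \<in> span (level_mons n))"
      by (intro exI[of _ "\<lambda>k. if k = size u then t else \<zero>"]) (auto simp: span_zero)
  next
    have "graded_parts \<zero> (\<lambda>k. \<zero>)" by (rule graded_partsI[of _ "{}"]) (auto simp: zero_A)
    then show "\<exists>f. graded_parts \<zero> f \<and> (\<forall>n. f n \<in> span (level_mons n))"
      by (intro exI[of _ "\<lambda>k. \<zero>"]) (auto simp: span_zero)
  next
    fix a b assume ab: "a \<in> carrier R" "b \<in> carrier R"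
      and "\<exists>f. graded_parts a f \<and> (\<forall>n. f n \<in> span (level_mons n))"
      and "\<exists>f. graded_parts b f \<and> (\<forall>n. f n \<in> span (level_mons n))"
    then obtain f g where f: "graded_parts a f" "\<And>n. f n \<in> span (level_mons n)"
      and g: "graded_parts b g" "\<And>n. g n \<in> span (level_mons n)" by blast
    define T where "T = {n. f n \<noteq> \<zero>} \<union> {n. g n \<noteq> \<zero>}"
    have T: "finite T" using f(1) g(1) by (simp add: T_def graded_parts_def)
    have fA: "f n \<in> A n" and gA: "g n \<in> A n" for n using f(1) g(1) by (auto simp: graded_parts_def)
    have "graded_parts (a \<oplus> b) (\<lambda>n. f n \<oplus> g n)"
    proof (rule graded_partsI[OF _ T])
      show "f n \<oplus> g n \<in> A n" for n using A_submodule[of n] fA gA by (auto simp: submodule_def)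
      show "f n \<oplus> g n = \<zero>" if "n \<notin> T" for n using that by (auto simp: T_def)
      have "a = finsum R f T" "b = finsum R g T"
        using graded_parts_sum_superset[OF f(1) T] graded_parts_sum_superset[OF g(1) T]
        by (auto simp: T_def)
      then show "a \<oplus> b = (\<Oplus>n\<in>T. f n \<oplus> g n)"
        using fA gA A_subset by (subst M.finsum_addf) auto
    qed
    then show "\<exists>f. graded_parts (a \<oplus> b) f \<and> (\<forall>n. f n \<in> span (level_mons n))"
      using f(2) g(2) by (intro exI[of _ "\<lambda>n. f n \<oplus> g n"])
        (auto intro: span_add_closed[OF level_mons_carrier])
  next
    fix c a assume ca: "c \<in> carrier K" "a \<in> carrier R"
      and "\<exists>f. graded_parts a f \<and> (\<forall>n. f n \<in> span (level_mons n))"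
    then obtain f where f: "graded_parts a f" "\<And>n. f n \<in> span (level_mons n)" by blast
    define T where "T = {n. f n \<noteq> \<zero>}"
    have T: "finite T" using f(1) by (simp add: T_def graded_parts_def)
    have fA: "f n \<in> A n" for n using f(1) by (auto simp: graded_parts_def)
    have "graded_parts (c \<odot> a) (\<lambda>n. c \<odot> f n)"
    proof (rule graded_partsI[OF _ T])
      show "c \<odot> f n \<in> A n" for n using A_submodule[of n] fA ca by (auto simp: submodule_def)
      show "c \<odot> f n = \<zero>" if "n \<notin> T" for n using that ca by (auto simp: T_def)
      have "a = finsum R f T" using f(1) by (simp add: T_def graded_parts_def)
      then show "c \<odot> a = (\<Oplus>n\<in>T. c \<odot> f n)"
        using fA A_subset ca T by (auto intro!: finsum_smult_ldistr)
    qed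
    then show "\<exists>f. graded_parts (c \<odot> a) f \<and> (\<forall>n. f n \<in> span (level_mons n))"
      using f(2) ca by (intro exI[of _ "\<lambda>n. c \<odot> f n"])
        (auto intro: span_smult_closed[OF level_mons_carrier])
  qed (use mon_carrier in auto)
  note ex = this
  show "A n \<subseteq> span (level_mons n)"
  proof
    fix a assume a: "a \<in> A n"
    then have c: "a \<in> carrier R" using A_subset by auto
    obtain f where f: "graded_parts a f" "\<And>n. f n \<in> span (level_mons n)" using ex[OF c] by blast
    have "f = (\<lambda>k. if k = n then a else \<zero>)"
      by (rule graded_parts_unique[OF c f(1) graded_parts_homogeneous[OF a]])
    then have "f n = a" by simp
    then show "a \<in> span (level_mons n)" using f(2)[of n] by simp
  qed
qed

definition smaller_mons :: "nat multiset \<Rightarrow> 'c set" where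
  "smaller_mons u = mon ` {v \<in> monomials s. size v = size u \<and> v < u}"

text \<open>The standard monomials of Groebner basis theory, described without the defining ideal:
  \<open>u\<close> is nonstandard when it is the leading monomial of a homogeneous relation.\<close>

definition standard_mons :: "nat multiset set" where
  "standard_mons = {u \<in> monomials s. mon u \<notin> span (smaller_mons u)}"

lemma smaller_mons_carrier: "smaller_mons u \<subseteq> carrier R"
  using mon_carrier by (auto simp: smaller_mons_def)

text \<open>The multiset order is compatible with addition, so a relation with leading monomial
  \<open>u\<close> can be multiplied by \<open>w\<close>. Hence multiples of nonstandard monomials
  are nonstandard, and \<open>standard_mons\<close> is an order ideal.\<close>

lemma span_smaller_mons_mult:
  assumes "a \<in> span (smaller_mons u)" "w \<in> monomials s"
  shows "a \<otimes> mon w \<in> span (smaller_mons (u + w))"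
proof -
  have base: "t \<otimes> mon w \<in> span (smaller_mons (u + w))" if t: "t \<in> smaller_mons u" for t
  proof -
    obtain v where v: "v \<in> monomials s" "size v = size u" "v < u" "t = mon v"
      using t by (auto simp: smaller_mons_def)
    then have "t \<otimes> mon w \<in> smaller_mons (u + w)"
      unfolding smaller_mons_def using assms(2)
      by (auto simp flip: mon_add intro!: imageI monomials_add)
    then show ?thesis using in_own_span[OF smaller_mons_carrier] by blast
  qed
  show ?thesis
    by (rule span_induct[OF smaller_mons_carrier assms(1)])
      (simp_all add: base mon_carrier span_zero Alg.l_distr Alg.smult_assoc2
        span_add_closed[OF smaller_mons_carrier] span_smult_closed[OF smaller_mons_carrier])
qed

lemma downset_standard_mons: "downset standard_mons"
  unfolding downset_def
proof (intro ballI allI impI)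
  fix u v assume u: "u \<in> standard_mons" and "v \<subseteq># u"
  then obtain w where w: "u = v + w" by (auto simp: subset_mset.le_iff_add)
  have m: "v \<in> monomials s" "w \<in> monomials s" using u w by (auto simp: standard_mons_def monomials_def)
  have "mon v \<notin> span (smaller_mons v)"
    using span_smaller_mons_mult[OF _ m(2), of "mon v" v] u w by (auto simp: standard_mons_def mon_add)
  then show "v \<in> standard_mons" using m by (simp add: standard_mons_def)
qed

text \<open>A nonstandard monomial is rewritten by smaller ones of the same degree; this ends
  because the multiset order is well-founded.\<close>

lemma standard_mons_span:
  assumes "u \<in> monomials s"
  shows "mon u \<in> span (mon ` {v \<in> standard_mons. size v = size u})"
  using assms
proof (induction u rule: less_induct)
  case (less u)
  have c: "mon ` {v \<in> standard_mons. size v = size u} \<subseteq> carrier R" using mon_carrier by auto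
  show ?case
  proof (cases "u \<in> standard_mons")
    case True
    then show ?thesis using in_own_span[OF c] by auto
  next
    case False
    then have "mon u \<in> span (smaller_mons u)" using less.prems by (simp add: standard_mons_def)
    moreover have "smaller_mons u \<subseteq> span (mon ` {v \<in> standard_mons. size v = size u})"
      unfolding smaller_mons_def using less.IH by fastforce
    ultimately show ?thesis using span_is_subset[OF _ span_is_submodule[OF c]] by blast
  qed
qed

text \<open>Adding the monomials in increasing order, each new one is outside the span of the
  smaller ones by the definition of \<open>standard_mons\<close>.\<close>

lemma standard_mons_independent:
  assumes "finite T" "T \<subseteq> {u \<in> standard_mons. size u = n}"
  shows "lin_indpt (mon ` T) \<and> inj_on mon T"
  using assms
proof (induction T rule: finite_linorder_max_induct)
  case empty
  then show ?case by (auto simp: lin_dep_def)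
next
  case (insert u T)
  then have IH: "lin_indpt (mon ` T)" "inj_on mon T" by auto
  have u: "u \<in> standard_mons" "size u = n" using insert.prems by auto
  have "mon ` T \<subseteq> smaller_mons u"
    using insert.hyps insert.prems u by (auto simp: smaller_mons_def standard_mons_def)
  then have "span (mon ` T) \<subseteq> span (smaller_mons u)" by (rule span_is_monotone)
  then have nin: "mon u \<notin> span (mon ` T)" using u by (auto simp: standard_mons_def)
  have c: "mon ` T \<subseteq> carrier R" using mon_carrier by auto
  have nin': "mon u \<notin> mon ` T" using nin in_own_span[OF c] by blast
  have "lin_indpt (mon ` T \<union> {mon u})"
    using lin_dep_iff_in_span[OF c IH(1) mon_carrier nin'] nin by blast
  then show ?case using IH(2) nin' insert.hyps by auto
qed

text \<open>Macaulay's theorem: the standard monomials of degree n form a basis of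
  \<open>A n\<close>.\<close>

lemma hilbert_series_eq: "hilbert_series K R A = counting_series standard_mons"
proof (rule fps_ext)
  fix n
  let ?T = "{u \<in> standard_mons. size u = n}"
  have sub: "standard_mons \<subseteq> monomials s" by (auto simp: standard_mons_def)
  have T: "finite ?T" by (rule finite_level[OF sub])
  have ind: "lin_indpt (mon ` ?T)" "inj_on mon ?T" using standard_mons_independent[OF T] by auto
  have c: "mon ` ?T \<subseteq> carrier R" using mon_carrier by auto
  have "vectorspace.dim K (R\<lparr>carrier := A n\<rparr>) = card (mon ` ?T)"
  proof (rule dim_subspace_eq_card[OF A_submodule])
    show "mon ` ?T \<subseteq> A n" using mon_A sub by auto
    show "A n \<subseteq> span (mon ` ?T)"
      unfolding span_level_mons[symmetric]
      using standard_mons_span by (intro span_is_subset span_is_submodule c) auto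
  qed (use T ind in auto)
  then show "fps_nth (hilbert_series K R A) n = fps_nth (counting_series standard_mons) n"
    by (simp add: hilbert_series_def counting_series_def card_image[OF ind(2)])
qed

end

text \<open>A monomial of degree 2 in \<open>M\<close> is a product of two variables in
  \<open>M\<close>. The ordered pairs \<open>P\<close> are counted together with their mirror image
  \<open>Q\<close>, which overlaps them in the diagonal.\<close>

lemma card_level_2:
  assumes "downset M" "M \<subseteq> monomials s"
  shows "2 * card {u \<in> M. size u = 2} \<le> card {u \<in> M. size u = 1} * (card {u \<in> M. size u = 1} + 1)"
proof -
  define V where "V = {i. {#i#} \<in> M}"
  have finV: "finite V"
    using assms(2) by (intro finite_subset[of V "{..<s}"]) (auto simp: V_def monomials_def)
  have level1: "{u \<in> M. size u = 1} = (\<lambda>i. {#i#}) ` V"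
  proof (intro equalityI subsetI)
    fix u assume u: "u \<in> {u \<in> M. size u = 1}"
    then obtain i where "u = {#i#}" using size_1_singleton_mset by blast
    then show "u \<in> (\<lambda>i. {#i#}) ` V" using u by (simp add: V_def)
  qed (auto simp: V_def)
  have card1: "card {u \<in> M. size u = 1} = card V"
  proof -
    have "inj_on (\<lambda>i. {#i#}) V" by (rule inj_onI) simp
    then show ?thesis unfolding level1 by (rule card_image)
  qed
  define P Q where "P = {(i, j) \<in> V \<times> V. i \<le> j}" and "Q = {(i, j) \<in> V \<times> V. j \<le> i}"
  have "P \<subseteq> V \<times> V" "Q \<subseteq> V \<times> V" by (auto simp: P_def Q_def)
  then have fin: "finite P" "finite Q" using finV finite_subset by blast+
  have "bij_betw prod.swap P Q"
    by (rule bij_betw_byWitness[of _ prod.swap]) (auto simp: P_def Q_def)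
  then have PQ: "card P = card Q" by (rule bij_betw_same_card)
  have "P \<union> Q = V \<times> V" "P \<inter> Q = (\<lambda>i. (i, i)) ` V" by (auto simp: P_def Q_def)
  then have "card P + card Q = card (V \<times> V) + card ((\<lambda>i. (i, i)) ` V)"
    using card_Un_Int[OF fin] by simp
  also have "\<dots> = card V * (card V + 1)"
    by (simp add: card_cartesian_product card_image inj_on_def)
  finally have P: "2 * card P = card V * (card V + 1)" using PQ by simp
  have "{u \<in> M. size u = 2} \<subseteq> (\<lambda>(i, j). {#i, j#}) ` P"
  proof
    fix u assume u: "u \<in> {u \<in> M. size u = 2}"
    then obtain i j where ij: "u = {#i, j#}" 
    proof -
      have "size u = Suc 1" using u by simp
      then obtain i v where v: "u = add_mset i v" using size_eq_Suc_imp_eq_union by blast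
      then have "size v = 1" using u by simp
      then obtain j where "v = {#j#}" using size_1_singleton_mset by blast
      with v that show ?thesis by blast
    qed
    have "{#i#} \<subseteq># u" "{#j#} \<subseteq># u" unfolding ij by (simp_all add: mset_subset_eq_single)
    then have "{#i#} \<in> M" "{#j#} \<in> M"
      using u assms(1) unfolding downset_def by blast+
    then have "i \<in> V" "j \<in> V" by (auto simp: V_def)
    then have "(i, j) \<in> P \<or> (j, i) \<in> P" by (auto simp: P_def)
    moreover have "u = {#j, i#}" using ij by (simp add: add_mset_commute)
    ultimately show "u \<in> (\<lambda>(i, j). {#i, j#}) ` P" using ij
      by (metis (mono_tags, lifting) case_prod_conv imageI)
  qed
  then have "card {u \<in> M. size u = 2} \<le> card P" by (rule surj_card_le[OF fin(1)])
  then show ?thesis unfolding card1 using P by simp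
qed

text \<open>Translates the first dimensions into h_1 and h_2. With H_1 and H_2 the dimensions in
  degrees 1 and 2, the bound 2 H_2 <= H_1 (H_1 + 1) becomes 2 h_2 <= h_1 (h_1 + 1): the dependence
  on d cancels.\<close>

lemma pole_form_low_coeffs:
  assumes "pole_form d F p" "fps_nth F 0 = 1"
  shows "coeff p 0 = 1 \<and> coeff p 1 = fps_nth F 1 - int d \<and>
    2 * coeff p 2 = 2 * fps_nth F 2 - 2 * int d * fps_nth F 1 + int d * (int d - 1)"
  using assms
proof (induction d arbitrary: F)
  case (Suc d)
  let ?G = "F * (1 - fps_X)"
  have G: "pole_form d ?G p" using Suc.prems by (simp add: pole_form_Suc_iff)
  have n: "fps_nth ?G 0 = fps_nth F 0" "fps_nth ?G 1 = fps_nth F 1 - fps_nth F 0"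
    "fps_nth ?G 2 = fps_nth F 2 - fps_nth F 1"
    by (simp_all add: algebra_simps numeral_2_eq_2)
  have G0: "fps_nth ?G 0 = 1" using Suc.prems n by simp
  show ?case using Suc.IH[OF G G0] Suc.prems n by (simp add: algebra_simps)
qed (simp_all add: pole_form_def)

text \<open>The bridge from algebras to combinatorics. The empty monomial is standard because 1 is
  not 0, which follows from injectivity of the structure map.\<close>

lemma standard_graded_algebra_monomials:
  assumes K: "field K" and sga: "standard_graded_algebra K R A"
  obtains M s where "downset M" "M \<subseteq> monomials s" "{#} \<in> M"
    "hilbert_series K R A = counting_series M"
proof -
  have alg: "algebra K R" and sub: "\<And>n. Module.submodule (A n) K R"
    and mult: "\<And>i j x y. x \<in> A i \<Longrightarrow> y \<in> A j \<Longrightarrow> x \<otimes>\<^bsub>R\<^esub> y \<in> A (i + j)"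
    and dec: "\<And>x. x \<in> carrier R \<Longrightarrow> \<exists>!f. (\<forall>n. f n \<in> A n) \<and> finite {n. f n \<noteq> \<zero>\<^bsub>R\<^esub>} \<and>
        x = finsum R f {n. f n \<noteq> \<zero>\<^bsub>R\<^esub>}"
    and bij: "bij_betw (\<lambda>c. c \<odot>\<^bsub>R\<^esub> \<one>\<^bsub>R\<^esub>) (carrier K) (A 0)"
    using sga unfolding standard_graded_algebra_def graded_algebra_def by blast+
  obtain S where S: "finite S" "S \<subseteq> A 1"
    "generate_ring R ((\<lambda>c. c \<odot>\<^bsub>R\<^esub> \<one>\<^bsub>R\<^esub>) ` carrier K \<union> S) = carrier R"
    using sga unfolding standard_graded_algebra_def by blast
  obtain s x where x: "S = x ` {i::nat. i < s}"
    using finite_imp_nat_seg_image_inj_on[OF S(1)] by blast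
  have md: "module K R" using alg by (simp add: algebra_def)
  have RC: "cring R" by (rule algebra.M_cring[OF alg])
  then have R1: "\<one>\<^bsub>R\<^esub> \<in> carrier R" by (simp add: cring.cring_simprules)
  have K01: "\<one>\<^bsub>K\<^esub> \<in> carrier K" "\<zero>\<^bsub>K\<^esub> \<in> carrier K" "\<one>\<^bsub>K\<^esub> \<noteq> \<zero>\<^bsub>K\<^esub>"
    using fieldE[OF K] by (auto simp: cring.cring_simprules)
  interpret V: field_algebra K R
    using alg K md by (simp add: field_algebra_def vectorspace_def)
  have sm: "LinearCombinations.submodule K (A n) R" for n
  proof -
    interpret N: Module.submodule "A n" K R by (rule sub)
    show ?thesis
      using N.subset N.m_closed N.one_closed N.smult_closed md
      by (auto simp: LinearCombinations.submodule_def)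
  qed
  have one: "\<one>\<^bsub>R\<^esub> \<in> A 0"
  proof -
    have "\<one>\<^bsub>K\<^esub> \<odot>\<^bsub>R\<^esub> \<one>\<^bsub>R\<^esub> \<in> A 0" using bij_betwE[OF bij] K01(1) by blast
    then show ?thesis using module.smult_one[OF md R1] by simp
  qed
  interpret G: standard_graded K R A s x
  proof (intro standard_graded.intro standard_graded_axioms.intro)
    show "field_algebra K R" by unfold_locales
    show "LinearCombinations.submodule K (A n) R" for n by (rule sm)
    show "a \<in> A i \<Longrightarrow> b \<in> A j \<Longrightarrow> a \<otimes>\<^bsub>R\<^esub> b \<in> A (i + j)" for i j a b by (rule mult)
    show "i < s \<Longrightarrow> x i \<in> A 1" for i using S(2) x by auto
    show "generate_ring R ((\<lambda>c. c \<odot>\<^bsub>R\<^esub> \<one>\<^bsub>R\<^esub>) ` carrier K \<union> x ` {..<s}) = carrier R"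
      using S(3) unfolding x lessThan_def .
  qed (fact dec one)+
  have "\<one>\<^bsub>R\<^esub> \<noteq> \<zero>\<^bsub>R\<^esub>"
  proof
    assume "\<one>\<^bsub>R\<^esub> = \<zero>\<^bsub>R\<^esub>"
    then have "\<one>\<^bsub>K\<^esub> \<odot>\<^bsub>R\<^esub> \<one>\<^bsub>R\<^esub> = \<zero>\<^bsub>K\<^esub> \<odot>\<^bsub>R\<^esub> \<one>\<^bsub>R\<^esub>"
      using module.smult_one[OF md R1] module.smult_l_null[OF md R1] by simp
    then show False using inj_onD[OF bij_betw_imp_inj_on[OF bij] _ K01(1,2)] K01(3) by blast
  qed
  moreover have "G.smaller_mons {#} = {}" by (auto simp: G.smaller_mons_def)
  ultimately have "{#} \<in> G.standard_mons"
    by (simp add: G.standard_mons_def G.mon_empty V.span_empty monomials_def)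
  moreover have "G.standard_mons \<subseteq> monomials s" by (auto simp: G.standard_mons_def)
  ultimately show ?thesis using that G.downset_standard_mons G.hilbert_series_eq by blast
qed

lemma type_CI_of_cyclotomic:
  assumes K: "field K" and sga: "standard_graded_algebra K R A" and cyc: "cyclotomic_algebra K R A"
    and h: "is_h_polynomial K R A h" and val: "poly h 1 \<in> {1, 4, 6} \<or> prime (poly h 1)"
  shows "type_CI h"
proof -
  obtain M s where M: "downset M" "M \<subseteq> monomials s" "{#} \<in> M"
    "hilbert_series K R A = counting_series M"
    using standard_graded_algebra_monomials[OF K sga] .
  obtain d where "hilbert_series K R A * (1 - fps_X) ^ d = fps_of_poly h" and pos: "poly h 1 > 0"
    using h by (auto simp: is_h_polynomial_def)
  then have pf: "pole_form d (counting_series M) h" by (simp add: pole_form_def M(4))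
  have "{u \<in> M. size u = 0} = {{#}}" using M(3) by auto
  then have F0: "fps_nth (counting_series M) 0 = 1" by (simp add: counting_series_def)
  have low: "coeff h 0 = 1" "coeff h 1 = fps_nth (counting_series M) 1 - int d"
    "2 * coeff h 2 = 2 * fps_nth (counting_series M) 2
      - 2 * int d * fps_nth (counting_series M) 1 + int d * (int d - 1)"
    using pole_form_low_coeffs[OF pf F0] by auto
  have roots: "unit_roots h"
    using cyc h is_h_polynomial_unique unfolding cyclotomic_algebra_def unit_roots_def by blast
  have "int (degree h) < poly h 1"
    by (rule degree_less_value[OF unit_roots_palindromic(1)[OF roots low(1) pos] pos
        hilbert_coefficient_bound[OF M(1,2) pf]])
  note prems = roots low(1) this
  have h2: "2 * coeff h 2 \<le> coeff h 1 * (coeff h 1 + 1)"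
  proof -
    have "2 * fps_nth (counting_series M) 2
        \<le> fps_nth (counting_series M) 1 * (fps_nth (counting_series M) 1 + 1)"
    proof -
      define a b where "a = card {u \<in> M. size u = 2}" and "b = card {u \<in> M. size u = 1}"
      have "2 * a \<le> b * (b + 1)" using card_level_2[OF M(1,2)] by (simp only: a_def b_def)
      then have "int (2 * a) \<le> int (b * (b + 1))" by (simp only: of_nat_le_iff)
      then have "2 * int a \<le> int b * (int b + 1)" by (simp add: algebra_simps)
      then show ?thesis by (simp add: counting_series_def a_def b_def)
    qed
    then show ?thesis unfolding low by (simp add: algebra_simps)
  qed
  show ?thesis using val type_CI_value_1[OF low(1) prems(3)] type_CI_value_4[OF prems]
      type_CI_value_6[OF prems _ h2] type_CI_value_prime[OF prems] by blast
qed

section \<open>The algebra of a monomial order ideal\<close>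

lemma (in abelian_monoid) finsum_Sigma:
  assumes "finite A" "\<And>x. x \<in> A \<Longrightarrow> finite (B x)"
    and "\<And>x y. x \<in> A \<Longrightarrow> y \<in> B x \<Longrightarrow> g x y \<in> carrier G"
  shows "(\<Oplus>x\<in>A. \<Oplus>y\<in>B x. g x y) = (\<Oplus>p\<in>Sigma A B. g (fst p) (snd p))"
  using assms
proof (induction A rule: finite_induct)
  case (insert a A)
  have eq: "Sigma (insert a A) B = Pair a ` B a \<union> Sigma A B" by auto
  have "(\<Oplus>p\<in>Pair a ` B a. g (fst p) (snd p)) = (\<Oplus>y\<in>B a. g a y)"
    using insert.prems by (subst add.finprod_reindex) (auto simp: inj_on_def)
  moreover have "(\<Oplus>p\<in>Sigma (insert a A) B. g (fst p) (snd p))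
      = (\<Oplus>p\<in>Pair a ` B a. g (fst p) (snd p)) \<oplus> (\<Oplus>p\<in>Sigma A B. g (fst p) (snd p))"
    unfolding eq using insert by (intro finsum_Un_disjoint) auto
  ultimately show ?case using insert by (subst finsum_insert) (auto intro!: finsum_closed)
qed simp

definition splits :: "nat multiset \<Rightarrow> (nat multiset \<times> nat multiset) set" where
  "splits u = {(v, w). v + w = u}"

lemma finite_splits: "finite (splits u)"
proof -
  define n where "n = size u"
  define T where "T = {v. set_mset v \<subseteq> set_mset u \<and> size v \<le> size u}"
  have "T = (\<Union>k\<le>size u. {v. set_mset v \<subseteq> set_mset u \<and> size v = k})" by (auto simp: T_def)
  also have "finite \<dots>"
    using finite_multisets_of_size[of "set_mset u"] by (auto simp: multisets_of_size_def)
  finally have "finite (T \<times> T)" by simp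
  moreover have "splits u \<subseteq> T \<times> T" by (auto simp: splits_def T_def)
  ultimately show ?thesis using finite_subset by blast
qed

text \<open>The quotient of the polynomial ring by all monomials outside \<open>M\<close>, with
  coefficient functions supported in \<open>M\<close> as normal forms. The product is convolution,
  truncated to \<open>M\<close>.\<close>

definition monomial_algebra ::
    "('k, 'm) ring_scheme \<Rightarrow> nat multiset set \<Rightarrow> ('k, nat multiset \<Rightarrow> 'k) module" where
  "monomial_algebra K M =
    \<lparr>carrier = {f. (\<forall>u. f u \<in> carrier K) \<and> finite {u. f u \<noteq> \<zero>\<^bsub>K\<^esub>} \<and> (\<forall>u. u \<notin> M \<longrightarrow> f u = \<zero>\<^bsub>K\<^esub>)},
     monoid.mult = (\<lambda>f g u. if u \<in> M then (\<Oplus>\<^bsub>K\<^esub>p\<in>splits u. f (fst p) \<otimes>\<^bsub>K\<^esub> g (snd p)) else \<zero>\<^bsub>K\<^esub>),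
     monoid.one = (\<lambda>u. if u = {#} then \<one>\<^bsub>K\<^esub> else \<zero>\<^bsub>K\<^esub>),
     ring.zero = (\<lambda>u. \<zero>\<^bsub>K\<^esub>),
     ring.add = (\<lambda>f g u. f u \<oplus>\<^bsub>K\<^esub> g u),
     module.smult = (\<lambda>c f u. c \<otimes>\<^bsub>K\<^esub> f u)\<rparr>"

locale monomial_ring = field K for K (structure) +
  fixes M :: "nat multiset set" and s :: nat
  assumes M_downset: "downset M" and M_monomials: "M \<subseteq> monomials s" and M_empty: "{#} \<in> M"
begin

abbreviation R :: "('a, nat multiset \<Rightarrow> 'a) module" where
  "R \<equiv> monomial_algebra K M"

lemma carrier_iff: "f \<in> carrier R \<longleftrightarrow>
    (\<forall>u. f u \<in> carrier K) \<and> finite {u. f u \<noteq> \<zero>} \<and> (\<forall>u. u \<notin> M \<longrightarrow> f u = \<zero>)"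
  by (simp add: monomial_algebra_def)

lemma carrierD: "f \<in> carrier R \<Longrightarrow> f u \<in> carrier K"
  by (simp add: carrier_iff)

lemma mult_apply: "(f \<otimes>\<^bsub>R\<^esub> g) u = (if u \<in> M then (\<Oplus>p\<in>splits u. f (fst p) \<otimes> g (snd p)) else \<zero>)"
  and one_apply: "\<one>\<^bsub>R\<^esub> u = (if u = {#} then \<one> else \<zero>)"
  and zero_apply: "\<zero>\<^bsub>R\<^esub> u = \<zero>"
  and add_apply: "(f \<oplus>\<^bsub>R\<^esub> g) u = f u \<oplus> g u"
  and smult_apply: "(c \<odot>\<^bsub>R\<^esub> f) u = c \<otimes> f u"
  by (simp_all add: monomial_algebra_def)

lemmas apply_simps = mult_apply one_apply zero_apply add_apply smult_apply

lemma splits_closed: "f \<in> carrier R \<Longrightarrow> g \<in> carrier R \<Longrightarrow>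
    (\<lambda>p. f (fst p) \<otimes> g (snd p)) \<in> T \<rightarrow> carrier K"
  by (auto simp: carrierD)

lemma mult_closed:
  assumes f: "f \<in> carrier R" and g: "g \<in> carrier R"
  shows "f \<otimes>\<^bsub>R\<^esub> g \<in> carrier R"
proof -
  have "{u. (f \<otimes>\<^bsub>R\<^esub> g) u \<noteq> \<zero>} \<subseteq> (\<lambda>(v, w). v + w) ` ({v. f v \<noteq> \<zero>} \<times> {w. g w \<noteq> \<zero>})"
  proof
    fix u assume u: "u \<in> {u. (f \<otimes>\<^bsub>R\<^esub> g) u \<noteq> \<zero>}"
    then have nz: "(\<Oplus>p\<in>splits u. f (fst p) \<otimes> g (snd p)) \<noteq> \<zero>" by (auto simp: mult_apply split: if_splits)
    have "\<exists>p\<in>splits u. f (fst p) \<otimes> g (snd p) \<noteq> \<zero>"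
    proof (rule ccontr)
      assume "\<not> ?thesis"
      then have "(\<Oplus>p\<in>splits u. f (fst p) \<otimes> g (snd p)) = \<zero>"
        by (intro add.finprod_one_eqI) auto
      then show False using nz by simp
    qed
    then obtain v w where "v + w = u" "f v \<otimes> g w \<noteq> \<zero>" by (auto simp: splits_def)
    moreover from this have "f v \<noteq> \<zero>" "g w \<noteq> \<zero>" using carrierD[OF f] carrierD[OF g] by auto
    ultimately show "u \<in> (\<lambda>(v, w). v + w) ` ({v. f v \<noteq> \<zero>} \<times> {w. g w \<noteq> \<zero>})" by force
  qed
  moreover have "finite ({v. f v \<noteq> \<zero>} \<times> {w. g w \<noteq> \<zero>})" using f g by (simp add: carrier_iff)
  ultimately have "finite {u. (f \<otimes>\<^bsub>R\<^esub> g) u \<noteq> \<zero>}" by (meson finite_imageI finite_subset)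
  then show ?thesis
    using splits_closed[OF f g] by (auto simp: carrier_iff mult_apply intro!: finsum_closed)
qed

lemma one_closed_R: "\<one>\<^bsub>R\<^esub> \<in> carrier R"
  using M_empty by (auto simp: carrier_iff one_apply)

lemma zero_closed_R: "\<zero>\<^bsub>R\<^esub> \<in> carrier R"
  by (auto simp: carrier_iff zero_apply)

lemma add_closed_R: "f \<in> carrier R \<Longrightarrow> g \<in> carrier R \<Longrightarrow> f \<oplus>\<^bsub>R\<^esub> g \<in> carrier R"
proof -
  assume f: "f \<in> carrier R" and g: "g \<in> carrier R"
  have "{u. (f \<oplus>\<^bsub>R\<^esub> g) u \<noteq> \<zero>} \<subseteq> {u. f u \<noteq> \<zero>} \<union> {u. g u \<noteq> \<zero>}" by (auto simp: add_apply)
  then have "finite {u. (f \<oplus>\<^bsub>R\<^esub> g) u \<noteq> \<zero>}" using f g by (simp add: carrier_iff finite_subset)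
  then show ?thesis using f g by (auto simp: carrier_iff add_apply)
qed

lemma smult_closed_R: "c \<in> carrier K \<Longrightarrow> f \<in> carrier R \<Longrightarrow> c \<odot>\<^bsub>R\<^esub> f \<in> carrier R"
proof -
  assume c: "c \<in> carrier K" and f: "f \<in> carrier R"
  have "{u. (c \<odot>\<^bsub>R\<^esub> f) u \<noteq> \<zero>} \<subseteq> {u. f u \<noteq> \<zero>}" using c by (auto simp: smult_apply)
  then have "finite {u. (c \<odot>\<^bsub>R\<^esub> f) u \<noteq> \<zero>}" using f by (simp add: carrier_iff finite_subset)
  then show ?thesis using c f by (auto simp: carrier_iff smult_apply)
qed

lemma mult_comm_R:
  assumes f: "f \<in> carrier R" and g: "g \<in> carrier R"
  shows "f \<otimes>\<^bsub>R\<^esub> g = g \<otimes>\<^bsub>R\<^esub> f"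
proof
  fix u
  have sw: "splits u = prod.swap ` splits u" by (auto simp: splits_def add.commute image_iff)
  have "(\<Oplus>p\<in>splits u. f (fst p) \<otimes> g (snd p)) = (\<Oplus>p\<in>prod.swap ` splits u. f (fst p) \<otimes> g (snd p))"
    using sw by simp
  also have "\<dots> = (\<Oplus>p\<in>splits u. f (fst (prod.swap p)) \<otimes> g (snd (prod.swap p)))"
    using splits_closed[OF f g] by (intro add.finprod_reindex) auto
  also have "\<dots> = (\<Oplus>p\<in>splits u. g (fst p) \<otimes> f (snd p))"
    using splits_closed[OF g f] by (intro add.finprod_cong') (auto simp: m_comm carrierD f g)
  finally show "(f \<otimes>\<^bsub>R\<^esub> g) u = (g \<otimes>\<^bsub>R\<^esub> f) u" by (simp add: mult_apply)
qed

lemma in_M_splits: "u \<in> M \<Longrightarrow> (v, w) \<in> splits u \<Longrightarrow> v \<in> M \<and> w \<in> M"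
  using M_downset by (auto simp: downset_def splits_def)

text \<open>Truncation does no harm: every divisor of a monomial in \<open>M\<close> is again in
  \<open>M\<close>, so below such a monomial the inner products are full convolutions. Both sides
  then sum over factorizations of \<open>u\<close> into three monomials.\<close>

lemma mult_assoc_R:
  assumes f: "f \<in> carrier R" and g: "g \<in> carrier R" and h: "h \<in> carrier R"
  shows "(f \<otimes>\<^bsub>R\<^esub> g) \<otimes>\<^bsub>R\<^esub> h = f \<otimes>\<^bsub>R\<^esub> (g \<otimes>\<^bsub>R\<^esub> h)"
proof
  fix u
  show "((f \<otimes>\<^bsub>R\<^esub> g) \<otimes>\<^bsub>R\<^esub> h) u = (f \<otimes>\<^bsub>R\<^esub> (g \<otimes>\<^bsub>R\<^esub> h)) u"
  proof (cases "u \<in> M")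
    case True
    have "(\<Oplus>i\<in>splits u. (f \<otimes>\<^bsub>R\<^esub> g) (fst i) \<otimes> h (snd i))
        = (\<Oplus>pc\<in>splits u. \<Oplus>ab\<in>splits (fst pc). f (fst ab) \<otimes> g (snd ab) \<otimes> h (snd pc))"
    proof (rule add.finprod_cong'[OF refl])
      fix i assume "i \<in> splits u"
      then obtain p c where i: "i = (p, c)" "(p, c) \<in> splits u" by (cases i) auto
      then have "p \<in> M" using in_M_splits[OF True] by auto
      then have "(f \<otimes>\<^bsub>R\<^esub> g) p \<otimes> h c = (\<Oplus>ab\<in>splits p. f (fst ab) \<otimes> g (snd ab)) \<otimes> h c"
        by (simp add: mult_apply case_prod_unfold)
      also have "\<dots> = (\<Oplus>ab\<in>splits p. f (fst ab) \<otimes> g (snd ab) \<otimes> h c)"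
        by (rule finsum_ldistr[OF finite_splits]) (auto simp: carrierD f g h)
      finally show "(f \<otimes>\<^bsub>R\<^esub> g) (fst i) \<otimes> h (snd i)
          = (\<Oplus>ab\<in>splits (fst i). f (fst ab) \<otimes> g (snd ab) \<otimes> h (snd i))" by (simp add: i)
    qed (auto intro!: finsum_closed simp: carrierD f g h)
    also have "\<dots> = (\<Oplus>x\<in>(SIGMA pc:splits u. splits (fst pc)). f (fst (snd x)) \<otimes> g (snd (snd x)) \<otimes> h (snd (fst x)))"
      by (rule finsum_Sigma) (auto simp: finite_splits carrierD f g h)
    \<comment> \<open>Rebracketing: (a + b) + c on the left corresponds to a + (b + c) on the
      right.\<close>
    also have "(SIGMA pc:splits u. splits (fst pc))
        = (\<lambda>(aq, bc). ((fst aq + fst bc, snd bc), (fst aq, fst bc))) ` (SIGMA aq:splits u. splits (snd aq))"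
      by (force simp: splits_def image_iff add.assoc)
    also have "(\<Oplus>x\<in>\<dots>. f (fst (snd x)) \<otimes> g (snd (snd x)) \<otimes> h (snd (fst x)))
        = (\<Oplus>x\<in>(SIGMA aq:splits u. splits (snd aq)).
            (\<lambda>x. f (fst (snd x)) \<otimes> g (snd (snd x)) \<otimes> h (snd (fst x)))
              ((\<lambda>(aq, bc). ((fst aq + fst bc, snd bc), (fst aq, fst bc))) x))"
      by (rule add.finprod_reindex) (auto simp: carrierD f g h inj_on_def splits_def)
    also have "\<dots> = (\<Oplus>x\<in>(SIGMA aq:splits u. splits (snd aq)). f (fst (fst x)) \<otimes> (g (fst (snd x)) \<otimes> h (snd (snd x))))"
      by (rule add.finprod_cong'[OF refl]) (auto simp: carrierD f g h m_assoc)
    also have "\<dots> = (\<Oplus>aq\<in>splits u. \<Oplus>bc\<in>splits (snd aq). f (fst aq) \<otimes> (g (fst bc) \<otimes> h (snd bc)))"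
      by (rule finsum_Sigma[symmetric]) (auto simp: finite_splits carrierD f g h)
    also have "\<dots> = (\<Oplus>i\<in>splits u. f (fst i) \<otimes> (g \<otimes>\<^bsub>R\<^esub> h) (snd i))"
    proof (rule add.finprod_cong'[OF refl])
      fix i assume "i \<in> splits u"
      then obtain a q where i: "i = (a, q)" "(a, q) \<in> splits u" by (cases i) auto
      then have "q \<in> M" using in_M_splits[OF True] by auto
      then have "f a \<otimes> (g \<otimes>\<^bsub>R\<^esub> h) q = f a \<otimes> (\<Oplus>bc\<in>splits q. g (fst bc) \<otimes> h (snd bc))"
        by (simp add: mult_apply case_prod_unfold)
      also have "\<dots> = (\<Oplus>bc\<in>splits q. f a \<otimes> (g (fst bc) \<otimes> h (snd bc)))"
        by (rule finsum_rdistr[OF finite_splits]) (auto simp: carrierD f g h)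
      finally show "(\<Oplus>bc\<in>splits (snd i). f (fst i) \<otimes> (g (fst bc) \<otimes> h (snd bc)))
          = f (fst i) \<otimes> (g \<otimes>\<^bsub>R\<^esub> h) (snd i)" by (simp add: i)
    qed (simp add: carrierD[OF f] carrierD[OF mult_closed[OF g h]])
    finally show ?thesis using True by (simp add: mult_apply[of "f \<otimes>\<^bsub>R\<^esub> g" h] mult_apply[of f "g \<otimes>\<^bsub>R\<^esub> h"])
  qed (simp add: mult_apply)
qed

lemma one_mult_R:
  assumes f: "f \<in> carrier R"
  shows "\<one>\<^bsub>R\<^esub> \<otimes>\<^bsub>R\<^esub> f = f"
proof
  fix u
  have "(\<Oplus>p\<in>splits u. \<one>\<^bsub>R\<^esub> (fst p) \<otimes> f (snd p)) = (\<Oplus>p\<in>splits u. if ({#}, u) = p then f (snd p) else \<zero>)"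
    by (rule add.finprod_cong'[OF refl]) (auto simp: one_apply splits_def carrierD f)
  also have "\<dots> = f (snd ({#}, u))"
    using add.finprod_singleton[of "({#}, u)" "splits u" "\<lambda>p. f (snd p)"]
    by (simp add: finite_splits carrierD[OF f]) (simp add: splits_def)
  finally show "(\<one>\<^bsub>R\<^esub> \<otimes>\<^bsub>R\<^esub> f) u = f u" using f by (auto simp: mult_apply carrier_iff)
qed

lemma distr_R:
  assumes f: "f \<in> carrier R" and g: "g \<in> carrier R" and h: "h \<in> carrier R"
  shows "(f \<oplus>\<^bsub>R\<^esub> g) \<otimes>\<^bsub>R\<^esub> h = f \<otimes>\<^bsub>R\<^esub> h \<oplus>\<^bsub>R\<^esub> g \<otimes>\<^bsub>R\<^esub> h"
proof
  fix u
  have "(\<Oplus>p\<in>splits u. (f \<oplus>\<^bsub>R\<^esub> g) (fst p) \<otimes> h (snd p))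
      = (\<Oplus>p\<in>splits u. f (fst p) \<otimes> h (snd p) \<oplus> g (fst p) \<otimes> h (snd p))"
    by (rule add.finprod_cong'[OF refl]) (auto simp: add_apply carrierD f g h l_distr)
  also have "\<dots> = (\<Oplus>p\<in>splits u. f (fst p) \<otimes> h (snd p)) \<oplus> (\<Oplus>p\<in>splits u. g (fst p) \<otimes> h (snd p))"
    by (rule finsum_addf) (auto simp: carrierD f g h)
  finally show "((f \<oplus>\<^bsub>R\<^esub> g) \<otimes>\<^bsub>R\<^esub> h) u = (f \<otimes>\<^bsub>R\<^esub> h \<oplus>\<^bsub>R\<^esub> g \<otimes>\<^bsub>R\<^esub> h) u"
    by (simp add: mult_apply add_apply[of "f \<otimes>\<^bsub>R\<^esub> h"] case_prod_unfold)
qed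

lemma cring_R: "cring R"
proof (rule cringI)
  show "abelian_group R"
  proof (rule abelian_groupI)
    fix f assume f: "f \<in> carrier R"
    have "(\<lambda>u. \<ominus> f u) \<in> carrier R"
    proof -
      have "{u. \<ominus> f u \<noteq> \<zero>} \<subseteq> {u. f u \<noteq> \<zero>}" by auto
      then have "finite {u. \<ominus> f u \<noteq> \<zero>}" using f by (simp add: carrier_iff finite_subset)
      then show ?thesis using f by (simp add: carrier_iff)
    qed
    moreover have "(\<lambda>u. \<ominus> f u) \<oplus>\<^bsub>R\<^esub> f = \<zero>\<^bsub>R\<^esub>"
      by (rule ext) (simp add: apply_simps carrierD[OF f] l_neg)
    ultimately show "\<exists>g\<in>carrier R. g \<oplus>\<^bsub>R\<^esub> f = \<zero>\<^bsub>R\<^esub>" by blast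
  qed (auto intro!: add_closed_R zero_closed_R ext simp: apply_simps carrierD a_ac)
  show "comm_monoid R"
    by (rule comm_monoidI) (auto intro: mult_closed one_closed_R mult_assoc_R one_mult_R mult_comm_R)
qed (rule distr_R)

lemma algebra_R: "algebra K R"
proof (rule algebraI[OF is_cring cring_R])
  fix c f g assume c: "c \<in> carrier K" and f: "f \<in> carrier R" and g: "g \<in> carrier R"
  show "(c \<odot>\<^bsub>R\<^esub> f) \<otimes>\<^bsub>R\<^esub> g = c \<odot>\<^bsub>R\<^esub> (f \<otimes>\<^bsub>R\<^esub> g)"
  proof
    fix u
    have "(\<Oplus>p\<in>splits u. (c \<odot>\<^bsub>R\<^esub> f) (fst p) \<otimes> g (snd p)) = (\<Oplus>p\<in>splits u. c \<otimes> (f (fst p) \<otimes> g (snd p)))"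
      by (rule add.finprod_cong'[OF refl]) (auto simp: smult_apply carrierD f g c m_assoc)
    also have "\<dots> = c \<otimes> (\<Oplus>p\<in>splits u. f (fst p) \<otimes> g (snd p))"
      by (rule finsum_rdistr[OF finite_splits, symmetric]) (auto simp: carrierD f g c)
    finally show "((c \<odot>\<^bsub>R\<^esub> f) \<otimes>\<^bsub>R\<^esub> g) u = (c \<odot>\<^bsub>R\<^esub> (f \<otimes>\<^bsub>R\<^esub> g)) u"
      using c by (simp add: mult_apply smult_apply[of c "f \<otimes>\<^bsub>R\<^esub> g"] case_prod_unfold)
  qed
qed (auto intro!: smult_closed_R ext simp: apply_simps carrierD l_distr r_distr m_assoc)

end

section \<open>Monomial basis, grading and Hilbert series of the monomial algebra\<close>

context monomial_ring
begin

lemma module_R: "module K R"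
  using algebra_R by (simp add: algebra_def)

sublocale FA: field_algebra K R
  using algebra_R module_R field_axioms by (simp add: field_algebra_def vectorspace_def)

definition delta :: "nat multiset \<Rightarrow> nat multiset \<Rightarrow> 'a" where
  "delta u = (\<lambda>v. if v = u then \<one> else \<zero>)"

lemma delta_carrier: "u \<in> M \<Longrightarrow> delta u \<in> carrier R"
proof -
  assume "u \<in> M"
  moreover have "{v. delta u v \<noteq> \<zero>} \<subseteq> {u}" by (auto simp: delta_def)
  then have "finite {v. delta u v \<noteq> \<zero>}" using finite_subset by blast
  ultimately show ?thesis by (auto simp: carrier_iff delta_def)
qed

lemma delta_inj: "delta u = delta v \<Longrightarrow> u = v"
  by (metis delta_def one_not_zero)

lemma one_eq_delta: "\<one>\<^bsub>R\<^esub> = delta {#}"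
  by (auto simp: one_apply delta_def)

lemma delta_mult:
  assumes "u + v \<in> M" "u \<in> M" "v \<in> M"
  shows "delta u \<otimes>\<^bsub>R\<^esub> delta v = delta (u + v)"
proof
  fix w
  show "(delta u \<otimes>\<^bsub>R\<^esub> delta v) w = delta (u + v) w"
  proof (cases "w = u + v")
    case True
    have "(\<Oplus>p\<in>splits w. delta u (fst p) \<otimes> delta v (snd p)) = (\<Oplus>p\<in>splits w. if (u, v) = p then \<one> else \<zero>)"
      by (rule add.finprod_cong'[OF refl]) (auto simp: delta_def)
    also have "\<dots> = \<one>"
      using add.finprod_singleton[of "(u, v)" "splits w" "\<lambda>p. \<one>"] True
      by (simp add: finite_splits) (simp add: splits_def)
    finally show ?thesis using True assms(1) by (simp add: mult_apply delta_def)
  next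
    case False
    have "(\<Oplus>p\<in>splits w. delta u (fst p) \<otimes> delta v (snd p)) = \<zero>"
      using False by (intro add.finprod_one_eqI) (auto simp: delta_def splits_def)
    then show ?thesis using False by (simp add: mult_apply delta_def)
  qed
qed

lemma finsum_R_apply:
  assumes "finite T" "\<And>i. i \<in> T \<Longrightarrow> F i \<in> carrier R"
  shows "finsum R F T u = (\<Oplus>i\<in>T. F i u)"
  using assms
proof (induction T rule: finite_induct)
  case empty
  then show ?case by (simp add: zero_apply)
next
  case (insert i T)
  have "finsum R F (insert i T) = F i \<oplus>\<^bsub>R\<^esub> finsum R F T"
    using insert by (intro FA.M.finsum_insert) auto
  moreover have "(\<Oplus>i\<in>insert i T. F i u) = F i u \<oplus> (\<Oplus>i\<in>T. F i u)"
    using insert by (intro finsum_insert) (auto intro: carrierD)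
  ultimately show ?case using insert by (simp add: add_apply)
qed

lemma sum_deltas:
  assumes f: "f \<in> carrier R" and T: "finite T" "{u. f u \<noteq> \<zero>} \<subseteq> T" "T \<subseteq> M"
  shows "f = (\<Oplus>\<^bsub>R\<^esub>u\<in>T. f u \<odot>\<^bsub>R\<^esub> delta u)"
proof
  fix v
  have c: "f u \<odot>\<^bsub>R\<^esub> delta u \<in> carrier R" if "u \<in> T" for u
    using that T(3) f by (intro smult_closed_R delta_carrier carrierD) auto
  have "(\<Oplus>\<^bsub>R\<^esub>u\<in>T. f u \<odot>\<^bsub>R\<^esub> delta u) v = (\<Oplus>u\<in>T. (f u \<odot>\<^bsub>R\<^esub> delta u) v)"
    by (rule finsum_R_apply[OF T(1) c])
  also have "\<dots> = (\<Oplus>u\<in>T. if v = u then f u else \<zero>)"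
    by (rule add.finprod_cong'[OF refl]) (auto simp: smult_apply delta_def carrierD[OF f])
  also have "\<dots> = f v"
  proof (cases "v \<in> T")
    case True
    then show ?thesis using add.finprod_singleton[OF True T(1), of f] carrierD[OF f] by simp
  next
    case False
    then have "f v = \<zero>" using T(2) by auto
    then show ?thesis using False by (intro trans[OF add.finprod_one_eqI]) auto
  qed
  finally show "f v = (\<Oplus>\<^bsub>R\<^esub>u\<in>T. f u \<odot>\<^bsub>R\<^esub> delta u) v" ..
qed

definition component :: "nat \<Rightarrow> (nat multiset \<Rightarrow> 'a) set" where
  "component n = {f \<in> carrier R. \<forall>u. f u \<noteq> \<zero> \<longrightarrow> size u = n}"

lemma component_submodule: "LinearCombinations.submodule K (component n) R"
  unfolding LinearCombinations.submodule_def component_def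
  using module_R add_closed_R zero_closed_R smult_closed_R
  by (auto simp: apply_simps) (metis l_zero zero_closed, metis r_null)

lemma support_in_M: "f \<in> carrier R \<Longrightarrow> f u \<noteq> \<zero> \<Longrightarrow> u \<in> M"
  by (auto simp: carrier_iff)

lemma in_span_deltas:
  assumes f: "f \<in> carrier R" and T: "finite T" "T \<subseteq> M" "{u. f u \<noteq> \<zero>} \<subseteq> T"
  shows "f \<in> FA.span (delta ` T)"
proof -
  have c: "delta ` T \<subseteq> carrier R" using delta_carrier T(2) by auto
  have "(\<Oplus>\<^bsub>R\<^esub>u\<in>U. f u \<odot>\<^bsub>R\<^esub> delta u) \<in> FA.span (delta ` T)" if "finite U" "U \<subseteq> T" for U
    using that
  proof (induction U rule: finite_induct)
    case (insert u U)
    have "f u \<odot>\<^bsub>R\<^esub> delta u \<in> FA.span (delta ` T)"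
      using insert FA.in_own_span[OF c] by (intro FA.span_smult_closed c carrierD f) auto
    moreover have "(\<Oplus>\<^bsub>R\<^esub>u\<in>insert u U. f u \<odot>\<^bsub>R\<^esub> delta u)
        = f u \<odot>\<^bsub>R\<^esub> delta u \<oplus>\<^bsub>R\<^esub> (\<Oplus>\<^bsub>R\<^esub>u\<in>U. f u \<odot>\<^bsub>R\<^esub> delta u)"
      using insert T(2) by (intro FA.M.finsum_insert) (auto intro!: smult_closed_R delta_carrier carrierD f)
    ultimately show ?case using insert by (simp add: FA.span_add_closed[OF c])
  qed (simp add: FA.span_zero)
  from this[OF T(1) subset_refl] show ?thesis by (simp only: sum_deltas[OF f T(1,3,2), symmetric])
qed

lemma component_span:
  "component n \<subseteq> FA.span (delta ` {u \<in> M. size u = n})"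
  using support_in_M by (auto simp: component_def intro!: in_span_deltas finite_level[OF M_monomials])

lemma deltas_independent:
  assumes "finite T" "T \<subseteq> M"
  shows "FA.lin_indpt (delta ` T)"
proof (rule FA.finite_lin_indpt2)
  show "finite (delta ` T)" "delta ` T \<subseteq> carrier R" using assms delta_carrier by auto
  fix a assume a: "a \<in> delta ` T \<rightarrow> carrier K" and lc: "FA.lincomb a (delta ` T) = \<zero>\<^bsub>R\<^esub>"
  define f where "f u = (if u \<in> T then a (delta u) else \<zero>)" for u
  have "{u. f u \<noteq> \<zero>} \<subseteq> T" by (auto simp: f_def)
  then have "finite {u. f u \<noteq> \<zero>}" using assms(1) finite_subset by blast
  then have f: "f \<in> carrier R" using a assms(2) by (auto simp: carrier_iff f_def)
  have "FA.lincomb a (delta ` T) = (\<Oplus>\<^bsub>R\<^esub>u\<in>T. a (delta u) \<odot>\<^bsub>R\<^esub> delta u)"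
    unfolding FA.lincomb_def using a assms(2)
    by (subst FA.M.add.finprod_reindex) (auto intro!: smult_closed_R delta_carrier inj_onI dest: delta_inj)
  also have "\<dots> = (\<Oplus>\<^bsub>R\<^esub>u\<in>T. f u \<odot>\<^bsub>R\<^esub> delta u)"
    using a assms(2) by (intro FA.M.add.finprod_cong') (auto simp: f_def intro!: smult_closed_R delta_carrier)
  also have "\<dots> = f"
    by (rule sum_deltas[OF f assms(1) _ assms(2), symmetric]) (auto simp: f_def)
  finally have "f = \<zero>\<^bsub>R\<^esub>" using lc by simp
  then have "f u = \<zero>" for u by (simp add: zero_apply)
  then have "a (delta u) = \<zero>" if "u \<in> T" for u using that unfolding f_def by meson
  then show "\<forall>v\<in>delta ` T. a v = \<zero>" by auto
qed

lemma hilbert_series_R: "hilbert_series K R component = counting_series M"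
proof (rule fps_ext)
  fix n
  let ?T = "{u \<in> M. size u = n}"
  have T: "finite ?T" by (rule finite_level[OF M_monomials])
  have "vectorspace.dim K (R\<lparr>carrier := component n\<rparr>) = card (delta ` ?T)"
  proof (rule FA.dim_subspace_eq_card[OF component_submodule _ _ _ component_span])
    show "delta ` ?T \<subseteq> component n" by (auto simp: component_def delta_carrier) (auto simp: delta_def split: if_splits)
  qed (use T deltas_independent in auto)
  also have "\<dots> = card ?T" by (rule card_image) (auto intro: inj_onI delta_inj)
  finally show "fps_nth (hilbert_series K R component) n = fps_nth (counting_series M) n"
    by (simp add: hilbert_series_def counting_series_def)
qed

lemma component_decomposition:
  assumes a: "a \<in> carrier R"
  shows "\<exists>!f. (\<forall>n. f n \<in> component n) \<and> finite {n. f n \<noteq> \<zero>\<^bsub>R\<^esub>} \<and>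
    a = finsum R f {n. f n \<noteq> \<zero>\<^bsub>R\<^esub>}"
proof (rule ex1I)
  define f where "f n = (\<lambda>u. if size u = n then a u else \<zero>)" for n
  have sup: "{u. f n u \<noteq> \<zero>} \<subseteq> {u. a u \<noteq> \<zero>}" for n by (auto simp: f_def)
  have fin: "finite {u. f n u \<noteq> \<zero>}" for n
    using finite_subset[OF sup] a by (auto simp: carrier_iff)
  have fc: "f n \<in> component n" for n
    using a fin[of n] by (auto simp: component_def carrier_iff f_def)
  then have fR: "f n \<in> carrier R" for n by (simp add: component_def)
  have sub: "{n. f n \<noteq> \<zero>\<^bsub>R\<^esub>} \<subseteq> size ` {u. a u \<noteq> \<zero>}"
    by (auto simp: f_def zero_apply fun_eq_iff split: if_splits)
  then have finn: "finite {n. f n \<noteq> \<zero>\<^bsub>R\<^esub>}" using a finite_subset by (fastforce simp: carrier_iff)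
  have "a = finsum R f {n. f n \<noteq> \<zero>\<^bsub>R\<^esub>}"
  proof
    fix u
    have "finsum R f {n. f n \<noteq> \<zero>\<^bsub>R\<^esub>} u = (\<Oplus>n\<in>{n. f n \<noteq> \<zero>\<^bsub>R\<^esub>}. f n u)"
      by (rule finsum_R_apply[OF finn fR])
    also have "\<dots> = (\<Oplus>n\<in>{n. f n \<noteq> \<zero>\<^bsub>R\<^esub>}. if size u = n then a u else \<zero>)"
      by (rule add.finprod_cong'[OF refl]) (auto simp: f_def carrierD[OF a])
    also have "\<dots> = a u"
    proof (cases "size u \<in> {n. f n \<noteq> \<zero>\<^bsub>R\<^esub>}")
      case True
      then show ?thesis
        using add.finprod_singleton[OF True finn, of "\<lambda>_. a u"] carrierD[OF a] by simp
    next
      case False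
      then have "f (size u) u = \<zero>" by (simp add: zero_apply)
      then have "a u = \<zero>" by (simp add: f_def)
      then show ?thesis by (intro trans[OF add.finprod_one_eqI]) auto
    qed
    finally show "a u = finsum R f {n. f n \<noteq> \<zero>\<^bsub>R\<^esub>} u" ..
  qed
  then show "(\<forall>n. f n \<in> component n) \<and> finite {n. f n \<noteq> \<zero>\<^bsub>R\<^esub>} \<and> a = finsum R f {n. f n \<noteq> \<zero>\<^bsub>R\<^esub>}"
    using fc finn by blast
  fix g assume g: "(\<forall>n. g n \<in> component n) \<and> finite {n. g n \<noteq> \<zero>\<^bsub>R\<^esub>} \<and> a = finsum R g {n. g n \<noteq> \<zero>\<^bsub>R\<^esub>}"
  then have gR: "g n \<in> carrier R" and gc: "g n u \<noteq> \<zero> \<Longrightarrow> size u = n" for n u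
    by (auto simp: component_def)
  have "a u = g (size u) u" for u
  proof -
    let ?T = "{n. g n \<noteq> \<zero>\<^bsub>R\<^esub>}"
    have finT: "finite ?T" using g by blast
    have "a u = finsum R g ?T u" using g by auto
    also have "\<dots> = (\<Oplus>n\<in>?T. g n u)" by (rule finsum_R_apply[OF finT gR])
    also have "\<dots> = (\<Oplus>n\<in>?T. if size u = n then g n u else \<zero>)"
      by (rule add.finprod_cong'[OF refl]) (auto simp: carrierD[OF gR] dest: gc)
    also have "\<dots> = g (size u) u"
    proof (cases "size u \<in> ?T")
      case True
      then show ?thesis
        using add.finprod_singleton[OF True finT, of "\<lambda>n. g n u"] carrierD[OF gR] by simp
    next
      case False
      then have "g (size u) u = \<zero>" by (simp add: zero_apply)
      moreover have "(\<Oplus>n\<in>?T. if size u = n then g n u else \<zero>) = \<zero>"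
        using False by (intro add.finprod_one_eqI) auto
      ultimately show ?thesis by simp
    qed
    finally show ?thesis .
  qed
  then have "g n u = f n u" for n u
    by (auto simp: f_def dest: gc)
  then show "g = f" by (intro ext)
qed

lemma component_mult:
  assumes "f \<in> component i" "g \<in> component j"
  shows "f \<otimes>\<^bsub>R\<^esub> g \<in> component (i + j)"
proof -
  have f: "f \<in> carrier R" and g: "g \<in> carrier R"
    and fs: "\<And>u. f u \<noteq> \<zero> \<Longrightarrow> size u = i" and gs: "\<And>u. g u \<noteq> \<zero> \<Longrightarrow> size u = j"
    using assms by (auto simp: component_def)
  have "(f \<otimes>\<^bsub>R\<^esub> g) u = \<zero>" if "size u \<noteq> i + j" for u
  proof -
    have "f (fst p) \<otimes> g (snd p) = \<zero>" if "p \<in> splits u" for p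
    proof -
      have "fst p + snd p = u" using that by (auto simp: splits_def)
      then have "size (fst p) \<noteq> i \<or> size (snd p) \<noteq> j" using \<open>size u \<noteq> i + j\<close> by auto
      then show ?thesis using fs gs carrierD[OF f] carrierD[OF g] by (metis l_null r_null)
    qed
    then show ?thesis by (auto simp: mult_apply intro: add.finprod_one_eqI)
  qed
  then show ?thesis using mult_closed[OF f g] by (auto simp: component_def)
qed

lemma standard_graded_R: "standard_graded_algebra K R component"
proof -
  have sub: "Module.submodule (component n) K R" for n
  proof -
    interpret N: LinearCombinations.submodule K "component n" R by (rule component_submodule)
    show ?thesis
    proof (rule FA.submoduleI)
      fix a assume a: "a \<in> component n"
      then have "a \<in> carrier R" using N.subset by auto
      then have "\<ominus>\<^bsub>R\<^esub> a = (\<ominus> \<one>) \<odot>\<^bsub>R\<^esub> a"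
        using FA.smult_l_minus[of \<one> a] by simp
      then show "\<ominus>\<^bsub>R\<^esub> a \<in> component n" using a by simp
    qed (use N.subset in auto)
  qed
  have bij: "bij_betw (\<lambda>c. c \<odot>\<^bsub>R\<^esub> \<one>\<^bsub>R\<^esub>) (carrier K) (component 0)"
  proof (rule bij_betwI[where g = "\<lambda>f. f {#}"])
    show "(\<lambda>c. c \<odot>\<^bsub>R\<^esub> \<one>\<^bsub>R\<^esub>) \<in> carrier K \<rightarrow> component 0"
      using smult_closed_R one_closed_R by (auto simp: component_def apply_simps)
    show "(\<lambda>f. f {#}) \<in> component 0 \<rightarrow> carrier K" by (auto simp: component_def carrierD)
    show "(f {#}) \<odot>\<^bsub>R\<^esub> \<one>\<^bsub>R\<^esub> = f" if "f \<in> component 0" for f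
    proof
      fix u show "(f {#} \<odot>\<^bsub>R\<^esub> \<one>\<^bsub>R\<^esub>) u = f u"
      proof (cases "u = {#}")
        case False
        then have "f u = \<zero>" using that unfolding component_def by auto
        then show ?thesis using False that by (simp add: component_def apply_simps carrierD)
      qed (use that in \<open>simp add: component_def apply_simps carrierD\<close>)
    qed
  qed (simp add: apply_simps)
  define S where "S = delta ` {u \<in> M. size u = 1}"
  let ?G = "generate_ring R ((\<lambda>c. c \<odot>\<^bsub>R\<^esub> \<one>\<^bsub>R\<^esub>) ` carrier K \<union> S)"
  have SA: "S \<subseteq> component 1"
    by (auto simp: S_def component_def delta_carrier) (auto simp: delta_def split: if_splits)
  have gens: "(\<lambda>c. c \<odot>\<^bsub>R\<^esub> \<one>\<^bsub>R\<^esub>) ` carrier K \<union> S \<subseteq> carrier R"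
    using SA smult_closed_R one_closed_R by (auto simp: component_def)
  have delta_G: "delta u \<in> ?G" if "u \<in> M" for u
    using that
  proof (induction u)
    case empty
    then show ?case using generate_ring.one[of R] by (simp add: one_eq_delta)
  next
    case (add i u)
    have sub: "{#i#} \<in> M" "u \<in> M"
      using add.prems M_downset unfolding downset_def by (auto simp: mset_subset_eq_single)
    then have "delta {#i#} \<in> ?G" by (intro generate_ring.incl) (auto simp: S_def)
    then have "delta {#i#} \<otimes>\<^bsub>R\<^esub> delta u \<in> ?G" using add.IH[OF sub(2)] by (rule generate_ring.eng_mult)
    then show ?case using delta_mult[of "{#i#}" u] sub add.prems by simp
  qed
  have "f \<in> ?G" if f: "f \<in> carrier R" for f
  proof -
    have scaled: "c \<odot>\<^bsub>R\<^esub> delta u \<in> ?G" if "c \<in> carrier K" "u \<in> M" for c u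
    proof -
      have "c \<odot>\<^bsub>R\<^esub> \<one>\<^bsub>R\<^esub> \<in> ?G" using that(1) by (intro generate_ring.incl) auto
      then have "(c \<odot>\<^bsub>R\<^esub> \<one>\<^bsub>R\<^esub>) \<otimes>\<^bsub>R\<^esub> delta u \<in> ?G"
        using delta_G[OF that(2)] by (rule generate_ring.eng_mult)
      then show ?thesis
        using that by (simp add: FA.Alg.smult_assoc2 one_closed_R delta_carrier one_mult_R)
    qed
    have "(\<Oplus>\<^bsub>R\<^esub>u\<in>T. f u \<odot>\<^bsub>R\<^esub> delta u) \<in> ?G" if "finite T" "T \<subseteq> M" for T
      using that
    proof (induction T rule: finite_induct)
      case empty
      then show ?case using ring.zero_in_generate[OF cring.axioms(1)[OF cring_R]] by simp
    next
      case (insert u T)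
      have "(\<Oplus>\<^bsub>R\<^esub>u\<in>insert u T. f u \<odot>\<^bsub>R\<^esub> delta u)
          = f u \<odot>\<^bsub>R\<^esub> delta u \<oplus>\<^bsub>R\<^esub> (\<Oplus>\<^bsub>R\<^esub>u\<in>T. f u \<odot>\<^bsub>R\<^esub> delta u)"
        using insert by (intro FA.M.finsum_insert) (auto intro!: smult_closed_R delta_carrier carrierD f)
      then show ?case using insert scaled carrierD[OF f] by (auto intro: generate_ring.eng_add)
    qed
    moreover have T: "finite {u. f u \<noteq> \<zero>}" "{u. f u \<noteq> \<zero>} \<subseteq> M"
      using f support_in_M[OF f] by (auto simp: carrier_iff)
    ultimately have "(\<Oplus>\<^bsub>R\<^esub>u\<in>{u. f u \<noteq> \<zero>}. f u \<odot>\<^bsub>R\<^esub> delta u) \<in> ?G" by blast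
    then show ?thesis by (simp only: sum_deltas[OF f T(1) subset_refl T(2), symmetric])
  qed
  then have "?G = carrier R"
    using ring.generate_ring_incl[OF cring.axioms(1)[OF cring_R] gens] by blast
  moreover have "finite S" unfolding S_def using finite_level[OF M_monomials] by blast
  ultimately show ?thesis
    unfolding standard_graded_algebra_def graded_algebra_def
    using algebra_R sub component_mult component_decomposition bij SA by blast
qed

end

section \<open>Chains of prime ideals\<close>

text \<open>Formulated for families rather than sets, since the products of powers to which it is
  applied may coincide; a repetition is itself a relation, with coefficients 1 and -1.\<close>

lemma (in field_algebra) family_dependent:
  assumes I: "finite I" and B: "finite B" "B \<subseteq> carrier R" "card B < card I"
    and m: "\<And>i. i \<in> I \<Longrightarrow> m i \<in> span B"
  shows "\<exists>c. c \<in> I \<rightarrow> carrier K \<and> (\<exists>i\<in>I. c i \<noteq> \<zero>\<^bsub>K\<^esub>) \<and> (\<Oplus>i\<in>I. c i \<odot> m i) = \<zero>"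
proof (cases "inj_on m I")
  case True
  let ?S = "m ` I"
  have mc: "m i \<in> carrier R" if "i \<in> I" for i
    using m[OF that] span_is_subset2[OF B(2)] by auto
  have sub: "subspace K (span B) R" by (rule span_is_subspace[OF B(2)])
  have SB: "?S \<subseteq> span B" using m by auto
  have BB: "B \<subseteq> span B" by (rule in_own_span[OF B(2)])
  interpret W: vectorspace K "R\<lparr>carrier := span B\<rparr>" by (rule subspace_is_vs[OF sub])
  have smod: "submodule K (span B) R" by (rule span_is_submodule[OF B(2)])
  have "lin_dep ?S"
  proof (rule ccontr)
    assume "\<not> lin_dep ?S"
    then have "\<not> W.lin_dep ?S" using span_li_not_depend(2)[OF SB smod] by simp
    moreover have "W.span B = span B" using span_li_not_depend(1)[OF BB smod] .
    ultimately have "card ?S \<le> card B"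
      using W.li_smaller_than_gen[of ?S B] I B(1) SB BB by simp
    then show False using B(3) card_image[OF True] by simp
  qed
  then obtain a v where a: "a \<in> ?S \<rightarrow> carrier K" "lincomb a ?S = \<zero>" "v \<in> ?S" "a v \<noteq> \<zero>\<^bsub>K\<^esub>"
    using finite_lin_dep[of ?S] I mc by blast
  have "lincomb a ?S = (\<Oplus>i\<in>I. a (m i) \<odot> m i)"
    unfolding lincomb_def using a(1) mc True by (intro M.add.finprod_reindex) auto
  then show ?thesis using a by (intro exI[of _ "\<lambda>i. a (m i)"]) auto
next
  case False
  have mc: "m i \<in> carrier R" if "i \<in> I" for i
    using m[OF that] span_is_subset2[OF B(2)] by auto
  obtain i j where ij: "i \<in> I" "j \<in> I" "i \<noteq> j" "m i = m j" using False by (auto simp: inj_on_def)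
  define c where "c k = (if k = i then \<one>\<^bsub>K\<^esub> else if k = j then \<ominus>\<^bsub>K\<^esub> \<one>\<^bsub>K\<^esub> else \<zero>\<^bsub>K\<^esub>)" for k
  have cK: "c k \<in> carrier K" for k by (simp add: c_def)
  have "(\<Oplus>k\<in>I. c k \<odot> m k) = (\<Oplus>k\<in>{i, j}. c k \<odot> m k)"
    using ij I mc cK by (intro M.add.finprod_mono_neutral_cong_right) (auto simp: c_def)
  also have "\<dots> = m i \<oplus> (\<ominus>\<^bsub>K\<^esub> \<one>\<^bsub>K\<^esub>) \<odot> m i"
    using ij mc by (simp add: c_def)
  also have "\<dots> = \<zero>" using mc[OF ij(1)] by (simp add: smult_l_minus M.r_neg)
  finally show ?thesis using ij(1) cK by (intro exI[of _ c]) (auto simp: c_def)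
qed

text \<open>In a relation modulo \<open>P\<close>, unmarked low terms vanish and powers of
  \<open>x\<close>, which is not in \<open>P\<close>, can be cancelled. Once the lowest term is
  marked, the remaining terms are multiples of \<open>x\<close> and lie in \<open>Q\<close>, so that
  coefficient lies in \<open>Q\<close> as well. The marks \<open>nz\<close> record that a
  coefficient is formally nonzero; as an element of the ring it may still be zero.\<close>

lemma (in cring) lowest_coefficient_in_next_prime:
  fixes N :: nat
  assumes P: "primeideal P R" and Q: "ideal Q R" "P \<subseteq> Q" and x: "x \<in> Q" "x \<notin> P"
    and "\<And>i. i \<le> N \<Longrightarrow> c i \<in> carrier R" "\<And>i. i \<le> N \<Longrightarrow> \<not> nz i \<Longrightarrow> c i = \<zero>" "\<exists>i\<le>N. nz i"
    and "(\<Oplus>i\<in>{..N}. c i \<otimes> x [^] i) \<in> P"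
  shows "\<exists>i\<le>N. nz i \<and> c i \<in> Q"
  using assms(6-9)
proof (induction N arbitrary: c nz)
  case 0
  then have "c 0 \<in> P" by simp
  then show ?case using Q(2) 0 by auto
next
  case (Suc N)
  interpret Q: ideal Q R by (rule Q)
  interpret P: primeideal P R by (rule P)
  have xc: "x \<in> carrier R" using x(1) Q.a_subset by auto
  define S where "S = (\<Oplus>i\<in>{..N}. c (Suc i) \<otimes> x [^] i)"
  have Sc: "S \<in> carrier R" unfolding S_def using Suc.prems(1) xc by (intro finsum_closed) auto
  have "(\<Oplus>i\<in>{..Suc N}. c i \<otimes> x [^] i) = (\<Oplus>i\<in>{..N}. c (Suc i) \<otimes> x [^] (Suc i)) \<oplus> c 0 \<otimes> x [^] (0::nat)"
    using Suc.prems(1) xc by (intro finsum_Suc2) auto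
  also have "(\<Oplus>i\<in>{..N}. c (Suc i) \<otimes> x [^] (Suc i)) = (\<Oplus>i\<in>{..N}. x \<otimes> (c (Suc i) \<otimes> x [^] i))"
    using Suc.prems(1) xc by (intro add.finprod_cong') (auto simp: m_ac)
  also have "\<dots> = x \<otimes> S"
    unfolding S_def using Suc.prems(1) xc by (intro finsum_rdistr[symmetric]) auto
  finally have eq: "x \<otimes> S \<oplus> c 0 \<in> P" using Suc.prems(1)[of 0] Suc.prems(4) by simp
  show ?case
  proof (cases "nz 0")
    case True
    have "x \<otimes> S \<in> Q" using Q.I_r_closed x(1) Sc by blast
    moreover have "x \<otimes> S \<oplus> c 0 \<in> Q" using eq Q(2) by auto
    ultimately have "\<ominus> (x \<otimes> S) \<oplus> (x \<otimes> S \<oplus> c 0) \<in> Q" by simp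
    then have "c 0 \<in> Q" using Suc.prems(1)[of 0] xc Sc by (simp add: r_neg2 r_neg1)
    then show ?thesis using True by auto
  next
    case False
    then have "x \<otimes> S \<in> P" using eq Suc.prems(2)[of 0] xc Sc by simp
    then have "S \<in> P" using P.I_prime[OF xc Sc] x(2) by blast
    moreover have "\<exists>i\<le>N. nz (Suc i)"
      using Suc.prems(3) False by (metis Suc_le_mono not0_implies_Suc)
    ultimately have "\<exists>i\<le>N. nz (Suc i) \<and> c (Suc i) \<in> Q"
      using Suc.prems unfolding S_def by (intro Suc.IH) auto
    then show ?thesis by auto
  qed
qed

context monomial_ring
begin

lemma support_mult_bound:
  assumes f: "f \<in> carrier R" "\<And>u. f u \<noteq> \<zero> \<Longrightarrow> size u \<le> i"
    and g: "g \<in> carrier R" "\<And>u. g u \<noteq> \<zero> \<Longrightarrow> size u \<le> j"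
    and u: "(f \<otimes>\<^bsub>R\<^esub> g) u \<noteq> \<zero>"
  shows "size u \<le> i + j"
proof (rule ccontr)
  assume "\<not> size u \<le> i + j"
  have "f (fst p) \<otimes> g (snd p) = \<zero>" if "p \<in> splits u" for p
  proof -
    have "fst p + snd p = u" using that by (auto simp: splits_def)
    then have "\<not> size (fst p) \<le> i \<or> \<not> size (snd p) \<le> j" using \<open>\<not> size u \<le> i + j\<close> by auto
    then show ?thesis using f g carrierD[OF f(1)] carrierD[OF g(1)] by (metis l_null r_null)
  qed
  then have "(f \<otimes>\<^bsub>R\<^esub> g) u = \<zero>" by (auto simp: mult_apply intro: add.finprod_one_eqI)
  then show False using u by simp
qed

lemma support_pow_bound:
  fixes k :: nat
  assumes f: "f \<in> carrier R" "\<And>u. f u \<noteq> \<zero> \<Longrightarrow> size u \<le> i"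
  shows "(f [^]\<^bsub>R\<^esub> k) u \<noteq> \<zero> \<Longrightarrow> size u \<le> k * i"
proof (induction k arbitrary: u)
  case 0
  then show ?case by (auto simp: one_apply split: if_splits)
next
  case (Suc k)
  have "f [^]\<^bsub>R\<^esub> k \<in> carrier R" using f(1) by (rule FA.Alg.nat_pow_closed)
  from support_mult_bound[OF this Suc.IH f, of u] Suc.prems show ?case by simp
qed

lemma finite_bounded_level: "finite {u \<in> M. size u \<le> L}"
proof -
  have "{u \<in> M. size u \<le> L} = (\<Union>n\<le>L. {u \<in> M. size u = n})" by auto
  then show ?thesis using finite_level[OF M_monomials] by auto
qed

text \<open>Choose y_i in P_(i+1) but not in P_i for i = 0, 1, 2. There are cubically many products
  of powers of the three elements, but they live in a space of quadratically growing dimension, so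
  they satisfy a nontrivial relation over \<open>K\<close>. Taking a marked coefficient with respect
  to y_0, y_1 and y_2 in turn puts a nonzero scalar into P_3.\<close>

lemma no_long_prime_chain:
  assumes growth: "\<And>L. card {u \<in> M. size u \<le> L} \<le> C * (L + 1)\<^sup>2"
    and primes: "\<And>i. i \<le> 3 \<Longrightarrow> primeideal (P i) R" and chain: "\<And>i. i < 3 \<Longrightarrow> P i \<subset> P (Suc i)"
  shows False
proof -
  have "\<exists>y. y \<in> P (Suc i) \<and> y \<notin> P i" if "i < 3" for i using chain[OF that] by blast
  then obtain y where y: "\<And>i. i < 3 \<Longrightarrow> y i \<in> P (Suc i)" "\<And>i. i < 3 \<Longrightarrow> y i \<notin> P i" by metis
  have id: "ideal (P i) R" if "i \<le> 3" for i using primes[OF that] by (simp add: primeideal_def)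
  have yc: "y i \<in> carrier R" if "i < 3" for i
    using y(1)[OF that] additive_subgroup.a_subset[OF ideal.axioms(1)[OF id[of "Suc i"]]] that by auto
  have fin: "finite (\<Union>i<3. size ` {u. y i u \<noteq> \<zero>})" using yc by (auto simp: carrier_iff)
  define b where "b = Max (insert 0 (\<Union>i<3. size ` {u. y i u \<noteq> \<zero>}))"
  have b: "size u \<le> b" if "i < 3" "y i u \<noteq> \<zero>" for i u
    unfolding b_def using that fin by (intro Max_ge) auto
  \<comment> \<open>\<open>b\<close> bounds the degrees in the three elements. With this
    \<open>N\<close> the dimension is at most C ((3 b + 1) (N + 1))^2 = N (N + 1)^2, less than the
    (N + 1)^3 exponent triples.\<close>
  define N where "N = C * (3 * b + 1)\<^sup>2"
  define L where "L = 3 * (N * b)"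
  define Box where "Box = {..N} \<times> ({..N} \<times> {..N})"
  define m where "m a = y 0 [^]\<^bsub>R\<^esub> (fst a :: nat) \<otimes>\<^bsub>R\<^esub> (y 1 [^]\<^bsub>R\<^esub> (fst (snd a) :: nat) \<otimes>\<^bsub>R\<^esub> y 2 [^]\<^bsub>R\<^esub> (snd (snd a) :: nat))" for a
  have pc: "y i [^]\<^bsub>R\<^esub> k \<in> carrier R" if "i < 3" for i and k :: nat
    using yc[OF that] by (rule FA.Alg.nat_pow_closed)
  have mc: "m a \<in> carrier R" for a unfolding m_def using pc by (intro FA.Alg.m_closed) auto
  let ?T = "{u \<in> M. size u \<le> L}"
  have "m a \<in> FA.span (delta ` ?T)" if "a \<in> Box" for a
  proof (rule in_span_deltas[OF mc finite_bounded_level])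
    show "{u. m a u \<noteq> \<zero>} \<subseteq> ?T"
    proof
      fix u assume u: "u \<in> {u. m a u \<noteq> \<zero>}"
      have p: "(y i [^]\<^bsub>R\<^esub> k) v \<noteq> \<zero> \<Longrightarrow> size v \<le> N * b" if "i < 3" "k \<le> N" for i k v
        using support_pow_bound[OF yc[OF that(1)] b[OF that(1)], of k v] that(2)
        by (meson le_trans mult_le_mono1)
      have k: "fst a \<le> N" "fst (snd a) \<le> N" "snd (snd a) \<le> N" using that by (auto simp: Box_def)
      define g where "g = y 1 [^]\<^bsub>R\<^esub> (fst (snd a)) \<otimes>\<^bsub>R\<^esub> y 2 [^]\<^bsub>R\<^esub> (snd (snd a))"
      have gc: "g \<in> carrier R" unfolding g_def using pc by (intro FA.Alg.m_closed) auto
      have gb: "size v \<le> N * b + N * b" if "g v \<noteq> \<zero>" for v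
        using that unfolding g_def
        by (rule support_mult_bound[rotated 4]) (use pc p[of 1, OF _ k(2)] p[of 2, OF _ k(3)] in auto)
      have "size u \<le> N * b + (N * b + N * b)"
      proof (rule support_mult_bound)
        show "(y 0 [^]\<^bsub>R\<^esub> fst a \<otimes>\<^bsub>R\<^esub> g) u \<noteq> \<zero>" using u by (simp add: m_def g_def)
      qed (use pc p[of 0, OF _ k(1)] gc gb in auto)
      then show "u \<in> ?T" using u support_in_M[OF mc] by (auto simp: L_def)
    qed
  qed auto
  moreover have "card (delta ` ?T) < card Box"
  proof -
    have "card (delta ` ?T) \<le> card ?T" by (rule card_image_le[OF finite_bounded_level])
    also have "\<dots> \<le> C * (L + 1)\<^sup>2" by (rule growth)
    also have "\<dots> \<le> C * ((3 * b + 1) * (N + 1))\<^sup>2"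
      by (intro mult_le_mono power_mono) (auto simp: L_def algebra_simps)
    also have "\<dots> = N * (N + 1)\<^sup>2" by (simp only: power_mult_distrib mult.assoc[symmetric] N_def[symmetric])
    also have "\<dots> < (N + 1) * (N + 1)\<^sup>2" by simp
    also have "\<dots> = card Box" by (simp add: Box_def card_cartesian_product power2_eq_square)
    finally show ?thesis .
  qed
  moreover have "finite Box" by (simp add: Box_def)
  moreover have "finite (delta ` ?T)" "delta ` ?T \<subseteq> carrier R"
    using finite_bounded_level delta_carrier by auto
  ultimately obtain c where c: "c \<in> Box \<rightarrow> carrier K" "\<exists>a\<in>Box. c a \<noteq> \<zero>"
    "(\<Oplus>\<^bsub>R\<^esub>a\<in>Box. c a \<odot>\<^bsub>R\<^esub> m a) = \<zero>\<^bsub>R\<^esub>"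
    using FA.family_dependent[of Box "delta ` ?T" m] by blast
  \<comment> \<open>The relation is regrouped as a polynomial in y_0 whose coefficients
    \<open>c0\<close> are polynomials in y_1, with coefficients \<open>c1\<close> that are
    polynomials in y_2 with scalar coefficients \<open>c2\<close>. The outermost variable belongs to
    the smallest prime.\<close>
  define c2 where "c2 i j k = c (i, j, k) \<odot>\<^bsub>R\<^esub> \<one>\<^bsub>R\<^esub>" for i j k
  define c1 where "c1 i j = (\<Oplus>\<^bsub>R\<^esub>k\<in>{..N}. c2 i j k \<otimes>\<^bsub>R\<^esub> y 2 [^]\<^bsub>R\<^esub> k)" for i j
  define c0 where "c0 i = (\<Oplus>\<^bsub>R\<^esub>j\<in>{..N}. c1 i j \<otimes>\<^bsub>R\<^esub> y 1 [^]\<^bsub>R\<^esub> j)" for i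
  have cK: "c (i, j, k) \<in> carrier K" if "i \<le> N" "j \<le> N" "k \<le> N" for i j k
    using c(1) that by (auto simp: Box_def)
  have c2c: "c2 i j k \<in> carrier R" if "i \<le> N" "j \<le> N" "k \<le> N" for i j k
    unfolding c2_def using cK[OF that] one_closed_R by (rule smult_closed_R)
  have c1c: "c1 i j \<in> carrier R" if "i \<le> N" "j \<le> N" for i j
    unfolding c1_def using c2c that pc by (intro FA.M.finsum_closed) auto
  have c0c: "c0 i \<in> carrier R" if "i \<le> N" for i
    unfolding c0_def using c1c that pc by (intro FA.M.finsum_closed) auto
  have tc: "c2 i j k \<otimes>\<^bsub>R\<^esub> m (i, j, k) \<in> carrier R" if "i \<le> N" "j \<le> N" "k \<le> N" for i j k
    using c2c[OF that] mc by (rule FA.Alg.m_closed)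
  have "(\<Oplus>\<^bsub>R\<^esub>i\<in>{..N}. c0 i \<otimes>\<^bsub>R\<^esub> y 0 [^]\<^bsub>R\<^esub> i)
      = (\<Oplus>\<^bsub>R\<^esub>i\<in>{..N}. \<Oplus>\<^bsub>R\<^esub>jk\<in>{..N}\<times>{..N}. c2 i (fst jk) (snd jk) \<otimes>\<^bsub>R\<^esub> m (i, jk))"
  proof (rule FA.M.add.finprod_cong'[OF refl])
    fix i assume "i \<in> {..N}"
    then have i: "i \<le> N" by simp
    have "c0 i \<otimes>\<^bsub>R\<^esub> y 0 [^]\<^bsub>R\<^esub> i = (\<Oplus>\<^bsub>R\<^esub>j\<in>{..N}. c1 i j \<otimes>\<^bsub>R\<^esub> y 1 [^]\<^bsub>R\<^esub> j \<otimes>\<^bsub>R\<^esub> y 0 [^]\<^bsub>R\<^esub> i)"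
      unfolding c0_def using c1c[OF i] pc by (intro FA.Alg.finsum_ldistr) auto
    also have "\<dots> = (\<Oplus>\<^bsub>R\<^esub>j\<in>{..N}. \<Oplus>\<^bsub>R\<^esub>k\<in>{..N}. c2 i j k \<otimes>\<^bsub>R\<^esub> m (i, j, k))"
    proof (rule FA.M.add.finprod_cong'[OF refl])
      fix j assume "j \<in> {..N}"
      then have j: "j \<le> N" by simp
      have "c1 i j \<otimes>\<^bsub>R\<^esub> y 1 [^]\<^bsub>R\<^esub> j \<otimes>\<^bsub>R\<^esub> y 0 [^]\<^bsub>R\<^esub> i = c1 i j \<otimes>\<^bsub>R\<^esub> (y 1 [^]\<^bsub>R\<^esub> j \<otimes>\<^bsub>R\<^esub> y 0 [^]\<^bsub>R\<^esub> i)"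
        using c1c[OF i j] pc by (intro FA.Alg.m_assoc) auto
      also have "\<dots> = (\<Oplus>\<^bsub>R\<^esub>k\<in>{..N}. c2 i j k \<otimes>\<^bsub>R\<^esub> y 2 [^]\<^bsub>R\<^esub> k \<otimes>\<^bsub>R\<^esub> (y 1 [^]\<^bsub>R\<^esub> j \<otimes>\<^bsub>R\<^esub> y 0 [^]\<^bsub>R\<^esub> i))"
        unfolding c1_def using c2c[OF i j] pc by (intro FA.Alg.finsum_ldistr) auto
      also have "\<dots> = (\<Oplus>\<^bsub>R\<^esub>k\<in>{..N}. c2 i j k \<otimes>\<^bsub>R\<^esub> m (i, j, k))"
      proof (rule FA.M.add.finprod_cong'[OF refl])
        fix k assume "k \<in> {..N}"
        then show "c2 i j k \<otimes>\<^bsub>R\<^esub> y 2 [^]\<^bsub>R\<^esub> k \<otimes>\<^bsub>R\<^esub> (y 1 [^]\<^bsub>R\<^esub> j \<otimes>\<^bsub>R\<^esub> y 0 [^]\<^bsub>R\<^esub> i) = c2 i j k \<otimes>\<^bsub>R\<^esub> m (i, j, k)"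
          using c2c[OF i j, of k] pc[of 0 i] pc[of 1 j] pc[of 2 k] by (simp add: m_def FA.Alg.m_ac)
      qed (use tc[OF i j] in auto)
      finally show "c1 i j \<otimes>\<^bsub>R\<^esub> y 1 [^]\<^bsub>R\<^esub> j \<otimes>\<^bsub>R\<^esub> y 0 [^]\<^bsub>R\<^esub> i = (\<Oplus>\<^bsub>R\<^esub>k\<in>{..N}. c2 i j k \<otimes>\<^bsub>R\<^esub> m (i, j, k))" .
    qed (use tc[OF i] in \<open>auto intro!: FA.M.finsum_closed\<close>)
    also have "\<dots> = (\<Oplus>\<^bsub>R\<^esub>jk\<in>{..N}\<times>{..N}. c2 i (fst jk) (snd jk) \<otimes>\<^bsub>R\<^esub> m (i, jk))"
      by (subst FA.M.finsum_Sigma) (use tc[OF i] in auto)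
    finally show "c0 i \<otimes>\<^bsub>R\<^esub> y 0 [^]\<^bsub>R\<^esub> i
        = (\<Oplus>\<^bsub>R\<^esub>jk\<in>{..N}\<times>{..N}. c2 i (fst jk) (snd jk) \<otimes>\<^bsub>R\<^esub> m (i, jk))" .
  qed (use tc in \<open>auto intro!: FA.M.finsum_closed\<close>)
  also have "\<dots> = (\<Oplus>\<^bsub>R\<^esub>a\<in>Box. c2 (fst a) (fst (snd a)) (snd (snd a)) \<otimes>\<^bsub>R\<^esub> m (fst a, snd a))"
    unfolding Box_def by (rule FA.M.finsum_Sigma) (use tc in auto)
  also have "\<dots> = (\<Oplus>\<^bsub>R\<^esub>a\<in>Box. c a \<odot>\<^bsub>R\<^esub> m a)"
  proof (rule FA.M.add.finprod_cong'[OF refl])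
    fix a assume "a \<in> Box"
    then have "c a \<in> carrier K" using c(1) by auto
    then show "c2 (fst a) (fst (snd a)) (snd (snd a)) \<otimes>\<^bsub>R\<^esub> m (fst a, snd a) = c a \<odot>\<^bsub>R\<^esub> m a"
      using mc[of a] by (simp add: c2_def FA.Alg.smult_assoc2 one_closed_R one_mult_R)
  qed (use c(1) mc in \<open>auto intro!: smult_closed_R\<close>)
  finally have sum0: "(\<Oplus>\<^bsub>R\<^esub>i\<in>{..N}. c0 i \<otimes>\<^bsub>R\<^esub> y 0 [^]\<^bsub>R\<^esub> i) = \<zero>\<^bsub>R\<^esub>" using c(3) by simp
  have zero_in: "\<zero>\<^bsub>R\<^esub> \<in> P 0" using additive_subgroup.zero_closed[OF ideal.axioms(1)[OF id[of 0]]] by simp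
  \<comment> \<open>A coefficient is marked when some scalar inside it is nonzero, so that a nonzero
    scalar can be followed down to the innermost level.\<close>
  define nz2 nz1 nz0 where "nz2 i j k \<longleftrightarrow> c (i, j, k) \<noteq> \<zero>" and "nz1 i j \<longleftrightarrow> (\<exists>k\<le>N. nz2 i j k)"
    and "nz0 i \<longleftrightarrow> (\<exists>j\<le>N. nz1 i j)" for i j k
  have z2: "c2 i j k = \<zero>\<^bsub>R\<^esub>" if "\<not> nz2 i j k" for i j k
    using that by (simp add: nz2_def c2_def one_closed_R)
  have z1: "c1 i j = \<zero>\<^bsub>R\<^esub>" if "\<not> nz1 i j" for i j
    unfolding c1_def using that z2 pc by (intro FA.M.add.finprod_one_eqI) (auto simp: nz1_def)
  have z0: "c0 i = \<zero>\<^bsub>R\<^esub>" if "\<not> nz0 i" for i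
    unfolding c0_def using that z1 pc by (intro FA.M.add.finprod_one_eqI) (auto simp: nz0_def)
  have "\<exists>i\<le>N. nz0 i \<and> c0 i \<in> P 1"
  proof (rule FA.Alg.lowest_coefficient_in_next_prime[of "P 0" "P 1" "y 0"])
    show "\<exists>i\<le>N. nz0 i" using c(2) by (force simp: nz0_def nz1_def nz2_def Box_def)
  qed (use primes[of 0] id[of 1] chain[of 0] y[of 0] c0c z0 sum0 zero_in in auto)
  then obtain i where i: "i \<le> N" "nz0 i" "c0 i \<in> P 1" by blast
  have "\<exists>j\<le>N. nz1 i j \<and> c1 i j \<in> P 2"
  proof (rule FA.Alg.lowest_coefficient_in_next_prime[of "P 1" "P 2" "y 1"])
    show "\<exists>j\<le>N. nz1 i j" using i(2) by (simp add: nz0_def)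
  qed (use primes[of 1] id[of 2] chain[of 1] y[of 1] c1c[OF i(1)] z1 i(3) in \<open>auto simp: c0_def numeral_2_eq_2\<close>)
  then obtain j where j: "j \<le> N" "nz1 i j" "c1 i j \<in> P 2" by blast
  have "\<exists>k\<le>N. nz2 i j k \<and> c2 i j k \<in> P 3"
  proof (rule FA.Alg.lowest_coefficient_in_next_prime[of "P 2" "P 3" "y 2"])
    show "\<exists>k\<le>N. nz2 i j k" using j(2) by (simp add: nz1_def)
  qed (use primes[of 2] id[of 3] chain[of 2] y[of 2] c2c[OF i(1) j(1)] z2 j(3) in \<open>auto simp: c1_def numeral_3_eq_3\<close>)
  then obtain k where k: "k \<le> N" "nz2 i j k" "c2 i j k \<in> P 3" by blast
  let ?c = "c (i, j, k)"
  have cu: "?c \<in> carrier K" "?c \<noteq> \<zero>" using cK i(1) j(1) k by (auto simp: nz2_def)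
  then have inv: "inv ?c \<in> carrier K" "inv ?c \<otimes> ?c = \<one>"
    using field_Units by auto
  interpret P3: primeideal "P 3" R using primes by simp
  have "(inv ?c \<odot>\<^bsub>R\<^esub> \<one>\<^bsub>R\<^esub>) \<otimes>\<^bsub>R\<^esub> c2 i j k \<in> P 3"
    using k(3) inv one_closed_R by (intro P3.I_l_closed smult_closed_R)
  also have "(inv ?c \<odot>\<^bsub>R\<^esub> \<one>\<^bsub>R\<^esub>) \<otimes>\<^bsub>R\<^esub> c2 i j k = inv ?c \<odot>\<^bsub>R\<^esub> c2 i j k"
    using inv c2c[OF i(1) j(1) k(1)] by (simp add: FA.Alg.smult_assoc2 one_closed_R one_mult_R)
  also have "\<dots> = (inv ?c \<otimes> ?c) \<odot>\<^bsub>R\<^esub> \<one>\<^bsub>R\<^esub>"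
    unfolding c2_def by (rule FA.smult_assoc1[OF inv(1) cu(1) one_closed_R, symmetric])
  also have "\<dots> = \<one>\<^bsub>R\<^esub>" using inv(2) one_closed_R by simp
  finally show False using P3.one_imp_carrier P3.I_notcarr by simp
qed

end

section \<open>Primes from sets of variables and Krull dimension two\<close>

context monomial_ring
begin

text \<open>If all monomials in the variables \<open>T\<close> belong to \<open>M\<close>, this is
  the kernel of the map onto the polynomial ring in \<open>T\<close> that kills the other
  variables.\<close>

definition vanishing_on :: "nat set \<Rightarrow> (nat multiset \<Rightarrow> 'a) set" where
  "vanishing_on T = {f \<in> carrier R. \<forall>u. set_mset u \<subseteq> T \<longrightarrow> f u = \<zero>}"

lemma splits_subset: "p \<in> splits u \<Longrightarrow> set_mset u \<subseteq> T \<Longrightarrow> set_mset (fst p) \<subseteq> T \<and> set_mset (snd p) \<subseteq> T"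
  by (auto simp: splits_def)

text \<open>The leading term argument. Let \<open>u\<close> and \<open>v\<close> be the largest
  monomials over \<open>T\<close> in the two factors. Any other splitting of u + v has a component
  larger than its counterpart, so the coefficient of the product there is f(u) g(v), which is
  nonzero.\<close>

lemma vanishing_on_prime:
  assumes T: "\<And>u. set_mset u \<subseteq> T \<Longrightarrow> u \<in> M"
  shows "primeideal (vanishing_on T) R"
proof (rule primeidealI)
  show "ideal (vanishing_on T) R"
  proof (rule idealI)
    show "ring R" using cring_R by (rule cring.axioms)
    have neg: "\<ominus>\<^bsub>R\<^esub> f = (\<ominus> \<one>) \<odot>\<^bsub>R\<^esub> f" if "f \<in> carrier R" for f
      using FA.smult_l_minus[of \<one> f] that by simp
    show "subgroup (vanishing_on T) (add_monoid R)"
    proof (rule FA.M.add.subgroupI)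
      show "vanishing_on T \<noteq> {}" using zero_closed_R by (auto simp: vanishing_on_def zero_apply)
      show "\<ominus>\<^bsub>R\<^esub> f \<in> vanishing_on T" if "f \<in> vanishing_on T" for f
        using that neg[of f] smult_closed_R[of "\<ominus> \<one>" f]
        by (auto simp: vanishing_on_def smult_apply)
    qed (use add_closed_R in \<open>auto simp: vanishing_on_def add_apply\<close>)
    fix f g assume f: "f \<in> vanishing_on T" and g: "g \<in> carrier R"
    then have fc: "f \<in> carrier R" by (simp add: vanishing_on_def)
    have "(f \<otimes>\<^bsub>R\<^esub> g) u = \<zero>" if u: "set_mset u \<subseteq> T" for u
    proof -
      have "f (fst p) \<otimes> g (snd p) = \<zero>" if "p \<in> splits u" for p
      proof -
        have "f (fst p) = \<zero>" using f splits_subset[OF that u] by (simp add: vanishing_on_def)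
        then show ?thesis using carrierD[OF g] by simp
      qed
      then have "(\<Oplus>p\<in>splits u. f (fst p) \<otimes> g (snd p)) = \<zero>" by (rule add.finprod_one_eqI)
      then show ?thesis by (simp add: mult_apply)
    qed
    then show "f \<otimes>\<^bsub>R\<^esub> g \<in> vanishing_on T" using mult_closed[OF fc g] by (simp add: vanishing_on_def)
    then show "g \<otimes>\<^bsub>R\<^esub> f \<in> vanishing_on T" using mult_comm_R[OF fc g] by simp
  qed
  show "cring R" by (rule cring_R)
  have "\<one>\<^bsub>R\<^esub> {#} \<noteq> \<zero>" by (simp add: one_apply)
  then have "\<one>\<^bsub>R\<^esub> \<notin> vanishing_on T" unfolding vanishing_on_def by force
  then show "carrier R \<noteq> vanishing_on T" using one_closed_R by auto
  fix f g assume f: "f \<in> carrier R" and g: "g \<in> carrier R" and fg: "f \<otimes>\<^bsub>R\<^esub> g \<in> vanishing_on T"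
  show "f \<in> vanishing_on T \<or> g \<in> vanishing_on T"
  proof (rule ccontr)
    assume contra: "\<not> (f \<in> vanishing_on T \<or> g \<in> vanishing_on T)"
    define F G where "F = {u. set_mset u \<subseteq> T \<and> f u \<noteq> \<zero>}" and "G = {u. set_mset u \<subseteq> T \<and> g u \<noteq> \<zero>}"
    have ne: "F \<noteq> {}" "G \<noteq> {}" using contra f g unfolding F_def G_def vanishing_on_def by blast+
    have "finite {u. f u \<noteq> \<zero>}" "finite {u. g u \<noteq> \<zero>}" using f g by (simp_all add: carrier_iff)
    then have fin: "finite F" "finite G" unfolding F_def G_def by (simp_all add: finite_Collect_conjI)
    define u v where "u = Max F" and "v = Max G"
    have u: "u \<in> F" and v: "v \<in> G" using Max_in fin ne by (auto simp: u_def v_def)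
    have uv: "set_mset (u + v) \<subseteq> T" using u v by (auto simp: F_def G_def)
    have zero: "f (fst p) \<otimes> g (snd p) = \<zero>" if p: "p \<in> splits (u + v)" "(u, v) \<noteq> p" for p
    proof -
      have sp: "fst p + snd p = u + v" using p(1) by (auto simp: splits_def)
      have "fst p > u \<or> snd p > v"
      proof (rule ccontr)
        assume "\<not> ?thesis"
        then have le: "fst p \<le> u" "snd p \<le> v" by auto
        have "fst p = u"
        proof (rule ccontr)
          assume "fst p \<noteq> u"
          then have "fst p + snd p < u + v" using le by (intro add_less_le_mono) auto
          then show False using sp by simp
        qed
        then show False using sp p(2) by (cases p) auto
      qed
      then show ?thesis
      proof
        assume "fst p > u"
        then have "fst p \<notin> F" using Max_ge[OF fin(1)] unfolding u_def by (meson leD)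
        then have "f (fst p) = \<zero>" using splits_subset[OF p(1) uv] by (simp add: F_def)
        then show ?thesis using carrierD[OF g] by simp
      next
        assume "snd p > v"
        then have "snd p \<notin> G" using Max_ge[OF fin(2)] unfolding v_def by (meson leD)
        then have "g (snd p) = \<zero>" using splits_subset[OF p(1) uv] by (simp add: G_def)
        then show ?thesis using carrierD[OF f] by simp
      qed
    qed
    have "(f \<otimes>\<^bsub>R\<^esub> g) (u + v) = (\<Oplus>p\<in>splits (u + v). f (fst p) \<otimes> g (snd p))"
      using T[OF uv] by (simp add: mult_apply)
    also have "\<dots> = (\<Oplus>p\<in>splits (u + v). if (u, v) = p then f (fst p) \<otimes> g (snd p) else \<zero>)"
      using zero carrierD[OF f] carrierD[OF g] by (intro add.finprod_cong') auto
    also have "\<dots> = f u \<otimes> g v"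
      using add.finprod_singleton[of "(u, v)" "splits (u + v)" "\<lambda>p. f (fst p) \<otimes> g (snd p)"]
        carrierD[OF f] carrierD[OF g] by (simp add: finite_splits) (simp add: splits_def)
    finally have "f u \<otimes> g v = \<zero>" using fg uv by (simp add: vanishing_on_def)
    then have "f u = \<zero> \<or> g v = \<zero>" using integral carrierD[OF f] carrierD[OF g] by blast
    then show False using u v by (simp add: F_def G_def)
  qed
qed

lemma vanishing_on_antimono: "T \<subseteq> T' \<Longrightarrow> vanishing_on T' \<subseteq> vanishing_on T"
  by (auto simp: vanishing_on_def)

text \<open>Only dimension 2 occurs in the construction, so the growth hypothesis is quadratic and
  the chain of primes comes from the coordinate plane of the variables 0 and 1.\<close>

lemma krull_dim_R:
  assumes growth: "\<And>L. card {u \<in> M. size u \<le> L} \<le> C * (L + 1)\<^sup>2"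
    and plane: "\<And>u. set_mset u \<subseteq> {0, 1} \<Longrightarrow> u \<in> M"
  shows "krull_dim R = enat 2"
proof (rule antisym)
  let ?chain = "\<lambda>n P. (\<forall>i\<le>n. primeideal (P i) R) \<and> (\<forall>i<n. P i \<subset> P (Suc i))"
  have upper: "n \<le> 2" if chain: "?chain n P" for n :: nat and P
  proof (rule ccontr)
    assume "\<not> n \<le> 2"
    then have n: "3 \<le> n" by simp
    have "primeideal (P i) R" if "i \<le> 3" for i by (rule mp[OF spec[OF conjunct1[OF chain]] order_trans[OF that n]])
    moreover have "P i \<subset> P (Suc i)" if "i < 3" for i by (rule mp[OF spec[OF conjunct2[OF chain]] less_le_trans[OF that n]])
    ultimately show False by (rule no_long_prime_chain[OF growth])
  qed
  then show "krull_dim R \<le> enat 2"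
    unfolding krull_dim_def
  proof (intro Sup_least)
    fix d assume "d \<in> {enat n |n. \<exists>P. ?chain n P}"
    then have "\<exists>n. d = enat n \<and> (\<exists>P. ?chain n P)" by (rule CollectD)
    then obtain n where "d = enat n \<and> (\<exists>P. ?chain n P)" ..
    note n = conjunct1[OF this] conjunct2[OF this]
    from n(2) obtain P where "?chain n P" ..
    then have "n \<le> 2" by (rule upper)
    then show "d \<le> enat 2" by (simp only: n(1) enat_ord_simps)
  qed
  \<comment> \<open>The variable sets are {0, 1}, {0} and the empty set.\<close>
  define P where "P i = vanishing_on {..<2 - i}" for i :: nat
  have prime: "primeideal (P i) R" for i
    unfolding P_def
  proof (rule vanishing_on_prime)
    fix u :: "nat multiset"
    have "{..<2 - i} \<subseteq> {0, 1}" by auto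
    then show "set_mset u \<subseteq> {..<2 - i} \<Longrightarrow> u \<in> M" using plane by blast
  qed
  have step: "P i \<subset> P (Suc i)" if "i < 2" for i
  proof
    have "{..<2 - Suc i} \<subseteq> {..<2 - i}" by auto
    then show "P i \<subseteq> P (Suc i)" unfolding P_def by (rule vanishing_on_antimono)
    \<comment> \<open>The variable dropped in step \<open>i\<close> is 1 for \<open>i = 0\<close>
      and 0 for \<open>i = 1\<close>; it separates the two primes.\<close>
    have "{#1 - i#} \<in> M" by (rule plane) (cases i, auto)
    then have dc: "delta {#1 - i#} \<in> carrier R" by (rule delta_carrier)
    have "delta {#1 - i#} u = \<zero>" if "set_mset u \<subseteq> {..<2 - Suc i}" for u
      using that \<open>i < 2\<close> by (auto simp: delta_def)
    then have "delta {#1 - i#} \<in> P (Suc i)" using dc by (simp add: P_def vanishing_on_def)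
    moreover have "delta {#1 - i#} \<notin> P i"
    proof
      assume "delta {#1 - i#} \<in> P i"
      then have "set_mset {#1 - i#} \<subseteq> {..<2 - i} \<longrightarrow> delta {#1 - i#} {#1 - i#} = \<zero>"
        unfolding P_def vanishing_on_def by blast
      then show False using \<open>i < 2\<close> by (simp add: delta_def)
    qed
    ultimately show "P i \<noteq> P (Suc i)" by metis
  qed
  have chain: "?chain 2 P" by (intro conjI allI impI) (rule prime, erule step)
  then have "\<exists>P. ?chain 2 P" by (rule exI[where x = P])
  then have "enat 2 = enat 2 \<and> (\<exists>P. ?chain 2 P)" by (rule conjI[OF refl])
  then have "enat 2 \<in> {enat n |n. \<exists>P. ?chain n P}" by (intro CollectI) (rule exI[where x = 2])
  then show "enat 2 \<le> krull_dim R" unfolding krull_dim_def by (rule Sup_upper)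
qed

end

section \<open>Staircases\<close>

text \<open>The successor is a premise so that the rule also applies when the numbers of variables
  are numerals such as 3 and 2.\<close>

lemma slice_Collect:
  assumes "t = Suc s"
  shows "slice s {u \<in> monomials t. P u} k = {u \<in> monomials s. P (u + replicate_mset k s)}"
proof -
  have "u + replicate_mset k s \<in> monomials t" if "u \<in> monomials s" for u
    using that assms by (auto simp: monomials_def less_SucI)
  then show ?thesis by (auto simp: slice_def)
qed

lemma counting_series_empty: "counting_series {} = 0"
  by (rule fps_ext) (simp add: counting_series_def)

lemma counting_series_finite_slices:
  assumes "M \<subseteq> monomials (Suc s)" "\<And>k. k \<ge> K \<Longrightarrow> slice s M k = {}"
  shows "counting_series M = (\<Sum>k<K. fps_X ^ k * counting_series (slice s M k))"
proof -
  obtain G where G: "G * (1 - fps_X) = counting_series (slice s M K)"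
    "counting_series M = (\<Sum>k<K. fps_X ^ k * counting_series (slice s M k)) + fps_X ^ K * G"
    using counting_series_slices[OF assms(1), of K] assms(2) by auto
  have "G * (1 - fps_X) = 0" using G(1) assms(2)[of K] by (simp add: counting_series_empty)
  then have "G = 0" using one_minus_X_nonzero by simp
  then show ?thesis using G(2) by simp
qed

lemma pole_form_finite_slices:
  assumes "M \<subseteq> monomials t" "t = Suc s" "\<And>k. k \<ge> K \<Longrightarrow> slice s M k = {}"
    and "\<And>k. k < K \<Longrightarrow> pole_form D (counting_series (slice s M k)) (p k)"
  shows "pole_form D (counting_series M) (\<Sum>k<K. monom 1 k * p k)"
proof -
  have eq: "counting_series M = (\<Sum>k<K. fps_X ^ k * counting_series (slice s M k))"
    using assms(1-3) by (intro counting_series_finite_slices) auto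
  show ?thesis unfolding eq
    by (rule pole_form_sum, rule pole_form_shift, rule assms(4)) simp
qed

lemma count_monomial_0: "u \<in> monomials s \<Longrightarrow> i \<ge> s \<Longrightarrow> count u i = 0"
  by (auto simp: monomials_def count_eq_zero_iff)

lemma not_in_monomial: "u \<in> monomials s \<Longrightarrow> i \<ge> s \<Longrightarrow> i \<notin># u"
  by (auto simp: monomials_def)

lemma pole_form_monomials: "pole_form s (counting_series (monomials s)) 1"
proof (induction s)
  case 0
  show ?case using counting_series_monomials_0[of "monomials 0"] by (simp add: monomials_def)
next
  case (Suc s)
  have sl: "slice s (monomials (Suc s)) k = monomials s" for k
    using slice_Collect[of "Suc s" s "\<lambda>_. True" k] by simp
  obtain G where "G * (1 - fps_X) = counting_series (monomials s)"
    "counting_series (monomials (Suc s)) = fps_X ^ 0 * G"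
    using counting_series_slices[of "monomials (Suc s)" s 0] by (auto simp: sl)
  then show ?case using Suc by (simp add: pole_form_Suc_iff)
qed

text \<open>The thickened plane: two free variables and a third with exponent below n, hence a
  numerator of multiplicity n.\<close>

lemma pole_form_plane:
  "pole_form 2 (counting_series {u \<in> monomials 3. count u 2 < n}) (Psi n)"
proof -
  let ?M = "{u \<in> monomials 3. count u 2 < n}"
  have sl: "slice 2 ?M k = (if k < n then monomials 2 else {})" for k
    by (subst slice_Collect) (auto simp: count_monomial_0)
  have "pole_form 2 (counting_series ?M) (\<Sum>k<n. monom 1 k * 1)"
    by (rule pole_form_finite_slices[of _ 3 2]) (unfold sl, auto simp: pole_form_monomials)
  then show ?thesis by (simp add: Psi_def)
qed

lemma pole_form_segment:
  "pole_form 0 (counting_series {u \<in> monomials 1. count u 0 \<le> m}) (Psi (Suc m))"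
proof -
  let ?M = "{u \<in> monomials 1. count u 0 \<le> m}"
  have sl: "slice 0 ?M k = (if k < Suc m then monomials 0 else {})" for k
    by (subst slice_Collect) (auto simp: count_monomial_0)
  have "pole_form 0 (counting_series ?M) (\<Sum>k<Suc m. monom 1 k * 1)"
    by (rule pole_form_finite_slices[of _ 1 0]) (unfold sl, auto simp: pole_form_monomials)
  then show ?thesis by (simp add: Psi_def)
qed

text \<open>A rectangle graded by the coordinate sum splits into a border hook, first row and last
  column, that meets each degree once, and a smaller rectangle shifted by one.\<close>

lemma Psi_mult_Suc: "Psi (Suc u) * Psi (Suc v) = Psi (Suc (u + v)) + monom 1 1 * (Psi u * Psi v)"
proof -
  define t :: "int poly" where "t = monom 1 1"
  have P: "(1 - t) * Psi m = 1 - t ^ m" for m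
    using one_minus_times_Psi[of m] by (simp add: t_def monom_power)
  have "(1 - t) ^ 2 * (Psi (Suc u) * Psi (Suc v)) = ((1 - t) * Psi (Suc u)) * ((1 - t) * Psi (Suc v))"
    by (simp add: power2_eq_square ac_simps)
  also have "\<dots> = (1 - t) * ((1 - t) * Psi (Suc (u + v))) + t * (((1 - t) * Psi u) * ((1 - t) * Psi v))"
    unfolding P by (simp add: algebra_simps power_add)
  also have "\<dots> = (1 - t) ^ 2 * (Psi (Suc (u + v)) + t * (Psi u * Psi v))"
    by (simp add: power2_eq_square algebra_simps)
  finally have "(1 - t) ^ 2 * (Psi (Suc u) * Psi (Suc v)) = (1 - t) ^ 2 * (Psi (Suc (u + v)) + t * (Psi u * Psi v))" .
  moreover have "coeff (1 - t) 0 = 1" by (simp add: t_def)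
  then have "1 - t \<noteq> 0" by (metis coeff_0 zero_neq_one)
  ultimately show ?thesis unfolding t_def by simp
qed

text \<open>Peeling off hooks repeatedly decomposes the rectangle into symmetric chains; these
  become the rows of the nested regions.\<close>

lemma Psi_mult_eq_sum:
  "u \<le> v \<Longrightarrow> Psi u * Psi v = (\<Sum>k<u. monom 1 k * Psi (u + v - 1 - 2 * k))"
proof (induction u arbitrary: v)
  case (Suc u)
  then obtain w where v: "v = Suc w" by (cases v) auto
  have "Psi (Suc u) * Psi v = Psi (Suc (u + w)) + monom 1 1 * (\<Sum>k<u. monom 1 k * Psi (u + w - 1 - 2 * k))"
    using Suc v by (simp add: Psi_mult_Suc)
  also have "monom 1 1 * (\<Sum>k<u. monom 1 k * Psi (u + w - 1 - 2 * k))
      = (\<Sum>k<u. monom 1 (Suc k) * Psi (Suc u + v - 1 - 2 * Suc k))"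
    unfolding sum_distrib_left
  proof (rule sum.cong[OF refl])
    fix k assume "k \<in> {..<u}"
    have "u + w - 1 - 2 * k = Suc u + v - 1 - 2 * Suc k" by (simp add: v)
    then show "monom 1 1 * (monom 1 k * Psi (u + w - 1 - 2 * k)) = monom 1 (Suc k) * Psi (Suc u + v - 1 - 2 * Suc k)"
      by (simp add: mult_monom flip: mult.assoc)
  qed
  also have "Psi (Suc (u + w)) + \<dots> = (\<Sum>k<Suc u. monom 1 k * Psi (Suc u + v - 1 - 2 * k))"
    unfolding sum.lessThan_Suc_shift by (simp add: v monom_0)
  finally show ?case .
qed simp

text \<open>Unlike the $u \times v$ rectangles, which have the same Hilbert functions, these regions are
  nested as soon as \<open>u\<close> and \<open>u + v\<close> decrease.\<close>

lemma pole_form_region: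
  assumes "u \<le> v"
  shows "pole_form 0 (counting_series {m \<in> monomials 2. count m 1 < u \<and> count m 0 + 2 * count m 1 \<le> u + v - 2})
    (Psi u * Psi v)"
proof -
  let ?M = "{m \<in> monomials 2. count m 1 < u \<and> count m 0 + 2 * count m 1 \<le> u + v - 2}"
  have sl: "slice 1 ?M k = (if k < u then {m \<in> monomials 1. count m 0 \<le> u + v - 2 - 2 * k} else {})" for k
    using assms by (subst slice_Collect) (auto simp: count_monomial_0)
  have "pole_form 0 (counting_series ?M) (\<Sum>k<u. monom 1 k * Psi (Suc (u + v - 2 - 2 * k)))"
    by (rule pole_form_finite_slices[of _ 2 1]) (unfold sl, auto intro: pole_form_segment simp del: One_nat_def)
  also have "(\<Sum>k<u. monom 1 k * Psi (Suc (u + v - 2 - 2 * k))) = Psi u * Psi v"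
    unfolding Psi_mult_eq_sum[OF assms]
  proof (rule sum.cong[OF refl])
    fix k assume "k \<in> {..<u}"
    then have "Suc (u + v - 2 - 2 * k) = u + v - 1 - 2 * k" using assms by simp
    then show "monom 1 k * Psi (Suc (u + v - 2 - 2 * k)) = monom 1 k * Psi (u + v - 1 - 2 * k)" by simp
  qed
  finally show ?thesis .
qed

lemma pole_form_thick_region:
  assumes "u \<le> v"
  shows "pole_form 0 (counting_series {m \<in> monomials 3. count m 2 < b \<and> count m 1 < u \<and>
      count m 0 + 2 * count m 1 \<le> u + v - 2}) (Psi b * (Psi u * Psi v))"
proof -
  let ?M = "{m \<in> monomials 3. count m 2 < b \<and> count m 1 < u \<and> count m 0 + 2 * count m 1 \<le> u + v - 2}"
  have sl: "slice 2 ?M k = (if k < b then {m \<in> monomials 2. count m 1 < u \<and> count m 0 + 2 * count m 1 \<le> u + v - 2} else {})" for k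
    by (subst slice_Collect) (auto simp: count_monomial_0)
  have "pole_form 0 (counting_series ?M) (\<Sum>k<b. monom 1 k * (Psi u * Psi v))"
    by (rule pole_form_finite_slices[of _ 3 2]) (unfold sl, use pole_form_region[OF assms] in auto)
  then show ?thesis by (simp add: Psi_def[of b] sum_distrib_right)
qed

text \<open>Layers are indexed by the exponent of variable 3. Layer 0 is the thickened plane; layer
  \<open>i\<close> is a finite region with the series of a box with sides \<open>b\<close>,
  \<open>u i\<close> and \<open>v i\<close>. Monotonicity of \<open>u\<close> and
  \<open>u + v\<close>, with b <= n, makes the layers nested, and \<open>1 \<le> u 1\<close> makes
  \<open>q\<close> nonzero.\<close>

locale staircase =
  fixes n b r :: nat and u v :: "nat \<Rightarrow> nat"
  assumes b: "1 \<le> b" "b \<le> n" and r: "1 \<le> r" "1 \<le> u 1"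
    and uv: "\<And>i. 1 \<le> i \<Longrightarrow> i \<le> r \<Longrightarrow> u i \<le> v i"
    and u_antimono: "\<And>i j. 1 \<le> i \<Longrightarrow> i \<le> j \<Longrightarrow> j \<le> r \<Longrightarrow> u j \<le> u i"
    and uv_antimono: "\<And>i j. 1 \<le> i \<Longrightarrow> i \<le> j \<Longrightarrow> j \<le> r \<Longrightarrow> u j + v j \<le> u i + v i"
begin

definition region :: "nat \<Rightarrow> nat multiset \<Rightarrow> bool" where
  "region i m \<longleftrightarrow> (if i = 0 then count m 2 < n else
     i \<le> r \<and> count m 2 < b \<and> count m 1 < u i \<and> count m 0 + 2 * count m 1 \<le> u i + v i - 2)"

definition M :: "nat multiset set" where
  "M = {m \<in> monomials 4. region (count m 3) m}"

text \<open>The series of the finite layers. Over the denominator (1 - t)^2 of the plane it acquires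
  the factor (1 - t)^2 in the numerator.\<close>

definition q :: "int poly" where
  "q = Psi b * (\<Sum>i=1..r. monom 1 i * (Psi (u i) * Psi (v i)))"

lemma region_antimono:
  assumes "region j m" "i \<le> j" "k \<subseteq># m"
  shows "region i k"
proof -
  have c: "count k x \<le> count m x" for x using assms(3) by (simp add: mset_subset_eq_count)
  show ?thesis
  proof (cases "i = 0")
    case True
    then show ?thesis using assms(1) b(2) c[of 2] by (auto simp: region_def split: if_splits)
  next
    case False
    then have j: "j \<noteq> 0" "j \<le> r" using assms by (auto simp: region_def split: if_splits)
    have "u j \<le> u i" "u j + v j \<le> u i + v i"
      using False assms(2) j by (auto intro!: u_antimono uv_antimono)
    then show ?thesis using False j assms(1,2) c[of 0] c[of 1] c[of 2] by (auto simp: region_def)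
  qed
qed

lemma downset_M: "downset M"
  unfolding downset_def M_def
proof (intro ballI allI impI)
  fix m k assume m: "m \<in> {m \<in> monomials 4. region (count m 3) m}" and k: "k \<subseteq># m"
  have "k \<in> monomials 4" using m set_mset_mono[OF k] by (auto simp: monomials_def)
  moreover have "region (count k 3) k"
    using m k by (auto intro: region_antimono mset_subset_eq_count)
  ultimately show "k \<in> {m \<in> monomials 4. region (count m 3) m}" by simp
qed

lemma pole_form_M: "pole_form 2 (counting_series M) (Psi n + q * [:1, -1:] ^ 2)"
proof -
  define p where "p i = (if i = 0 then Psi n else Psi b * (Psi (u i) * Psi (v i)) * [:1, -1:] ^ 2)" for i
  have sl: "slice 3 M i = {m \<in> monomials 3. region i m}" for i
    unfolding M_def by (subst slice_Collect) (auto simp: count_monomial_0 not_in_monomial region_def)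
  have "pole_form 2 (counting_series (slice 3 M i)) (p i)" if "i < Suc r" for i
  proof (cases "i = 0")
    case True
    then show ?thesis using pole_form_plane[of n] by (simp add: sl p_def region_def)
  next
    case False
    then show ?thesis
      using pole_form_add_exponent[OF pole_form_thick_region[of "u i" "v i" b], of 2, unfolded add_0_left]
        uv[of i] that
      by (simp add: sl p_def region_def)
  qed
  moreover have "slice 3 M i = {}" if "i \<ge> Suc r" for i
    using that by (auto simp: sl region_def)
  moreover have "M \<subseteq> monomials 4" by (auto simp: M_def)
  ultimately have "pole_form 2 (counting_series M) (\<Sum>i<Suc r. monom 1 i * p i)"
    by (intro pole_form_finite_slices[of _ 4 3]) auto
  also have "(\<Sum>i<Suc r. monom 1 i * p i) = Psi n + (\<Sum>i<r. monom 1 (Suc i) * p (Suc i))"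
    unfolding sum.lessThan_Suc_shift by (simp add: p_def monom_0)
  also have "(\<Sum>i<r. monom 1 (Suc i) * p (Suc i)) = (\<Sum>i=1..r. monom 1 i * p i)"
    by (rule sum.reindex_bij_witness[of _ "\<lambda>i. i - 1" Suc]) auto
  also have "\<dots> = q * [:1, -1:] ^ 2"
    unfolding q_def sum_distrib_left sum_distrib_right
    by (rule sum.cong) (simp_all only: p_def atLeastAtMost_iff ac_simps, auto)
  finally show ?thesis .
qed

text \<open>The exponents of variables 2 and 3 are bounded, so only two exponents grow with the
  degree.\<close>

lemma growth: "card {m \<in> M. size m \<le> L} \<le> n * (r + 1) * (L + 1)\<^sup>2"
proof -
  let ?A = "{m \<in> M. size m \<le> L}"
  define f where "f m = ((count m 2, count m 3), (count m 0, count m 1))" for m :: "nat multiset"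
  have "inj_on f ?A"
  proof (rule inj_onI)
    fix x y assume "x \<in> ?A" "y \<in> ?A" and f: "f x = f y"
    then have xy: "x \<in> monomials 4" "y \<in> monomials 4" by (auto simp: M_def)
    show "x = y"
    proof (rule multiset_eqI)
      fix i :: nat
      consider "i = 0" | "i = 1" | "i = 2" | "i = 3" | "i \<ge> 4" by linarith
      then show "count x i = count y i"
        using f count_monomial_0[OF xy(1), of i] count_monomial_0[OF xy(2), of i]
        by cases (auto simp: f_def)
    qed
  qed
  moreover have "f ` ?A \<subseteq> ({..<n} \<times> {..r}) \<times> ({..L} \<times> {..L})"
  proof
    fix z assume "z \<in> f ` ?A"
    then obtain m where m: "m \<in> ?A" "z = f m" by auto
    have "count m i \<le> L" for i using m(1) count_le_size[of m i] by simp
    then show "z \<in> ({..<n} \<times> {..r}) \<times> ({..L} \<times> {..L})"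
      using m b(2) by (auto simp: f_def M_def region_def split: if_splits)
  qed
  ultimately have "card ?A \<le> card (({..<n} \<times> {..r}) \<times> ({..L} \<times> {..L}))"
    by (rule card_inj_on_le) auto
  then show ?thesis by (simp add: card_cartesian_product power2_eq_square algebra_simps)
qed

lemma exists_algebra:
  fixes K :: "('k, 'm) ring_scheme"
  assumes "field K"
  shows "\<exists>(R :: ('k, nat multiset \<Rightarrow> 'k) module) A.
    standard_graded_algebra K R A \<and> is_h_polynomial K R A (Psi n + q * [:1, -1:] ^ 2)"
proof -
  have plane: "m \<in> M" if "set_mset m \<subseteq> {0, 1}" for m
  proof -
    have "count m 2 = 0" "count m 3 = 0" using that by (auto simp: count_eq_zero_iff)
    then show ?thesis using that b by (auto simp: M_def monomials_def region_def)
  qed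
  interpret monomial_ring K M 4
    using assms downset_M plane[of "{#}"]
    by (simp add: monomial_ring_def monomial_ring_axioms_def) (auto simp: M_def)
  have "poly (Psi n + q * [:1, -1:] ^ 2) 1 > 0" using b by simp
  moreover have "hilbert_series K R component * (1 - fps_X) ^ 2 = fps_of_poly (Psi n + q * [:1, -1:] ^ 2)"
    using pole_form_M by (simp add: hilbert_series_R pole_form_def)
  ultimately have "is_h_polynomial K R component (Psi n + q * [:1, -1:] ^ 2)"
    unfolding is_h_polynomial_def using krull_dim_R[OF growth plane] by blast
  then show ?thesis using standard_graded_R by blast
qed

end

section \<open>Cyclotomic polynomials that are not of type CI\<close>

lemma norm_eq_1_if_power:
  fixes z :: complex
  assumes "norm (z ^ k) = 1" "k > 0"
  shows "norm z = 1"
  using assms power_eq_imp_eq_base[of "norm z" k 1] by (simp add: norm_power)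

lemma cpoly_diff: "cpoly (p - q) = cpoly p - cpoly q"
  by (rule poly_eqI) simp

lemma cpoly_monom: "cpoly (monom 1 k) = monom 1 k"
  by (rule poly_eqI) simp

lemma unit_roots_mult: "unit_roots p \<Longrightarrow> unit_roots q \<Longrightarrow> unit_roots (p * q)"
  by (auto simp: unit_roots_def cpoly_mult)

lemma unit_roots_Psi:
  assumes "m > 0"
  shows "unit_roots (Psi m)"
  unfolding unit_roots_def
proof (intro allI impI)
  fix z assume "poly (cpoly (Psi m)) z = 0"
  moreover have "cpoly ((1 - monom 1 1) * Psi m) = cpoly (1 - monom 1 m)"
    by (simp only: one_minus_times_Psi)
  then have "poly (cpoly (1 - monom 1 1)) z * poly (cpoly (Psi m)) z = poly (cpoly (1 - monom 1 m)) z"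
    by (metis cpoly_mult poly_mult)
  ultimately have "z ^ m = 1" by (simp add: cpoly_diff cpoly_monom poly_monom)
  then show "norm z = 1" using assms by (intro norm_eq_1_if_power[of z m]) auto
qed

lemma unit_roots_one_plus_monom:
  assumes "k > 0"
  shows "unit_roots (1 + monom 1 k)"
  unfolding unit_roots_def
proof (intro allI impI)
  fix z assume "poly (cpoly (1 + monom 1 k)) z = 0"
  then have "1 + z ^ k = 0" by (simp add: cpoly_add cpoly_monom poly_monom)
  then have "z ^ k = - 1" by (simp add: add_eq_0_iff)
  then show "norm z = 1" using assms by (intro norm_eq_1_if_power[of z k]) auto
qed

lemma unit_roots_trinomial:
  assumes "j > 0"
  shows "unit_roots (1 - monom 1 j + monom 1 (2 * j))"
  unfolding unit_roots_def
proof (intro allI impI)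
  fix z assume "poly (cpoly (1 - monom 1 j + monom 1 (2 * j))) z = 0"
  then have "1 - z ^ j + z ^ (2 * j) = 0" by (simp add: cpoly_add cpoly_diff cpoly_monom poly_monom)
  then have "(1 + z ^ j) * (1 - z ^ j + (z ^ j)\<^sup>2) = 0" by (simp add: power_mult mult.commute[of 2 j])
  then have "1 + (z ^ j) ^ 3 = 0" by (simp add: algebra_simps power2_eq_square power3_eq_cube)
  then have "z ^ (3 * j) = - 1" by (simp add: power_mult mult.commute[of 3 j] add_eq_0_iff)
  then show "norm z = 1" using assms by (intro norm_eq_1_if_power[of z "3 * j"]) auto
qed

text \<open>$\sum (m_i - 1) \le \prod m_i - 1$, with equality only if at most one factor is nontrivial.\<close>

lemma type_CI_extremal:
  assumes "type_CI h" "degree h = n - 1" "poly h 1 = int n" "n > 0"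
  shows "h = Psi n"
proof -
  obtain ms where ms: "\<forall>m\<in>set ms. m > 0" "h = (\<Prod>m\<leftarrow>ms. Psi m)"
    using assms(1) by (auto simp: type_CI_def)
  have "prod_list ms > 0 \<and> degree (\<Prod>m\<leftarrow>ms. Psi m) < prod_list ms \<and> (\<Prod>m\<leftarrow>ms. Psi m) \<noteq> 0
      \<and> poly (\<Prod>m\<leftarrow>ms. Psi m) 1 = int (prod_list ms)
      \<and> (degree (\<Prod>m\<leftarrow>ms. Psi m) = prod_list ms - 1 \<longrightarrow> (\<Prod>m\<leftarrow>ms. Psi m) = Psi (prod_list ms))"
    using ms(1)
  proof (induction ms)
    case (Cons m ms)
    define P d f where "P = prod_list ms" and "d = degree (\<Prod>m\<leftarrow>ms. Psi m)" and "f = (\<Prod>m\<leftarrow>ms. Psi m)"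
    have IH: "P > 0" "d < P" "f \<noteq> 0" "poly f 1 = int P" "d = P - 1 \<Longrightarrow> f = Psi P"
      using Cons unfolding P_def d_def f_def by auto
    have m: "m > 0" using Cons.prems by simp
    have deg: "degree (Psi m * f) = m - 1 + d"
      using IH m by (subst degree_mult_eq) (auto simp: degree_Psi f_def d_def)
    obtain m' P' where mP: "m = Suc m'" "P = Suc P'" using m IH(1) by (meson gr0_conv_Suc)
    have "m - 1 + d < m * P" using IH(2) mP by simp
    moreover have "Psi m * f = Psi (m * P)" if "m - 1 + d = m * P - 1"
    proof -
      \<comment> \<open>The difference between m P - 1 and (m - 1) + (P - 1) is (m - 1) (P - 1), so
        equality means that one of the two numbers is 1.\<close>
      have "m' * P' = 0" "d = P'" using that IH(2) mP by auto
      then show ?thesis using IH(5) mP by auto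
    qed
    ultimately show ?case using IH m deg by (simp add: P_def[symmetric] f_def[symmetric])
  qed simp
  then show ?thesis using assms ms(2) by auto
qed

text \<open>Since q(1) > 0, \<open>h\<close> is not Psi_n, while a type CI polynomial with this
  value and degree would have to be Psi_n.\<close>

lemma (in staircase) exists_counterexample:
  fixes K :: "('k, 'm) ring_scheme"
  assumes K: "field K" and h: "h = Psi n + q * [:1, -1:] ^ 2" and roots: "unit_roots h"
    and deg: "degree h = n - 1"
  shows "\<exists>(R :: ('k, nat multiset \<Rightarrow> 'k) module) A h. standard_graded_algebra K R A \<and>
    cyclotomic_algebra K R A \<and> is_h_polynomial K R A h \<and> poly h 1 = int n \<and> \<not> type_CI h"
proof -
  have "poly q 1 = int b * (\<Sum>i=1..r. int (u i) * int (v i))"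
    by (simp add: q_def poly_sum poly_monom)
  moreover have "int (u 1) * int (v 1) \<le> (\<Sum>i=1..r. int (u i) * int (v i))"
    using r by (intro member_le_sum) auto
  moreover have "int (u 1) * int (v 1) > 0" using r uv[of 1] by simp
  ultimately have "poly q 1 = int b * (\<Sum>i=1..r. int (u i) * int (v i))"
    "0 < (\<Sum>i=1..r. int (u i) * int (v i))" by linarith+
  then have "poly q 1 > 0" using b by (auto intro!: mult_pos_pos)
  then have "q \<noteq> 0" by auto
  then have "h \<noteq> Psi n" by (simp add: h)
  moreover have val: "poly h 1 = int n" by (simp add: h)
  ultimately have "\<not> type_CI h" using type_CI_extremal[OF _ deg] b by auto
  then show ?thesis
    using exists_algebra[OF K] roots val unfolding cyclotomic_algebra_def unit_roots_def h by blast
qed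

section \<open>Three families of counterexamples\<close>

lemma one_minus_monom: "[:1, -1:] = 1 - (monom 1 1 :: int poly)"
  by (simp add: monom_Suc monom_0 one_pCons)

lemma monom_eq_power: "monom 1 k = (monom 1 1 :: int poly) ^ k"
  by (simp add: monom_power)

lemma times_one_minus_Psi: "(1 - monom 1 1) * Psi m = 1 - (monom 1 1) ^ m"
  using one_minus_times_Psi[of m] by (simp add: monom_power)

lemma one_minus_monom_nonzero: "1 - (monom 1 1 :: int poly) \<noteq> 0"
proof -
  have "coeff (1 - (monom 1 1 :: int poly)) 0 = 1" by simp
  then show ?thesis by (metis coeff_0 zero_neq_one)
qed

lemma degree_Psi_products:
  assumes "a > 0" "b > 0" "f \<noteq> 0"
  shows "degree (Psi a * Psi b * f) = (a - 1) + (b - 1) + degree f"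
  using assms by (simp add: degree_mult_eq degree_Psi)

lemma degree_one_plus_monom: "degree (1 + monom 1 k :: int poly) = k" if "k > 0"
  using that by (simp add: degree_add_eq_right degree_monom_eq)

lemma degree_trinomial: "degree (1 - monom 1 j + monom 1 (2 * j) :: int poly) = 2 * j" if "j > 0"
proof -
  have "degree (1 - monom 1 j :: int poly) \<le> max (degree (1 :: int poly)) (degree (monom 1 j :: int poly))"
    by (rule degree_diff_le_max)
  then have "degree (1 - monom 1 j :: int poly) < degree (monom 1 (2 * j) :: int poly)"
    using that by (simp add: degree_monom_eq)
  then show ?thesis by (simp add: degree_add_eq_right degree_monom_eq)
qed

definition has_counterexample :: "('k, 'm) ring_scheme \<Rightarrow> nat \<Rightarrow> bool" where
  "has_counterexample K n \<longleftrightarrow> (\<exists>(R :: ('k, nat multiset \<Rightarrow> 'k) module) A h.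
    standard_graded_algebra K R A \<and> cyclotomic_algebra K R A \<and> is_h_polynomial K R A h \<and>
    poly h 1 = int n \<and> \<not> type_CI h)"

text \<open>The exponent 3 k - 1 gives value 4 k and degree 4 k - 1. After division by Psi_k the
  identity is (1 + t) (1 + t^(3k-1)) = 1 + t^k + t^(2k) + t^(3k) + t (1 - t^(k-1)) (1 - t^(2k-1));
  the last product supplies the single layer, nonempty because k >= 2.\<close>

lemma counterexample_multiple_of_4:
  assumes K: "field K" and k: "k \<ge> 2"
  shows "has_counterexample K (4 * k)"
proof -
  interpret S: staircase "4 * k" k 1 "\<lambda>_. k - 1" "\<lambda>_. 2 * k - 1"
    using k by unfold_locales auto
  obtain j where j: "k = Suc j" using k by (cases k) auto
  define t :: "int poly" where "t = monom 1 1"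
  define s where "s = t ^ j"
  define h where "h = Psi 2 * Psi k * (1 + monom 1 (3 * k - 1))"
  have P: "(1 - t) * Psi m = 1 - t ^ m" for m unfolding t_def by (rule times_one_minus_Psi)
  \<comment> \<open>With every power written through \<open>t\<close> and \<open>s\<close> =
    t^(k-1), the identity becomes one between polynomials in two letters.\<close>
  have pw: "t ^ k = t * s" "t ^ (2 * k - 1) = t * (s * s)" "t ^ (k - 1) = s"
    "t ^ (3 * k - 1) = t * t * (s * s * s)" "t ^ (4 * k) = t * t * t * t * (s * s * s * s)"
    by (simp_all add: s_def j power_mult eval_nat_numeral power_add algebra_simps)
  have m: "monom 1 (3 * k - 1) = t ^ (3 * k - 1)" unfolding t_def by (rule monom_eq_power)
  have Psi2: "Psi 2 = 1 + t" by (simp add: t_def eval_nat_numeral Psi_Suc monom_Suc monom_0 one_pCons)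
  have Sq: "S.q = Psi k * (t * (Psi (k - 1) * Psi (2 * k - 1)))"
    unfolding S.q_def t_def by (simp add: ac_simps)
  have "(1 - t) * h = (1 + t) * ((1 - t) * Psi k) * (1 + t ^ (3 * k - 1))"
    unfolding h_def m Psi2 by (simp only: ac_simps)
  also have "\<dots> = (1 - t) * Psi (4 * k)
      + ((1 - t) * Psi k) * (t * (((1 - t) * Psi (k - 1)) * ((1 - t) * Psi (2 * k - 1))))"
    unfolding P pw by (simp add: algebra_simps)
  also have "\<dots> = (1 - t) * (Psi (4 * k) + S.q * (1 - t) ^ 2)"
    unfolding Sq power2_eq_square by (simp only: distrib_left ac_simps)
  finally have h: "h = Psi (4 * k) + S.q * [:1, -1:] ^ 2"
    using one_minus_monom_nonzero unfolding t_def one_minus_monom by simp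
  have nz: "1 + monom 1 (3 * k - 1) \<noteq> (0 :: int poly)"
    using degree_one_plus_monom[of "3 * k - 1"] k by auto
  have "degree h = 4 * k - 1"
    unfolding h_def using k degree_one_plus_monom[of "3 * k - 1"]
    by (subst degree_Psi_products[OF _ _ nz]) auto
  moreover have "unit_roots h"
    unfolding h_def using k by (intro unit_roots_mult unit_roots_Psi unit_roots_one_plus_monom) auto
  ultimately show ?thesis
    unfolding has_counterexample_def using S.exists_counterexample[OF K h] by blast
qed

text \<open>With b = 2 j + 1, division by Psi_b leaves (1 + t) (1 - t^j + t^(2j)) = 1 + t^b + t (1 -
  t^(j-1)) (1 - t^j). One layer with sides j - 1 and j suffices, and j >= 2 keeps it
  nonempty.\<close>

lemma counterexample_twice_odd:
  assumes K: "field K" and j: "j \<ge> 2"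
  shows "has_counterexample K (2 * (2 * j + 1))"
proof -
  define b where "b = 2 * j + 1"
  interpret S: staircase "2 * b" b 1 "\<lambda>_. j - 1" "\<lambda>_. j"
    using j by unfold_locales (auto simp: b_def)
  obtain i where i: "j = Suc i" using j by (cases j) auto
  define t :: "int poly" where "t = monom 1 1"
  define s where "s = t ^ i"
  define h where "h = Psi 2 * Psi b * (1 - monom 1 j + monom 1 (2 * j))"
  have P: "(1 - t) * Psi m = 1 - t ^ m" for m unfolding t_def by (rule times_one_minus_Psi)
  have pw: "t ^ j = t * s" "t ^ (j - 1) = s" "t ^ b = t * t * t * (s * s)"
    "t ^ (2 * j) = t * t * (s * s)" "t ^ (2 * b) = t * t * t * (s * s) * (t * t * t * (s * s))"
    by (simp_all add: s_def i b_def power_mult eval_nat_numeral power_add algebra_simps)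
  have m: "monom 1 e = t ^ e" for e unfolding t_def by (rule monom_eq_power)
  have Psi2: "Psi 2 = 1 + t" by (simp add: t_def eval_nat_numeral Psi_Suc monom_Suc monom_0 one_pCons)
  have Sq: "S.q = Psi b * (t * (Psi (j - 1) * Psi j))"
    unfolding S.q_def t_def by (simp add: ac_simps)
  have "(1 - t) * h = (1 + t) * ((1 - t) * Psi b) * (1 - t ^ j + t ^ (2 * j))"
    unfolding h_def m Psi2 by (simp only: ac_simps)
  also have "\<dots> = (1 - t) * Psi (2 * b)
      + ((1 - t) * Psi b) * (t * (((1 - t) * Psi (j - 1)) * ((1 - t) * Psi j)))"
    unfolding P pw by (simp add: algebra_simps)
  also have "\<dots> = (1 - t) * (Psi (2 * b) + S.q * (1 - t) ^ 2)"
    unfolding Sq power2_eq_square by (simp only: distrib_left ac_simps)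
  finally have h: "h = Psi (2 * b) + S.q * [:1, -1:] ^ 2"
    using one_minus_monom_nonzero unfolding t_def one_minus_monom by simp
  have nz: "1 - monom 1 j + monom 1 (2 * j) \<noteq> (0 :: int poly)"
    using degree_trinomial[of j] j by auto
  have "degree h = 2 * b - 1"
    unfolding h_def using j degree_trinomial[of j]
    by (subst degree_Psi_products[OF _ _ nz]) (auto simp: b_def)
  moreover have "unit_roots h"
    unfolding h_def using j by (intro unit_roots_mult unit_roots_Psi unit_roots_trinomial) (auto simp: b_def)
  ultimately show ?thesis
    unfolding has_counterexample_def b_def[symmetric] using S.exists_counterexample[OF K h] by blast
qed

text \<open>The pairs c - l and c + l run through an interval centred at c, with c itself met twice
  at l = 0. \<open>staircase_identity\<close> uses this both for consecutive exponents and for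
  multiples of \<open>b\<close>.\<close>

lemma sum_symmetric_pairs:
  fixes X :: "nat \<Rightarrow> 'a::comm_monoid_add"
  shows "m \<le> c \<Longrightarrow> (\<Sum>l\<le>m. X (c - l) + X (c + l)) = (\<Sum>i\<le>2 * m. X (c - m + i)) + X c"
proof (induction m)
  case (Suc m)
  have "(\<Sum>i\<le>2 * Suc m. X (c - Suc m + i)) = (\<Sum>i\<le>Suc (Suc (2 * m)). X (c - Suc m + i))" by simp
  also have "\<dots> = X (c - Suc m) + (\<Sum>i\<le>Suc (2 * m). X (c - Suc m + Suc i))"
    by (simp only: sum.atMost_Suc_shift add_0_right)
  also have "(\<Sum>i\<le>Suc (2 * m). X (c - Suc m + Suc i)) = (\<Sum>i\<le>Suc (2 * m). X (c - m + i))"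
    using Suc.prems by (intro sum.cong) (auto intro!: arg_cong[of _ _ X])
  also have "\<dots> = (\<Sum>i\<le>2 * m. X (c - m + i)) + X (c + Suc m)"
  proof -
    have "c - m + Suc (2 * m) = c + Suc m" using Suc.prems by simp
    then show ?thesis by (simp only: sum.atMost_Suc)
  qed
  finally have "(\<Sum>i\<le>2 * Suc m. X (c - Suc m + i))
      = X (c - Suc m) + ((\<Sum>i\<le>2 * m. X (c - m + i)) + X (c + Suc m))" .
  moreover have "(\<Sum>l\<le>Suc m. X (c - l) + X (c + l))
      = ((\<Sum>i\<le>2 * m. X (c - m + i)) + X c) + (X (c - Suc m) + X (c + Suc m))"
    using Suc by simp
  ultimately show ?case by (simp only: ac_simps)
qed simp

text \<open>Each summand on the right is $t^i (1 - t^{q_i - i})(1 - t^{2mb - q_i - i})$; the exponents $q_i$ and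
  $2mb - q_i$ run through $j, \dots, j + 2m$ and the multiples of $b$, up to boundary terms.\<close>

lemma staircase_identity:
  fixes X :: "nat \<Rightarrow> int poly" and m b :: nat
  defines "c \<equiv> m * b" and "j \<equiv> m * (b - 1)"
  defines "q \<equiv> \<lambda>i. if i \<le> m + 1 then c - (i - 1) else (2 * m + 1 - i) * b"
  assumes m: "m \<ge> 1" and b: "b \<ge> 1"
  shows "(\<Sum>i\<le>2 * m. X i) - (\<Sum>i\<le>2 * m. X (j + i)) + (\<Sum>i\<le>2 * m. X (2 * j + i))
    = (\<Sum>k\<le>2 * m. X (k * b)) + (\<Sum>i=1..2 * m. X i - X (q i) - X (2 * c - q i) + X (2 * c - i))"
proof -
  \<comment> \<open>As j = c - m, the middle block of exponents is centred at c, and the third block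
    is the mirror image of the first under e -> 2 c - e.\<close>
  have mc: "m \<le> c" and j: "j = c - m" using b by (auto simp: c_def j_def diff_mult_distrib2)
  have low: "(\<Sum>i\<le>2 * m. X i) = X 0 + (\<Sum>i=1..2 * m. X i)"
    by (simp add: atMost_atLeast0 sum.atLeast_Suc_atMost)
  have "(\<Sum>i\<le>2 * m. X (2 * j + i)) = (\<Sum>i\<le>2 * m. X (2 * c - i))"
    by (rule sum.reindex_bij_witness[of _ "\<lambda>i. 2 * m - i" "\<lambda>i. 2 * m - i"])
      (use mc in \<open>auto simp: j intro!: arg_cong[of _ _ X]\<close>)
  also have "\<dots> = X (2 * c) + (\<Sum>i=1..2 * m. X (2 * c - i))"
    by (simp add: atMost_atLeast0 sum.atLeast_Suc_atMost)
  finally have high: "(\<Sum>i\<le>2 * m. X (2 * j + i)) = X (2 * c) + (\<Sum>i=1..2 * m. X (2 * c - i))" .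
  have "{1..2 * m} = {1..m + 1} \<union> {m + 2..2 * m}" using m by auto
  then have split: "(\<Sum>i=1..2 * m. X (q i) + X (2 * c - q i))
      = (\<Sum>i=1..m + 1. X (q i) + X (2 * c - q i)) + (\<Sum>i=m + 2..2 * m. X (q i) + X (2 * c - q i))"
    by (simp only:) (rule sum.union_disjoint, auto)
  have "(\<Sum>i=1..m + 1. X (q i) + X (2 * c - q i)) = (\<Sum>l\<le>m. X (c - l) + X (c + l))"
    by (rule sum.reindex_bij_witness[of _ Suc "\<lambda>i. i - 1"])
      (use mc in \<open>auto simp: q_def intro!: arg_cong[of _ _ X]\<close>)
  then have mid: "(\<Sum>i=1..m + 1. X (q i) + X (2 * c - q i)) = (\<Sum>i\<le>2 * m. X (j + i)) + X c"
    using sum_symmetric_pairs[OF mc, of X] by (simp add: j)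
  have "(\<Sum>l\<le>m. X ((m - l) * b) + X ((m + l) * b)) = (\<Sum>k\<le>2 * m. X (k * b)) + X c"
    using sum_symmetric_pairs[of m m "\<lambda>k. X (k * b)"] by (simp add: c_def)
  \<comment> \<open>The term l = 0 is X c twice and l = m gives the exponents 0 and 2 c. These
    boundary terms cancel those split off in \<open>low\<close>, \<open>high\<close> and
    \<open>mid\<close>.\<close>
  moreover have "(\<Sum>l\<le>m. X ((m - l) * b) + X ((m + l) * b))
      = (X c + X c) + (\<Sum>l=1..m - 1. X ((m - l) * b) + X ((m + l) * b)) + (X 0 + X (2 * c))"
  proof -
    have "{..m} = insert 0 (insert m {1..m - 1})" using m by auto
    then have "(\<Sum>l\<le>m. G l) = G 0 + (G m + (\<Sum>l=1..m - 1. G l))" for G :: "nat \<Rightarrow> int poly"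
      using m by (simp del: One_nat_def)
    moreover have "(m + m) * b = 2 * c" by (simp add: c_def)
    ultimately show ?thesis by (simp only: c_def ac_simps) simp
  qed
  moreover have "(\<Sum>l=1..m - 1. X ((m - l) * b) + X ((m + l) * b)) = (\<Sum>i=m + 2..2 * m. X (q i) + X (2 * c - q i))"
  proof (rule sum.reindex_bij_witness[of _ "\<lambda>i. i - (m + 1)" "\<lambda>l. l + (m + 1)"])
    fix l assume l: "l \<in> {1..m - 1}"
    have "q (l + (m + 1)) = (m - l) * b" using l by (simp add: q_def)
    moreover have "(m - l) + (m + l) = 2 * m" using l by auto
    then have "(m - l) * b + (m + l) * b = 2 * c" by (simp only: c_def mult.assoc flip: add_mult_distrib)
    then have "2 * c - (m - l) * b = (m + l) * b" by linarith
    ultimately show "X (q (l + (m + 1))) + X (2 * c - q (l + (m + 1))) = X ((m - l) * b) + X ((m + l) * b)"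
      by simp
  qed auto
  ultimately have multiples: "(\<Sum>k\<le>2 * m. X (k * b))
      = X c + X 0 + X (2 * c) + (\<Sum>i=m + 2..2 * m. X (q i) + X (2 * c - q i))"
    by (simp add: algebra_simps)
  have "(\<Sum>i=1..2 * m. X i - X (q i) - X (2 * c - q i) + X (2 * c - i))
      = (\<Sum>i=1..2 * m. X i) - (\<Sum>i=1..2 * m. X (q i) + X (2 * c - q i)) + (\<Sum>i=1..2 * m. X (2 * c - i))"
    by (simp add: sum.distrib sum_subtractf)
  then show ?thesis unfolding low high split mid multiples by simp
qed

lemma Psi_mult_eq: "Psi (a * b) = Psi b * (\<Sum>k<a. monom 1 (k * b))"
proof -
  define t :: "int poly" where "t = monom 1 1"
  have P: "(1 - t) * Psi m = 1 - t ^ m" for m unfolding t_def by (rule times_one_minus_Psi)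
  have m: "monom 1 e = t ^ e" for e unfolding t_def by (rule monom_eq_power)
  have "(1 - t) * Psi (a * b) = 1 - (t ^ b) ^ a" by (simp add: P mult.commute flip: power_mult)
  also have "\<dots> = (1 - t ^ b) * (\<Sum>k<a. (t ^ b) ^ k)" by (rule one_diff_power_eq)
  also have "\<dots> = (1 - t) * (Psi b * (\<Sum>k<a. monom 1 (k * b)))"
    by (simp add: P[symmetric] m power_mult mult.commute[of _ b] mult.assoc)
  finally show ?thesis using one_minus_monom_nonzero unfolding t_def by simp
qed

text \<open>With a = 2 m + 1, the choice j = m (b - 1) gives Psi_a Psi_b (1 - t^j + t^(2j)) degree a
  b - 1. Dividing by Psi_b and subtracting the multiples of \<open>b\<close> leaves the sum in
  \<open>staircase_identity\<close>, one layer per summand, with sides q_i - i and 2 c - q_i - i.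
  Their sum 2 c - 2 i decreases, and the first side decreases because q does. The hypothesis on
  \<open>b\<close> keeps q decreasing where it passes from c - m to c - b, and ensures q_i >=
  i.\<close>

lemma counterexample_odd:
  assumes K: "field K" and m: "m \<ge> 1" and ab: "2 * m + 1 \<le> b"
  shows "has_counterexample K ((2 * m + 1) * b)"
proof -
  define a c j where "a = 2 * m + 1" and "c = m * b" and "j = m * (b - 1)"
  define q where "q i = (if i \<le> m + 1 then c - (i - 1) else (2 * m + 1 - i) * b)" for i
  have cb: "m * (2 * m + 1) \<le> c" unfolding c_def using ab by (rule mult_le_mono2)
  have c: "2 * m + 1 \<le> c" "m \<le> c" using cb m mult_le_mono1[of 1 m "2 * m + 1"] by auto
  have q_le: "q i \<le> c" for i
  proof (cases "i \<le> m + 1")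
    case False
    then have "2 * m + 1 - i \<le> m" by simp
    then show ?thesis using False by (simp add: q_def c_def)
  qed (simp add: q_def)
  have q_ge: "i \<le> q i" if "1 \<le> i" "i \<le> 2 * m" for i
  proof (cases "i \<le> m + 1")
    case True
    then show ?thesis using c that by (simp add: q_def)
  next
    case False
    have "1 * b \<le> (2 * m + 1 - i) * b" using that by (intro mult_le_mono1) simp
    then have "i \<le> (2 * m + 1 - i) * b" using ab that by linarith
    then show ?thesis using False by (simp add: q_def)
  qed
  have q_antimono: "q k \<le> q i" if "1 \<le> i" "i \<le> k" "k \<le> 2 * m" for i k
  proof -
    consider "k \<le> m + 1" | "i \<le> m + 1" "k > m + 1" | "i > m + 1" by linarith
    then show ?thesis
    proof cases
      case 2
      have "(2 * m + 1 - k) * b \<le> (m - 1) * b" using 2 by (intro mult_le_mono1) simp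
      also have "\<dots> = c - b" by (simp add: c_def diff_mult_distrib)
      also have "\<dots> \<le> c - (i - 1)" using 2 ab by (intro diff_le_mono2) simp
      finally show ?thesis using 2 by (simp add: q_def)
    next
      case 3
      have "(2 * m + 1 - k) * b \<le> (2 * m + 1 - i) * b" using that by (intro mult_le_mono1) simp
      then show ?thesis using 3 that by (simp add: q_def)
    qed (use that in \<open>auto simp: q_def\<close>)
  qed
  interpret S: staircase "a * b" b "2 * m" "\<lambda>i. q i - i" "\<lambda>i. 2 * c - q i - i"
  proof
    show "1 \<le> b" "b \<le> a * b" "1 \<le> 2 * m" using ab m by (auto simp: a_def)
    show "1 \<le> q 1 - 1" using c m by (simp add: q_def)
    show "q i - i \<le> 2 * c - q i - i" for i using q_le[of i] by simp
    show "q k - k \<le> q i - i" if "1 \<le> i" "i \<le> k" "k \<le> 2 * m" for i k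
      using q_antimono[OF that] that by simp
    show "q k - k + (2 * c - q k - k) \<le> q i - i + (2 * c - q i - i)" if "1 \<le> i" "i \<le> k" "k \<le> 2 * m" for i k
      using q_le[of i] q_le[of k] q_ge[of i] q_ge[of k] that by simp
  qed
  define t :: "int poly" where "t = monom 1 1"
  define X :: "nat \<Rightarrow> int poly" where "X e = monom 1 e" for e
  define h where "h = Psi a * Psi b * (1 - monom 1 j + monom 1 (2 * j))"
  have monom_X: "monom 1 e = X e" for e by (simp add: X_def)
  have XX: "X e * X f = X (e + f)" for e f by (simp add: X_def mult_monom)
  have X0: "X 0 = 1" by (simp add: X_def monom_0 one_pCons)
  have P: "(1 - t) * Psi m = 1 - X m" for m
    using one_minus_times_Psi[of m] by (simp add: t_def X_def)
  have Psi_a: "Psi a = (\<Sum>i\<le>2 * m. X i)" by (simp add: Psi_def a_def X_def lessThan_Suc_atMost)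
  \<comment> \<open>The first factor moves exponent i to q_i, the second moves it to 2 c - q_i, and
    both together to 2 c - i.\<close>
  have summand: "X i * (1 - X (q i - i)) * (1 - X (2 * c - q i - i)) = X i - X (q i) - X (2 * c - q i) + X (2 * c - i)"
    if i: "i \<in> {1..2 * m}" for i
  proof -
    have e: "i + (q i - i) = q i" "i + (2 * c - q i - i) = 2 * c - q i"
      "i + ((q i - i) + (2 * c - q i - i)) = 2 * c - i"
      using q_le[of i] q_ge[of i] i by auto
    have "X i * (1 - X (q i - i)) * (1 - X (2 * c - q i - i)) = X i - X (i + (q i - i))
        - X (i + (2 * c - q i - i)) + X (i + ((q i - i) + (2 * c - q i - i)))"
      by (simp add: algebra_simps flip: XX)
    then show ?thesis by (simp only: e)
  qed
  have shift: "(\<Sum>i\<le>2 * m. X (e + i)) = X e * (\<Sum>i\<le>2 * m. X i)" for e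
    by (simp add: sum_distrib_left XX)
  have Psi_ab: "Psi (a * b) = Psi b * (\<Sum>k\<le>2 * m. X (k * b))"
    unfolding Psi_mult_eq by (simp add: X_def a_def lessThan_Suc_atMost)
  have "S.q * (1 - t) ^ 2 = Psi b * (\<Sum>i=1..2 * m. X i * ((1 - t) * Psi (q i - i)) * ((1 - t) * Psi (2 * c - q i - i)))"
    unfolding S.q_def X_def power2_eq_square by (simp only: sum_distrib_right sum_distrib_left ac_simps)
  also have "\<dots> = Psi b * (\<Sum>i=1..2 * m. X i - X (q i) - X (2 * c - q i) + X (2 * c - i))"
    unfolding P using summand by simp
  finally have "Psi (a * b) + S.q * (1 - t) ^ 2 = Psi b * ((\<Sum>k\<le>2 * m. X (k * b))
      + (\<Sum>i=1..2 * m. X i - X (q i) - X (2 * c - q i) + X (2 * c - i)))"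
    by (simp only: Psi_ab distrib_left)
  also have "\<dots> = Psi b * ((\<Sum>i\<le>2 * m. X i) - (\<Sum>i\<le>2 * m. X (j + i)) + (\<Sum>i\<le>2 * m. X (2 * j + i)))"
    using staircase_identity[OF m, of b X] ab unfolding q_def c_def j_def by simp
  also have "\<dots> = h"
    unfolding h_def Psi_a shift monom_X by (simp only: algebra_simps mult_1_left mult_1_right)
  finally have h: "h = Psi (a * b) + S.q * [:1, -1:] ^ 2" by (simp add: t_def one_minus_monom)
  have jpos: "j > 0" using m ab by (simp add: j_def)
  have nz: "1 - monom 1 j + monom 1 (2 * j) \<noteq> (0 :: int poly)"
    using degree_trinomial[OF jpos] jpos by auto
  have "degree h = (a - 1) + (b - 1) + 2 * j"
    unfolding h_def using degree_trinomial[OF jpos] ab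
    by (subst degree_Psi_products[OF _ _ nz]) (auto simp: a_def)
  also have "\<dots> = a * b - 1"
  proof -
    obtain b' where "b = Suc b'" using ab by (cases b) auto
    then show ?thesis by (simp add: a_def j_def algebra_simps)
  qed
  finally have "degree h = a * b - 1" .
  moreover have "unit_roots h"
    unfolding h_def using jpos ab by (intro unit_roots_mult unit_roots_Psi unit_roots_trinomial) (auto simp: a_def)
  ultimately show ?thesis
    unfolding has_counterexample_def a_def[symmetric] using S.exists_counterexample[OF K h] by blast
qed

text \<open>n >= 8 excludes exactly the degenerate parameters of the even families, n = 4 and n = 6.
  For odd n the smaller factor is taken as 2 m + 1.\<close>

lemma counterexample_composite:
  assumes K: "field K" and n: "n \<ge> 8" "\<not> prime n"
  shows "has_counterexample K n"
proof (cases "even n")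
  case True
  then obtain l where l: "n = 2 * l" by (elim evenE)
  show ?thesis
  proof (cases "even l")
    case True
    then obtain k where "l = 2 * k" by (elim evenE)
    then show ?thesis using counterexample_multiple_of_4[OF K, of k] n l by simp
  next
    case False
    then obtain j where "l = 2 * j + 1" by (elim oddE)
    then show ?thesis using counterexample_twice_odd[OF K, of j] n l by simp
  qed
next
  case False
  have "n > 1" using n by simp
  then obtain a where a: "a dvd n" "a \<noteq> 1" "a \<noteq> n" using n(2) prime_nat_iff by blast
  then obtain b where b: "n = a * b" by (elim dvdE)
  have "a \<noteq> 0" "b \<noteq> 0" using b \<open>n > 1\<close> by (metis mult_0 mult_0_right not_less_zero)+
  moreover have "b \<noteq> 1" using a b by auto
  ultimately have "1 < a" "1 < b" using a by auto
  with b obtain a b where ab: "n = a * b" "1 < a" "a \<le> b"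
    by (metis mult.commute nat_le_linear)
  then have "odd a" "odd b" using False by auto
  then obtain m where a: "a = 2 * m + 1" by (elim oddE)
  then have "m \<ge> 1" using ab(2) by simp
  then show ?thesis using counterexample_odd[OF K, of m b] ab a by simp
qed

theorem theorem1p3:
  fixes K :: "('k, 'm) ring_scheme"
  assumes "field K"
  shows
    "(\<forall>(R :: ('k, 'a) module) A h.
        standard_graded_algebra K R A \<and> cyclotomic_algebra K R A \<and> is_h_polynomial K R A h \<and>
        (poly h 1 \<in> {1, 4, 6} \<or> prime (poly h 1)) \<longrightarrow>
        type_CI h) \<and>
     (\<forall>n :: int. n \<ge> 8 \<and> \<not> prime n \<longrightarrow>
        (\<exists>(R :: ('k, nat multiset \<Rightarrow> 'k) module) A h.
          standard_graded_algebra K R A \<and> cyclotomic_algebra K R A \<and> is_h_polynomial K R A h \<and>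
          poly h 1 = n \<and> \<not> type_CI h))"
proof (intro conjI allI impI)
  fix R :: "('k, 'a) module" and A h
  assume "standard_graded_algebra K R A \<and> cyclotomic_algebra K R A \<and> is_h_polynomial K R A h \<and>
    (poly h 1 \<in> {1, 4, 6} \<or> prime (poly h 1))"
  then show "type_CI h" using type_CI_of_cyclotomic[OF assms] by blast
next
  fix n :: int assume n: "n \<ge> 8 \<and> \<not> prime n"
  then have eq: "int (nat n) = n" by simp
  from n have "\<not> prime (nat n)" using prime_int_nat_transfer[of n] by linarith
  moreover have "nat n \<ge> 8" using n by linarith
  ultimately have "has_counterexample K (nat n)" using counterexample_composite[OF assms] by blast
  then show "\<exists>(R :: ('k, nat multiset \<Rightarrow> 'k) module) A h.
      standard_graded_algebra K R A \<and> cyclotomic_algebra K R A \<and> is_h_polynomial K R A h \<and>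
      poly h 1 = n \<and> \<not> type_CI h"
    unfolding has_counterexample_def eq .
qed

end
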